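(* Let $(\mathcal{A},\varphi)$ be a $W^*$-probability space. Let $U,V\in\mathcal{A}$ be free, with $0<U<1$ and $V>0$, $V$ bounded. Assume that for some $c,d\in\mathbb{R}$ $$\mathbb{E}_{V^{1/2}UV^{1/2}}\left[\left(V^{1/2}(1-U)V^{1/2}\right)^{-1}\right]=c\,1_{\mathcal{A}},$$ $$\mathbb{E}_{V^{1/2}UV^{1/2}}\left[\left(V^{1/2}(1-U)V^{1/2}\right)^{-2}\right]=d\,1_{\mathcal{A}}.$$ Then $d>c^2$ and, with $\alpha=\varphi\left(U(1-U)^{-1}\right)$, \begin{itemize} \item $V$ has the free Poisson distribution $\mu\left(\frac{d-c^2}{c^3},\,\frac{c^2\alpha+d}{d-c^2}\right)$, \item $U$ has the free binomial distribution $\nu\left(\frac{c^2\alpha}{d-c^2},\,\frac{d}{d-c^2}\right)$. \end{itemize}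
   Context: A $W^*$-probability space is a pair $(\mathcal{A},\varphi)$ where $\mathcal{A}$ is a finite von Neumann algebra and $\varphi$ is a faithful normal tracial state; $1_{\mathcal{A}}$ (also written $1$) is the unit. Inequalities such as $0<U<1$ and $V>0$ are between self-adjoint elements. Free means free in the sense of Voiculescu with respect to $\varphi$. $\mathbb{E}_X$ denotes the $\varphi$-preserving conditional expectation onto the von Neumann subalgebra generated by $X$ and $1_{\mathcal{A}}$. Free Poisson (Marchenko–Pastur) distribution $\mu(\alpha,\lambda)$, $\alpha,\lambda>0$: $\mu=\max\{0,1-\lambda\}\delta_0+\tilde\mu$, where $\tilde\mu$ is supported on $(\alpha(1-\sqrt\lambda)^2,\alpha(1+\sqrt\lambda)^2)$ with density $\frac{1}{2\pi\alpha x}\sqrt{4\lambda\alpha^2-(x-\alpha(1+\lambda))^2}$. Its $S$-transform is $\frac{1}{\alpha\lambda+\alpha z}$. Free binomial distribution $\nu(\sigma,\theta)$, for $(\sigma,\theta)$ with $\frac{\sigma+\theta}{\sigma+\theta-1}>0$ and $\frac{\sigma\theta}{\sigma+\theta-1}>0$: $\nu=(1-\sigma)\mathbb{I}_{0<\sigma<1}\delta_0+\tilde\nu+(1-\theta)\mathbb{I}_{0<\theta<1}\delta_1$, where $\tilde\nu$ is supported on $(x_-,x_+)$, $x_\pm=\left(\sqrt{\frac{\sigma}{\sigma+\theta}\left(1-\frac{1}{\sigma+\theta}\right)}\pm\sqrt{\frac{1}{\sigma+\theta}\left(1-\frac{\sigma}{\sigma+\theta}\right)}\right)^2$, with density $(\sigma+\theta)\frac{\sqrt{(x-x_-)(x_+-x)}}{2\pi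 x(1-x)}$. Its $S$-transform is $1+\frac{\theta}{\sigma+z}$. Here the $S$-transform is $S_X(z)=\frac{1+z}{z}M_X^{\langle-1\rangle}(z)$ with $M_X(z)=\varphi(zX(1-zX)^{-1})$ and $M_X^{\langle -1\rangle}$ its compositional inverse. The number $\alpha$ in the claim is unrelated to the parameter name in $\mu(\alpha,\lambda)$.
   Formalization: The formal theorem additionally assumes that U and V are not both scalar multiples of the unit; for scalar U and V (e.g. U = 1/2, V = 1, so c = 2, d = 4) one always has d = c², so the claim d > c² fails. *)

theory Defs
  imports "HOL-Probability.Probability"
begin

section \<open>Complex Hilbert spaces and bounded operators\<close>

class scaleC =
  fixes scaleC :: "complex \<Rightarrow> 'a \<Rightarrow> 'a"  (infixr \<open>*\<^sub>C\<close> 75)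

text \<open>
  The norm, metric and completeness come from the real inner product, which is the real part of
  the complex one. \<open>cinner\<close> is linear in its second argument. The zero space is excluded so that
  the operators form a ring with \<open>0 \<noteq> 1\<close>; it carries no state with value \<open>1\<close> at the unit anyway.
\<close>

class chilbert_space = real_inner + complete_space + scaleC +
  fixes cinner :: "'a \<Rightarrow> 'a \<Rightarrow> complex"
  assumes scaleC_add_right: "a *\<^sub>C (x + y) = a *\<^sub>C x + a *\<^sub>C y"
    and scaleC_add_left: "(a + b) *\<^sub>C x = a *\<^sub>C x + b *\<^sub>C x"
    and scaleC_scaleC: "a *\<^sub>C b *\<^sub>C x = (a * b) *\<^sub>C x"
    and scaleC_of_real: "complex_of_real r *\<^sub>C x = r *\<^sub>R x"
    and cinner_commute: "cinner x y = cnj (cinner y x)"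
    and cinner_add_right: "cinner x (y + z) = cinner x y + cinner x z"
    and cinner_scaleC_right: "cinner x (a *\<^sub>C y) = a * cinner x y"
    and Re_cinner: "Re (cinner x y) = inner x y"
    and ex_nonzero: "\<exists>x. x \<noteq> 0"

lemma bounded_linear_scaleC: "bounded_linear (\<lambda>x::'h::chilbert_space. a *\<^sub>C x)"
proof
  fix x y :: 'h and r :: real
  show "a *\<^sub>C (x + y) = a *\<^sub>C x + a *\<^sub>C y" by (rule scaleC_add_right)
  show "a *\<^sub>C (r *\<^sub>R x) = r *\<^sub>R (a *\<^sub>C x)"
    unfolding scaleC_of_real[symmetric] scaleC_scaleC by (simp add: mult.commute)
next
  have "norm (a *\<^sub>C x) = norm x * cmod a" for x :: 'h
  proof -
    have "cinner (a *\<^sub>C x) (a *\<^sub>C x) = a * cnj (cinner x (a *\<^sub>C x))"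
      by (simp only: cinner_scaleC_right[of "a *\<^sub>C x"] cinner_commute[of "a *\<^sub>C x" x])
    also have "\<dots> = a * cnj a * cnj (cinner x x)"
      by (simp add: cinner_scaleC_right)
    also have "\<dots> = a * cnj a * cinner x x"
      by (simp only: cinner_commute[of x x, symmetric])
    also have "\<dots> = complex_of_real ((cmod a)\<^sup>2) * cinner x x"
      by (simp only: complex_norm_square)
    finally have "inner (a *\<^sub>C x) (a *\<^sub>C x) = (cmod a)\<^sup>2 * inner x x"
      by (simp flip: Re_cinner)
    then show ?thesis
      by (simp add: norm_eq_sqrt_inner real_sqrt_mult)
  qed
  then show "\<exists>K. \<forall>x::'h. norm (a *\<^sub>C x) \<le> norm x * K"
    by (intro exI[of _ "cmod a"]) simp
qed

typedef (overloaded) 'h bounded_op =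
  "{f :: 'h::chilbert_space \<Rightarrow> 'h. bounded_linear f \<and> (\<forall>a x. f (a *\<^sub>C x) = a *\<^sub>C f x)}"
  morphisms apply_op Bounded_op
  by (rule exI[of _ id]) (simp add: bounded_linear_ident id_def)

setup_lifting type_definition_bounded_op

instantiation bounded_op :: (chilbert_space) "{ring_1, scaleC}"
begin

lift_definition zero_bounded_op :: "'a bounded_op" is "\<lambda>_. 0"
  by (simp add: bounded_linear_zero linear_0[OF bounded_linear.linear[OF bounded_linear_scaleC]])

lift_definition one_bounded_op :: "'a bounded_op" is "\<lambda>x. x"
  by (simp add: bounded_linear_ident)

lift_definition plus_bounded_op :: "'a bounded_op \<Rightarrow> 'a bounded_op \<Rightarrow> 'a bounded_op"
  is "\<lambda>f g x. f x + g x"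
  by (simp add: bounded_linear_add scaleC_add_right)

lift_definition uminus_bounded_op :: "'a bounded_op \<Rightarrow> 'a bounded_op" is "\<lambda>f x. - f x"
  by (simp add: bounded_linear_minus linear_neg[OF bounded_linear.linear[OF bounded_linear_scaleC]])

lift_definition minus_bounded_op :: "'a bounded_op \<Rightarrow> 'a bounded_op \<Rightarrow> 'a bounded_op"
  is "\<lambda>f g x. f x - g x"
  by (simp add: bounded_linear_sub linear_diff[OF bounded_linear.linear[OF bounded_linear_scaleC]])

lift_definition times_bounded_op :: "'a bounded_op \<Rightarrow> 'a bounded_op \<Rightarrow> 'a bounded_op"
  is "\<lambda>f g x. f (g x)"
  by (simp add: bounded_linear_compose)

lift_definition scaleC_bounded_op :: "complex \<Rightarrow> 'a bounded_op \<Rightarrow> 'a bounded_op"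
  is "\<lambda>a f x. a *\<^sub>C f x"
  by (simp add: bounded_linear_compose[OF bounded_linear_scaleC] scaleC_scaleC mult.commute)

instance
proof
  fix a b c :: "'a bounded_op"
  show "a + b + c = a + (b + c)" by transfer (simp add: add.assoc)
  show "a + b = b + a" by transfer (simp add: add.commute)
  show "0 + a = a" by transfer simp
  show "- a + a = 0" by transfer simp
  show "a - b = a + - b" by transfer simp
  show "a * b * c = a * (b * c)" by transfer simp
  show "1 * a = a" by transfer simp
  show "a * 1 = a" by transfer simp
  show "(a + b) * c = a * c + b * c" by transfer simp
  show "a * (b + c) = a * b + a * c"
    by transfer (use linear_add bounded_linear.linear in blast)
  show "(0::'a bounded_op) \<noteq> 1"
  proof
    assume "(0::'a bounded_op) = 1"
    then have "(\<lambda>_. 0) = (\<lambda>x::'a. x)" by transfer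
    then show False using ex_nonzero by metis
  qed
qed

end

definition is_adjoint :: "'h::chilbert_space bounded_op \<Rightarrow> 'h bounded_op \<Rightarrow> bool" where
  "is_adjoint S T \<longleftrightarrow> (\<forall>x y. cinner (apply_op S x) y = cinner x (apply_op T y))"

text \<open>Existence of the adjoint is the Riesz representation theorem.\<close>

definition adj :: "'h::chilbert_space bounded_op \<Rightarrow> 'h bounded_op" where
  "adj S = (THE T. is_adjoint S T)"

definition self_adjoint :: "'h::chilbert_space bounded_op \<Rightarrow> bool" where
  "self_adjoint S \<longleftrightarrow> is_adjoint S S"

definition positive_op :: "'h::chilbert_space bounded_op \<Rightarrow> bool" where
  "positive_op S \<longleftrightarrow> self_adjoint S \<and> (\<forall>x. 0 \<le> Re (cinner x (apply_op S x)))"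

definition op_le :: "'h::chilbert_space bounded_op \<Rightarrow> 'h bounded_op \<Rightarrow> bool" where
  "op_le S T \<longleftrightarrow> positive_op (T - S)"

text \<open>
  \<open>strictly_less S T\<close> says that \<open>T - S\<close> is positive with trivial kernel; for a faithful
  normal state this means that its distribution lives on \<open>(0, \<infinity>)\<close>. Invertibility
  of \<open>T - S\<close> is not required.
\<close>

definition strictly_less :: "'h::chilbert_space bounded_op \<Rightarrow> 'h bounded_op \<Rightarrow> bool" where
  "strictly_less S T \<longleftrightarrow>
    self_adjoint S \<and> self_adjoint T \<and>
    (\<forall>x. x \<noteq> 0 \<longrightarrow> 0 < Re (cinner x (apply_op (T - S) x)))"

definition op_invertible :: "'a::monoid_mult \<Rightarrow> bool" where
  "op_invertible X \<longleftrightarrow> (\<exists>Y. X * Y = 1 \<and> Y * X = 1)"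

definition op_inverse :: "'a::monoid_mult \<Rightarrow> 'a" where
  "op_inverse X = (THE Y. X * Y = 1 \<and> Y * X = 1)"

text \<open>
  Two scalars \<open>0 < U < 1\<close>, \<open>V > 0\<close> are free and have constant regressions with \<open>d = c\<^sup>2\<close>;
  this degenerate case has to be excluded.
\<close>

definition is_scalar :: "'h::chilbert_space bounded_op \<Rightarrow> bool" where
  "is_scalar X \<longleftrightarrow> (\<exists>c. X = c *\<^sub>C 1)"


section \<open>Tracial von Neumann algebras\<close>

definition commutant :: "'a::times set \<Rightarrow> 'a set" where
  "commutant A = {b. \<forall>a\<in>A. a * b = b * a}"

definition von_neumann_algebra :: "'h::chilbert_space bounded_op set \<Rightarrow> bool" where
  "von_neumann_algebra A \<longleftrightarrow> (\<forall>a\<in>A. adj a \<in> A) \<and> commutant (commutant A) = A"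

definition finite_von_neumann_algebra :: "'h::chilbert_space bounded_op set \<Rightarrow> bool" where
  "finite_von_neumann_algebra A \<longleftrightarrow>
    von_neumann_algebra A \<and> (\<forall>v\<in>A. adj v * v = 1 \<longrightarrow> v * adj v = 1)"

definition linear_on :: "'h::chilbert_space bounded_op set \<Rightarrow> ('h bounded_op \<Rightarrow> complex) \<Rightarrow> bool" where
  "linear_on A \<phi> \<longleftrightarrow>
    (\<forall>a\<in>A. \<forall>b\<in>A. \<phi> (a + b) = \<phi> a + \<phi> b) \<and> (\<forall>c. \<forall>a\<in>A. \<phi> (c *\<^sub>C a) = c * \<phi> a)"

definition state_on :: "'h::chilbert_space bounded_op set \<Rightarrow> ('h bounded_op \<Rightarrow> complex) \<Rightarrow> bool" where
  "state_on A \<phi> \<longleftrightarrow>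
    linear_on A \<phi> \<and> (\<forall>a\<in>A. \<phi> (adj a * a) \<in> \<real>\<^sub>\<ge>\<^sub>0) \<and> \<phi> 1 = 1"

text \<open>Normality: compatibility with suprema of bounded upward directed families.\<close>

definition normal_on :: "'h::chilbert_space bounded_op set \<Rightarrow> ('h bounded_op \<Rightarrow> complex) \<Rightarrow> bool" where
  "normal_on A \<phi> \<longleftrightarrow>
    (\<forall>D s. D \<noteq> {} \<and> D \<subseteq> A \<and> (\<forall>a\<in>D. self_adjoint a) \<and>
       (\<forall>a\<in>D. \<forall>b\<in>D. \<exists>c\<in>D. op_le a c \<and> op_le b c) \<and>
       s \<in> A \<and> (\<forall>a\<in>D. op_le a s) \<and>
       (\<forall>t\<in>A. (\<forall>a\<in>D. op_le a t) \<longrightarrow> op_le s t)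
     \<longrightarrow> Re (\<phi> s) = (SUP a\<in>D. Re (\<phi> a)))"

definition wstar_probability_space ::
    "'h::chilbert_space bounded_op set \<Rightarrow> ('h bounded_op \<Rightarrow> complex) \<Rightarrow> bool" where
  "wstar_probability_space A \<phi> \<longleftrightarrow>
    finite_von_neumann_algebra A \<and> state_on A \<phi> \<and> normal_on A \<phi> \<and>
    (\<forall>a\<in>A. \<phi> (adj a * a) = 0 \<longrightarrow> a = 0) \<and>
    (\<forall>a\<in>A. \<forall>b\<in>A. \<phi> (a * b) = \<phi> (b * a))"

definition generated_vna :: "'h::chilbert_space bounded_op \<Rightarrow> 'h bounded_op set" where
  "generated_vna X = von_neumann_algebra hull {X, 1}"

text \<open>
  On a tracial von Neumann algebra the \<open>\<phi>\<close>-preserving conditional expectation onto a von Neumann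
  subalgebra \<open>B\<close> exists and is unique; only its values on \<open>A\<close> matter.
\<close>

definition conditional_expectation ::
    "'h::chilbert_space bounded_op set \<Rightarrow> ('h bounded_op \<Rightarrow> complex) \<Rightarrow>
     'h bounded_op set \<Rightarrow> ('h bounded_op \<Rightarrow> 'h bounded_op) \<Rightarrow> bool" where
  "conditional_expectation A \<phi> B E \<longleftrightarrow>
    (\<forall>a\<in>A. E a \<in> B) \<and>
    (\<forall>a\<in>A. \<forall>b\<in>A. E (a + b) = E a + E b) \<and> (\<forall>c. \<forall>a\<in>A. E (c *\<^sub>C a) = c *\<^sub>C E a) \<and>
    (\<forall>a\<in>A. positive_op a \<longrightarrow> positive_op (E a)) \<and>
    (\<forall>b\<in>B. E b = b) \<and>
    (\<forall>a\<in>A. \<forall>b\<in>B. \<forall>b'\<in>B. E (b * a * b') = b * E a * b') \<and>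
    (\<forall>a\<in>A. \<phi> (E a) = \<phi> a)"


section \<open>Freeness\<close>

definition unital_subalgebra :: "'h::chilbert_space bounded_op set \<Rightarrow> bool" where
  "unital_subalgebra B \<longleftrightarrow>
    1 \<in> B \<and> (\<forall>a\<in>B. \<forall>b\<in>B. a + b \<in> B \<and> a * b \<in> B) \<and> (\<forall>c. \<forall>a\<in>B. c *\<^sub>C a \<in> B)"

definition free_family ::
    "('a::monoid_mult \<Rightarrow> complex) \<Rightarrow> ('i \<Rightarrow> 'a set) \<Rightarrow> bool" where
  "free_family \<phi> B \<longleftrightarrow>
    (\<forall>is as. as \<noteq> [] \<and> distinct_adj is \<and> list_all2 (\<lambda>i a. a \<in> B i \<and> \<phi> a = 0) is as
      \<longrightarrow> \<phi> (prod_list as) = 0)"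

definition free_elements ::
    "('h::chilbert_space bounded_op \<Rightarrow> complex) \<Rightarrow> 'h bounded_op \<Rightarrow> 'h bounded_op \<Rightarrow> bool" where
  "free_elements \<phi> X Y \<longleftrightarrow>
    free_family \<phi> (\<lambda>i::bool. unital_subalgebra hull {if i then X else Y})"


section \<open>Distributions\<close>

text \<open>
  For bounded self-adjoint \<open>X\<close> the moments determine the compactly supported measure \<open>\<mu>\<close>.
\<close>

definition has_distribution ::
    "('h::chilbert_space bounded_op \<Rightarrow> complex) \<Rightarrow> 'h bounded_op \<Rightarrow> real measure \<Rightarrow> bool" where
  "has_distribution \<phi> X \<mu> \<longleftrightarrow>
    prob_space \<mu> \<and> sets \<mu> = sets borel \<and> (\<exists>r. AE x in \<mu>. \<bar>x\<bar> \<le> r) \<and>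
    (\<forall>n. \<phi> (X ^ n) = complex_of_real (\<integral>x. x ^ n \<partial>\<mu>))"

definition add_measure :: "'a measure \<Rightarrow> 'a measure \<Rightarrow> 'a measure"  (infixl \<open>\<oplus>\<^sub>M\<close> 65) where
  "M \<oplus>\<^sub>M N = measure_of (space M) (sets M) (\<lambda>B. emeasure M B + emeasure N B)"

lemma sets_add_measure [simp]: "sets (M \<oplus>\<^sub>M N) = sets M"
  by (simp add: add_measure_def sets.sigma_sets_eq)

lemma emeasure_add_measure:
  assumes "sets N = sets M"
  shows "emeasure (M \<oplus>\<^sub>M N) B = emeasure M B + emeasure N B"
proof (cases "B \<in> sets M")
  case True
  show ?thesis
  proof (rule emeasure_measure_of[OF add_measure_def])
    show "countably_additive (sets (M \<oplus>\<^sub>M N)) (\<lambda>B. emeasure M B + emeasure N B)"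
      unfolding countably_additive_def
      by (auto simp: assms suminf_emeasure simp flip: suminf_add)
  qed (use True in \<open>auto simp: positive_def dest: sets.sets_into_space\<close>)
next
  case False
  then show ?thesis
    by (simp add: assms emeasure_notin_sets)
qed

text \<open>The rate parameter, usually called lambda, is \<open>\<rho>\<close> here.\<close>

definition free_poisson :: "real \<Rightarrow> real \<Rightarrow> real measure" where
  "free_poisson \<alpha> \<rho> =
    scale_measure (ennreal (max 0 (1 - \<rho>))) (return borel 0)
    \<oplus>\<^sub>M density lborel (\<lambda>x. ennreal
          (indicator {\<alpha> * (1 - sqrt \<rho>)\<^sup>2 <..< \<alpha> * (1 + sqrt \<rho>)\<^sup>2} x *
           (1 / (2 * pi * \<alpha> * x) * sqrt (4 * \<rho> * \<alpha>\<^sup>2 - (x - \<alpha> * (1 + \<rho>))\<^sup>2))))"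

definition free_binomial_lower :: "real \<Rightarrow> real \<Rightarrow> real" where
  "free_binomial_lower \<sigma> \<theta> =
    (sqrt (\<sigma> / (\<sigma> + \<theta>) * (1 - 1 / (\<sigma> + \<theta>))) - sqrt (1 / (\<sigma> + \<theta>) * (1 - \<sigma> / (\<sigma> + \<theta>))))\<^sup>2"

definition free_binomial_upper :: "real \<Rightarrow> real \<Rightarrow> real" where
  "free_binomial_upper \<sigma> \<theta> =
    (sqrt (\<sigma> / (\<sigma> + \<theta>) * (1 - 1 / (\<sigma> + \<theta>))) + sqrt (1 / (\<sigma> + \<theta>) * (1 - \<sigma> / (\<sigma> + \<theta>))))\<^sup>2"

definition free_binomial :: "real \<Rightarrow> real \<Rightarrow> real measure" where
  "free_binomial \<sigma> \<theta> =
    scale_measure (ennreal (if 0 < \<sigma> \<and> \<sigma> < 1 then 1 - \<sigma> else 0)) (return borel 0)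
    \<oplus>\<^sub>M density lborel (\<lambda>x. ennreal
          (indicator {free_binomial_lower \<sigma> \<theta> <..< free_binomial_upper \<sigma> \<theta>} x *
           ((\<sigma> + \<theta>) * sqrt ((x - free_binomial_lower \<sigma> \<theta>) * (free_binomial_upper \<sigma> \<theta> - x))
             / (2 * pi * x * (1 - x)))))
    \<oplus>\<^sub>M scale_measure (ennreal (if 0 < \<theta> \<and> \<theta> < 1 then 1 - \<theta> else 0)) (return borel 1)"

end

theory Submission
  imports Defs
begin

text \<open>
  Write \<open>p = (1 - U)\<inverse>\<close> and \<open>q = V\<inverse>\<close>. For small \<open>w, x > 0\<close> such that \<open>(1 - w U)\<inverse>\<close> and \<open>(1 - x V)\<inverse>\<close>
  have the same trace \<open>1 + m\<close>, write these resolvents as \<open>(1 + m) (1 + u)\<close> and \<open>(1 + m) (1 + v)\<close>, with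
  \<open>u\<close> and \<open>v\<close> free and centered. For \<open>\<kappa> = (1 + m) / m\<close> and \<open>z = \<kappa> w x\<close>,
  \<open>(1 - w U)\<inverse> (1 - z U V) (1 - x V)\<inverse> = (1 + m) (1 - \<kappa> u v)\<close>.
  Hence \<open>(1 - z U V)\<inverse>\<close> is explicit in terms of the Neumann series in \<open>u v\<close>, and by freeness nearly all
  terms of that series vanish under the trace. Up to similarity, the two regression conditions say that \<open>q p\<close> and \<open>q p q p\<close>,
  tested against this resolvent, have the traces \<open>c\<close> and \<open>d\<close> times its trace. Solving the resulting equations gives
  \<open>w\<close> and \<open>x\<close> as rational functions of \<open>m\<close>, i.e. the S-transforms of \<open>U\<close> and \<open>V\<close>. Equivalently the moment generating
  functions solve quadratic equations, and the closed form of the generating functions of the free Poisson and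
  free binomial densities solves the same ones.
\<close>

section \<open>The Banach algebra of bounded operators\<close>

text \<open>Freeness is given for polynomials in \<open>U\<close> and \<open>V\<close>, while
  \<open>p\<close>, \<open>q\<close> and the resolvents are only norm limits of polynomials. They
  are such limits because invertibility of \<open>sqrtV * (1 - U) * sqrtV\<close> makes
  \<open>sqrtV\<close> invertible and bounds \<open>V\<close> and \<open>1 - U\<close> below;
  freeness passes to closures because the trace is norm continuous. The two resolvents get equal
  traces because exactly then a single \<open>\<kappa>\<close> cancels both the terms linear in
  \<open>u\<close> and those linear in \<open>v\<close>. The price is that \<open>\<kappa>\<close>
  is of order \<open>1 / m\<close>: convergence of the series rests on the product of
  \<open>u\<close> and \<open>v\<close> being of order \<open>w x\<close>, while \<open>m\<close> is
  at least of order \<open>x\<close>. For a given small \<open>w\<close> the partner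
  \<open>x\<close> comes from the intermediate value theorem, and conversely. Testing the
  regressions on \<open>U * V\<close> itself supplies the relations that eliminate the remaining
  unknown traces. Strictness of \<open>d > c\<^sup>2\<close> is positivity of the variance of the
  inverse of \<open>sqrtV * (1 - U) * sqrtV\<close>: zero variance would put \<open>V\<close> into
  both free algebras and make \<open>U\<close> and \<open>V\<close> scalars.\<close>

instance chilbert_space \<subseteq> banach ..

lemma bounded_op_eqI: "(\<And>x. apply_op S x = apply_op T x) \<Longrightarrow> S = T"
  by (simp add: apply_op_inject[symmetric] ext)

lemma bounded_linear_apply_op [simp]: "bounded_linear (apply_op S)"
  using apply_op[of S] by simp

lemmas apply_op_linear = linear_simps[OF bounded_linear_apply_op]

lemma apply_op_scaleC: "apply_op S (a *\<^sub>C x) = a *\<^sub>C apply_op S x"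
  using apply_op[of S] by simp

lemmas apply_op_simps [simp] =
  zero_bounded_op.rep_eq one_bounded_op.rep_eq plus_bounded_op.rep_eq uminus_bounded_op.rep_eq
  minus_bounded_op.rep_eq times_bounded_op.rep_eq scaleC_bounded_op.rep_eq

instantiation bounded_op :: (chilbert_space) scaleR
begin

definition scaleR_bounded_op :: "real \<Rightarrow> 'a bounded_op \<Rightarrow> 'a bounded_op" where
  "scaleR_bounded_op r S = complex_of_real r *\<^sub>C S"

instance ..

end

instantiation bounded_op :: (chilbert_space) real_normed_algebra_1
begin

lift_definition norm_bounded_op :: "'a bounded_op \<Rightarrow> real" is onorm .

definition dist_bounded_op :: "'a bounded_op \<Rightarrow> 'a bounded_op \<Rightarrow> real" where
  "dist_bounded_op S T = norm (S - T)"

definition sgn_bounded_op :: "'a bounded_op \<Rightarrow> 'a bounded_op" where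
  "sgn_bounded_op S = scaleR (inverse (norm S)) S"

definition uniformity_bounded_op :: "('a bounded_op \<times> 'a bounded_op) filter" where
  "uniformity_bounded_op = (INF e\<in>{0 <..}. principal {(x, y). dist x y < e})"

definition open_bounded_op :: "'a bounded_op set \<Rightarrow> bool" where
  "open_bounded_op U = (\<forall>x\<in>U. \<forall>\<^sub>F (x', y) in uniformity. x' = x \<longrightarrow> y \<in> U)"

instance
proof
  fix S T :: "'a bounded_op" and a b :: real and U :: "'a bounded_op set"
  have scaleR: "apply_op (a *\<^sub>R S) x = a *\<^sub>R apply_op S x" for a and S :: "'a bounded_op" and x
    by (simp add: scaleR_bounded_op_def scaleC_of_real)
  show "dist S T = norm (S - T)" by (rule dist_bounded_op_def)
  show "sgn S = S /\<^sub>R norm S" by (rule sgn_bounded_op_def)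
  show "uniformity = (INF e\<in>{0 <..}. principal {(x, y :: 'a bounded_op). dist x y < e})"
    by (rule uniformity_bounded_op_def)
  show "open U = (\<forall>x\<in>U. \<forall>\<^sub>F (x', y) in uniformity. x' = x \<longrightarrow> y \<in> U)"
    by (rule open_bounded_op_def)
  show "a *\<^sub>R (S + T) = a *\<^sub>R S + a *\<^sub>R T" "(a + b) *\<^sub>R S = a *\<^sub>R S + b *\<^sub>R S"
    "a *\<^sub>R b *\<^sub>R S = (a * b) *\<^sub>R S" "1 *\<^sub>R S = S" "a *\<^sub>R S * T = a *\<^sub>R (S * T)"
    "S * a *\<^sub>R T = a *\<^sub>R (S * T)"
    by (auto intro!: bounded_op_eqI
        simp: scaleR scaleR_right_distrib scaleR_left_distrib apply_op_linear)
  show "(norm S = 0) = (S = 0)"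
    by (simp add: norm_bounded_op.rep_eq onorm_eq_0 apply_op_inject[symmetric] fun_eq_iff)
  show "norm (S + T) \<le> norm S + norm T"
    by (simp add: norm_bounded_op.rep_eq plus_bounded_op.rep_eq[abs_def] onorm_triangle)
  show "norm (a *\<^sub>R S) = \<bar>a\<bar> * norm S"
    by (simp add: norm_bounded_op.rep_eq scaleR[abs_def] onorm_scaleR)
  show "norm (S * T) \<le> norm S * norm T"
    using onorm_compose[of "apply_op S" "apply_op T"]
    by (simp add: norm_bounded_op.rep_eq times_bounded_op.rep_eq[abs_def] o_def)
  obtain x :: 'a where "x \<noteq> 0" using ex_nonzero by blast
  then have "onorm (\<lambda>x::'a. x) \<ge> 1"
    using onorm[OF bounded_linear_ident, of x] by simp
  then show "norm (1::'a bounded_op) = 1"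
    by (auto simp: norm_bounded_op.rep_eq one_bounded_op.rep_eq[abs_def] onorm_id_le intro!: antisym)
qed

end

lemma scaleR_bounded_op_eq: "r *\<^sub>R (S::'h::chilbert_space bounded_op) = complex_of_real r *\<^sub>C S"
  by (rule scaleR_bounded_op_def)

lemma apply_op_scaleR [simp]: "apply_op (r *\<^sub>R S) x = r *\<^sub>R apply_op S x"
  by (simp add: scaleR_bounded_op_eq scaleC_of_real)

lemma norm_apply_op: "norm (apply_op S x) \<le> norm S * norm x"
  using onorm[of "apply_op S" x] by (simp add: norm_bounded_op.rep_eq)

lemma norm_bounded_op_le: "0 \<le> K \<Longrightarrow> (\<And>x. norm (apply_op S x) \<le> K * norm x) \<Longrightarrow> norm S \<le> K"
  by (simp add: norm_bounded_op.rep_eq onorm_bound)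

lemma tendsto_apply_op:
  assumes "X \<longlonglongrightarrow> S"
  shows "(\<lambda>n. apply_op (X n) x) \<longlonglongrightarrow> apply_op S x"
proof (rule Lim_null[THEN iffD2], rule Lim_null_comparison)
  show "\<forall>\<^sub>F n in sequentially. norm (apply_op (X n) x - apply_op S x) \<le> norm (X n - S) * norm x"
    using norm_apply_op[of "X n - S" x for n] by auto
  show "(\<lambda>n. norm (X n - S) * norm x) \<longlonglongrightarrow> 0"
    using assms by (intro tendsto_mult_left_zero tendsto_norm_zero LIM_zero)
qed

text \<open>Operators sit isometrically in the Banach space of bounded real-linear maps; complex
  homogeneity survives the pointwise limit, so the limit taken there is again an operator.\<close>

instance bounded_op :: (chilbert_space) banach
proof
  fix X :: "nat \<Rightarrow> 'a bounded_op"
  assume X: "Cauchy X"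
  have nb: "norm (Blinfun (apply_op S)) = norm S" for S :: "'a bounded_op"
    by (simp add: norm_blinfun.rep_eq bounded_linear_Blinfun_apply norm_bounded_op.rep_eq)
  have diff: "Blinfun (apply_op S) - Blinfun (apply_op T) = Blinfun (apply_op (S - T))" for S T :: "'a bounded_op"
    by (rule blinfun_eqI)
      (simp add: bounded_linear_Blinfun_apply blinfun.diff_left bounded_linear_sub)
  have "Cauchy (\<lambda>n. Blinfun (apply_op (X n)))"
    using X unfolding Cauchy_def dist_norm diff nb by simp
  then obtain L where L: "(\<lambda>n. Blinfun (apply_op (X n))) \<longlonglongrightarrow> L"
    using Cauchy_convergent convergent_def by blast
  have Lx: "(\<lambda>n. apply_op (X n) x) \<longlonglongrightarrow> blinfun_apply L x" for x
    using blinfun.tendsto[OF L tendsto_const[of x]] by (simp add: bounded_linear_Blinfun_apply)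
  have "blinfun_apply L (a *\<^sub>C x) = a *\<^sub>C blinfun_apply L x" for a x
    using LIMSEQ_unique[OF Lx[of "a *\<^sub>C x"]]
      bounded_linear.tendsto[OF bounded_linear_scaleC Lx[of x], of a] by (simp add: apply_op_scaleC)
  then have ap: "apply_op (Bounded_op (blinfun_apply L)) = blinfun_apply L"
    by (intro Bounded_op_inverse) (simp add: blinfun.bounded_linear_right)
  have LB: "Blinfun (apply_op (Bounded_op (blinfun_apply L))) = L"
    unfolding ap by (rule blinfun_apply_inverse)
  have "norm (X n - Bounded_op (blinfun_apply L)) = norm (Blinfun (apply_op (X n)) - L)" for n
    using diff[of "X n" "Bounded_op (blinfun_apply L)"] nb[of "X n - Bounded_op (blinfun_apply L)"]
    unfolding LB by simp
  then have "(\<lambda>n. norm (X n - Bounded_op (blinfun_apply L))) \<longlonglongrightarrow> 0"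
    using tendsto_norm_zero[OF LIM_zero[OF L]] by simp
  then have "X \<longlonglongrightarrow> Bounded_op (blinfun_apply L)"
    by (rule LIM_zero_cancel[OF tendsto_norm_zero_cancel])
  then show "convergent X" unfolding convergent_def ..
qed


text \<open>Discriminant criterion, shared by the Cauchy-Schwarz inequality for operator forms and
  the one for the trace.\<close>

lemma quadratic_nonneg_imp:
  fixes a b c :: real
  assumes "\<And>t. 0 \<le> a + 2 * b * t + c * t\<^sup>2"
  shows "b\<^sup>2 \<le> a * c"
proof (cases "c = 0")
  case True
  \<comment> \<open>At this \<open>t\<close> the linear polynomial takes the value -1.\<close>
  then have "b = 0" using assms[of "- (a + 1) / (2 * b)"] by (cases "b = 0") auto
  then show ?thesis using True by simp
next
  case False
  have c: "c \<ge> 0"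
  proof (rule ccontr)
    assume "\<not> c \<ge> 0"
    \<comment> \<open>Chosen so that \<open>c * t\<^sup>2 = - (\<bar>a\<bar> + 1)\<close>; averaging
      the values at \<open>t\<close> and \<open>- t\<close> removes the linear term.\<close>
    define t where "t = sqrt ((\<bar>a\<bar> + 1) / - c)"
    have "t\<^sup>2 = (\<bar>a\<bar> + 1) / - c"
      unfolding t_def using \<open>\<not> c \<ge> 0\<close> by (intro real_sqrt_pow2) (simp add: divide_nonneg_neg)
    then have "a + c * t\<^sup>2 < 0" using \<open>\<not> c \<ge> 0\<close> by (simp add: field_simps)
    then show False using assms[of t] assms[of "- t"] by simp
  qed
  have "0 \<le> c * (a + 2 * b * (- b / c) + c * (- b / c)\<^sup>2)" using assms[of "- b / c"] c by simp
  also have "\<dots> = a * c - b\<^sup>2" using False by (simp add: field_simps power2_eq_square)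
  finally show ?thesis by simp
qed

text \<open>Binomial series of exponent 1/2. By Vandermonde its Cauchy square has the binomial
  coefficients of exponent 1, hence stops after the linear term.\<close>

lemma sqrt_one_minus_series:
  fixes Y :: "'a::{real_normed_algebra_1, banach}"
  assumes "norm Y < 1"
  defines "g \<equiv> \<lambda>n. ((1/2 gchoose n) * (-1) ^ n) *\<^sub>R Y ^ n"
  shows "summable g" "suminf g * suminf g = 1 - Y"
proof -
  \<comment> \<open>A radius strictly between \<open>norm Y\<close> and 1: convergence of the scalar
    series at \<open>r\<close> yields absolute convergence at \<open>norm Y\<close>.\<close>
  define r where "r = (norm Y + 1) / 2"
  have r: "\<bar>r\<bar> < 1" "norm (norm Y) < norm r" using assms by (auto simp: r_def)
  have "summable (\<lambda>n. (1/2 gchoose n) * r ^ n)"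
    using gen_binomial_real[OF r(1), of "1/2"] by (simp add: sums_iff)
  from powser_insidea[OF this r(2)] have "summable (\<lambda>n. \<bar>1/2 gchoose n\<bar> * norm Y ^ n)"
    by (simp add: abs_mult)
  moreover have "norm (g n) \<le> \<bar>1/2 gchoose n\<bar> * norm Y ^ n" for n
    unfolding g_def by (simp add: abs_mult power_abs mult_left_mono norm_power_ineq)
  ultimately have sn: "summable (\<lambda>n. norm (g n))"
    using summable_comparison_test'[of "\<lambda>n. \<bar>1/2 gchoose n\<bar> * norm Y ^ n" 0 "\<lambda>n. norm (g n)"]
    by simp
  then show "summable g" by (rule summable_norm_cancel)
  have prod: "(\<lambda>k. \<Sum>i\<le>k. g i * g (k - i)) sums (suminf g * suminf g)"
    by (rule Cauchy_product_sums[OF sn sn])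
  have coeff: "(\<Sum>i\<le>k. g i * g (k - i)) = (of_nat (1 choose k) * (-1) ^ k) *\<^sub>R Y ^ k" for k
  proof -
    have "g i * g (k - i) = ((1/2 gchoose i) * (1/2 gchoose (k - i)) * (-1) ^ k) *\<^sub>R Y ^ k" if "i \<le> k" for i
    proof -
      have "(-1 :: real) ^ i * (-1) ^ (k - i) = (-1) ^ k" "Y ^ i * Y ^ (k - i) = Y ^ k"
        using that by (simp_all flip: power_add)
      moreover have "g i * g (k - i) = ((1/2 gchoose i) * (1/2 gchoose (k - i))
          * ((-1) ^ i * (-1) ^ (k - i))) *\<^sub>R (Y ^ i * Y ^ (k - i))"
        by (simp add: g_def mult_ac)
      ultimately show ?thesis by simp
    qed
    then have "(\<Sum>i\<le>k. g i * g (k - i))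
      = ((\<Sum>i\<le>k. (1/2 gchoose i) * (1/2 gchoose (k - i))) * (-1) ^ k) *\<^sub>R Y ^ k"
      by (simp add: scaleR_sum_left sum_distrib_right)
    also have "(\<Sum>i\<le>k. (1/2 gchoose i) * (1/2 gchoose (k - i) :: real)) = of_nat (1 choose k)"
      using gbinomial_Vandermonde[of "1/2::real" "1/2" k] by (simp add: binomial_gbinomial atLeast0AtMost)
    finally show ?thesis .
  qed
  have "(\<lambda>k. (of_nat (1 choose k) * (-1) ^ k) *\<^sub>R Y ^ k) sums
      (\<Sum>k\<in>{0,1}. (of_nat (1 choose k) * (-1) ^ k) *\<^sub>R Y ^ k)"
    by (rule sums_finite) (auto simp: binomial_eq_0)
  from sums_unique2[OF this prod[unfolded coeff]] show "suminf g * suminf g = 1 - Y"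
    by simp
qed

lemma neumann_series:
  fixes Y :: "'a::{real_normed_algebra_1, banach}"
  assumes "norm Y < 1"
  shows "summable (\<lambda>n. Y ^ n)" "(1 - Y) * (\<Sum>n. Y ^ n) = 1" "(\<Sum>n. Y ^ n) * (1 - Y) = 1"
proof -
  show s: "summable (\<lambda>n. Y ^ n)" using assms by (rule complete_algebra_summable_geometric)
  have "(\<Sum>n. Y ^ n) = 1 + (\<Sum>n. Y ^ Suc n)" using suminf_split_head[OF s] by simp
  moreover have "(\<Sum>n. Y ^ Suc n) = Y * (\<Sum>n. Y ^ n)" using suminf_mult[OF s, of Y] by simp
  moreover have "(\<Sum>n. Y ^ Suc n) = (\<Sum>n. Y ^ n) * Y"
    using suminf_mult2[OF s, of Y] by (simp add: power_commutes)
  ultimately show "(1 - Y) * (\<Sum>n. Y ^ n) = 1" "(\<Sum>n. Y ^ n) * (1 - Y) = 1"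
    by (simp_all add: left_diff_distrib right_diff_distrib diff_eq_eq)
qed

section \<open>Adjoints and quadratic forms\<close>

lemma cinner_add_left: "cinner (x + y) z = cinner x z + cinner y z"
  using cinner_commute[of "x + y" z] cinner_commute[of x z] cinner_commute[of y z]
  by (simp add: cinner_add_right)

lemma cinner_scaleC_left: "cinner (a *\<^sub>C x) y = cnj a * cinner x y"
  using cinner_commute[of "a *\<^sub>C x" y] cinner_commute[of x y] by (simp add: cinner_scaleC_right)

lemma is_adjoint_inner: "is_adjoint S T \<Longrightarrow> inner (apply_op S x) y = inner x (apply_op T y)"
  by (simp add: is_adjoint_def flip: Re_cinner)

lemma is_adjoint_unique:
  assumes "is_adjoint S T" "is_adjoint S T'"
  shows "T = T'"
proof (rule bounded_op_eqI)
  fix x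
  have "inner y (apply_op T x - apply_op T' x) = 0" for y
    using assms by (simp add: inner_diff_right flip: is_adjoint_inner)
  from this[of "apply_op T x - apply_op T' x"] show "apply_op T x = apply_op T' x" by simp
qed

lemma adj_eqI: "is_adjoint S T \<Longrightarrow> adj S = T"
  unfolding adj_def using is_adjoint_unique by blast

lemma is_adjoint_sym: "is_adjoint S T \<Longrightarrow> is_adjoint T S"
  unfolding is_adjoint_def by (metis cinner_commute)

lemma is_adjoint_one: "is_adjoint 1 1"
  by (simp add: is_adjoint_def)

lemma is_adjoint_add: "is_adjoint S T \<Longrightarrow> is_adjoint S' T' \<Longrightarrow> is_adjoint (S + S') (T + T')"
  by (simp add: is_adjoint_def cinner_add_left cinner_add_right)

lemma is_adjoint_mult: "is_adjoint S T \<Longrightarrow> is_adjoint S' T' \<Longrightarrow> is_adjoint (S * S') (T' * T)"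
  by (simp add: is_adjoint_def)

lemma is_adjoint_scaleC: "is_adjoint S T \<Longrightarrow> is_adjoint (a *\<^sub>C S) (cnj a *\<^sub>C T)"
  by (simp add: is_adjoint_def cinner_scaleC_left cinner_scaleC_right)

lemma is_adjoint_scaleR: "is_adjoint S T \<Longrightarrow> is_adjoint (r *\<^sub>R S) (r *\<^sub>R T)"
  using is_adjoint_scaleC[of S T "complex_of_real r"] by (simp add: scaleR_bounded_op_eq)

lemma is_adjoint_diff: "is_adjoint S T \<Longrightarrow> is_adjoint S' T' \<Longrightarrow> is_adjoint (S - S') (T - T')"
  using is_adjoint_add[of S T "-1 *\<^sub>R S'" "-1 *\<^sub>R T'"] is_adjoint_scaleR[of S' T' "-1"] by simp

lemma is_adjoint_inverse:
  assumes "is_adjoint S T" "S * S' = 1" "T' * T = 1" "T * T' = 1"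
  shows "is_adjoint S' T'"
  unfolding is_adjoint_def
proof (intro allI)
  fix x y
  have e: "apply_op S (apply_op S' z) = z" "apply_op T (apply_op T' z) = z" for z
    using arg_cong[OF assms(2), of "\<lambda>A. apply_op A z"] arg_cong[OF assms(4), of "\<lambda>A. apply_op A z"]
    by simp_all
  have "cinner (apply_op S' x) y = cinner (apply_op S' x) (apply_op T (apply_op T' y))" by (simp add: e)
  also have "\<dots> = cinner (apply_op S (apply_op S' x)) (apply_op T' y)"
    using assms(1) by (simp add: is_adjoint_def)
  finally show "cinner (apply_op S' x) y = cinner x (apply_op T' y)" by (simp add: e)
qed

lemma self_adjoint_power: "self_adjoint S \<Longrightarrow> self_adjoint (S ^ n)"
  unfolding self_adjoint_def
proof (induction n)
  case (Suc n)
  then show ?case using is_adjoint_mult[of S S "S ^ n" "S ^ n"] by (simp add: power_commutes)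
qed (simp add: is_adjoint_one)

text \<open>The imaginary part is, up to sign, the real inner product with
  \<open>\<i> *\<^sub>C y\<close>, and multiplication by \<open>\<i>\<close> is isometric. The real
  Cauchy-Schwarz inequality thus bounds both parts, whence the constant 2.\<close>

lemma bounded_linear_cinner_right: "bounded_linear (cinner x)"
proof (rule bounded_linear_intro[where K = "norm x * 2"])
  fix y z :: 'a and r :: real
  show "cinner x (y + z) = cinner x y + cinner x z" by (rule cinner_add_right)
  show "cinner x (r *\<^sub>R y) = r *\<^sub>R cinner x y"
    by (simp add: cinner_scaleC_right scaleR_conv_of_real flip: scaleC_of_real)
  have i: "\<i> *\<^sub>C (- \<i> *\<^sub>C y) = y" by (simp add: scaleC_scaleC) (metis of_real_1 scaleC_of_real scaleR_one)
  have "inner (\<i> *\<^sub>C y) (\<i> *\<^sub>C y) = inner y y"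
    by (simp add: cinner_scaleC_left cinner_scaleC_right flip: Re_cinner)
  then have n: "norm (\<i> *\<^sub>C y) = norm y" by (simp add: norm_eq_sqrt_inner)
  have "Im (cinner x y) = - inner x (\<i> *\<^sub>C y)"
    by (simp add: cinner_scaleC_right flip: Re_cinner)
  then have "\<bar>Im (cinner x y)\<bar> \<le> norm x * norm y"
    using Cauchy_Schwarz_ineq2[of x "\<i> *\<^sub>C y"] n by simp
  moreover have "\<bar>Re (cinner x y)\<bar> \<le> norm x * norm y"
    using Cauchy_Schwarz_ineq2[of x y] by (simp add: Re_cinner)
  ultimately have "norm (cinner x y) \<le> 2 * (norm x * norm y)"
    using cmod_le[of "cinner x y"] by linarith
  then show "norm (cinner x y) \<le> norm y * (norm x * 2)" by (simp add: mult_ac)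
qed

lemma self_adjoint_limit:
  assumes "\<And>n. self_adjoint (X n)" "X \<longlonglongrightarrow> S"
  shows "self_adjoint S"
  unfolding self_adjoint_def is_adjoint_def
proof (intro allI)
  fix x y
  have 1: "(\<lambda>n. cinner y (apply_op (X n) x)) \<longlonglongrightarrow> cinner y (apply_op S x)"
    and 2: "(\<lambda>n. cinner x (apply_op (X n) y)) \<longlonglongrightarrow> cinner x (apply_op S y)"
    using bounded_linear.tendsto[OF bounded_linear_cinner_right tendsto_apply_op[OF assms(2)]] by blast+
  have "cinner x (apply_op (X n) y) = cnj (cinner y (apply_op (X n) x))" for n
    using assms(1)[of n] unfolding self_adjoint_def is_adjoint_def by (metis cinner_commute)
  then have "(\<lambda>n. cinner x (apply_op (X n) y)) \<longlonglongrightarrow> cnj (cinner y (apply_op S x))"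
    using tendsto_cnj[OF 1] by simp
  then show "cinner (apply_op S x) y = cinner x (apply_op S y)"
    using LIMSEQ_unique[OF 2] cinner_commute by metis
qed

lemma positive_form_Cauchy_Schwarz:
  assumes S: "self_adjoint S" "\<And>x. 0 \<le> inner x (apply_op S x)"
  shows "(inner x (apply_op S y))\<^sup>2 \<le> inner x (apply_op S x) * inner y (apply_op S y)"
proof (rule quadratic_nonneg_imp)
  fix t
  have "inner y (apply_op S x) = inner x (apply_op S y)"
    using is_adjoint_inner[of S S] S by (metis inner_commute self_adjoint_def)
  then show "0 \<le> inner x (apply_op S x) + 2 * inner x (apply_op S y) * t + inner y (apply_op S y) * t\<^sup>2"
    using S(2)[of "x + t *\<^sub>R y"]
    by (simp add: apply_op_linear inner_add_left inner_add_right power2_eq_square algebra_simps)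
qed

text \<open>Cauchy-Schwarz for the form of \<open>S\<close>, applied to \<open>S y\<close> and
  \<open>y\<close>, bounds the fourth power of \<open>norm (S y)\<close> by \<open>r\<^sup>2\<close>
  times the squares of both norms; one square cancels.\<close>

lemma norm_le_of_form:
  assumes S: "self_adjoint S" "\<And>x. 0 \<le> inner x (apply_op S x)" "\<And>x. inner x (apply_op S x) \<le> r * (norm x)\<^sup>2"
    and r: "0 \<le> r"
  shows "norm S \<le> r"
proof (rule norm_bounded_op_le[OF r])
  fix y
  let ?z = "apply_op S y"
  have "((norm ?z)\<^sup>2)\<^sup>2 \<le> inner ?z (apply_op S ?z) * inner y ?z"
    using positive_form_Cauchy_Schwarz[OF S(1,2), of ?z y] by (simp add: dot_square_norm)
  also have "\<dots> \<le> (r * (norm ?z)\<^sup>2) * (r * (norm y)\<^sup>2)"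
    using S by (intro mult_mono) (auto simp: r)
  finally have "(norm ?z)\<^sup>2 * (norm ?z)\<^sup>2 \<le> (norm ?z)\<^sup>2 * (r * norm y)\<^sup>2"
    by (simp add: power2_eq_square mult_ac)
  then have "norm ?z = 0 \<or> (norm ?z)\<^sup>2 \<le> (r * norm y)\<^sup>2"
    by (metis mult_le_cancel_left_pos zero_less_power2)
  then show "norm ?z \<le> r * norm y"
    using r by (auto intro: power2_le_imp_le)
qed

text \<open>The same Cauchy-Schwarz inequality at \<open>x\<close> and \<open>T x\<close>, where the
  mixed term is the squared norm of \<open>x\<close>. Given an inverse, it upgrades the mere
  positivity in \<open>strictly_less\<close> to a spectral gap.\<close>

lemma form_lower_bound:
  assumes S: "self_adjoint S" "\<And>x. 0 \<le> inner x (apply_op S x)" and inv: "S * T = 1"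
  shows "\<exists>\<epsilon>>0. \<forall>x. \<epsilon> * (norm x)\<^sup>2 \<le> inner x (apply_op S x)"
proof (intro exI conjI allI)
  let ?N = "norm T + 1"
  show pos: "0 < 1 / ?N" by (simp add: add_nonneg_pos)
  fix x
  let ?z = "apply_op T x"
  have z: "apply_op S ?z = x" using arg_cong[OF inv, of "\<lambda>A. apply_op A x"] by simp
  have "inner ?z x \<le> norm ?z * norm x" by (rule norm_cauchy_schwarz)
  also have "\<dots> \<le> ?N * norm x * norm x"
    using norm_apply_op[of T x] by (intro mult_right_mono) (auto simp: algebra_simps add_increasing)
  finally have zx: "inner ?z x \<le> ?N * (norm x)\<^sup>2" by (simp add: power2_eq_square)
  have "((norm x)\<^sup>2)\<^sup>2 \<le> inner x (apply_op S x) * inner ?z x"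
    using positive_form_Cauchy_Schwarz[OF S, of x ?z] by (simp add: z dot_square_norm)
  also have "\<dots> \<le> inner x (apply_op S x) * (?N * (norm x)\<^sup>2)"
    by (intro mult_left_mono zx S)
  finally have "(norm x)\<^sup>2 * (norm x)\<^sup>2 \<le> (norm x)\<^sup>2 * (?N * inner x (apply_op S x))"
    by (simp add: power2_eq_square mult_ac)
  then have "norm x = 0 \<or> (norm x)\<^sup>2 \<le> ?N * inner x (apply_op S x)"
    by (metis mult_le_cancel_left_pos zero_less_power2)
  then show "1 / ?N * (norm x)\<^sup>2 \<le> inner x (apply_op S x)"
    using S(2)[of x] pos by (auto simp: divide_le_eq mult.commute)
qed

lemma form_le_norm: "inner x (apply_op S x) \<le> norm S * (norm x)\<^sup>2"
proof -
  have "inner x (apply_op S x) \<le> norm x * norm (apply_op S x)" by (rule norm_cauchy_schwarz)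
  also have "\<dots> \<le> norm x * (norm S * norm x)" by (intro mult_left_mono norm_apply_op) simp
  finally show ?thesis by (simp add: power2_eq_square mult_ac)
qed

text \<open>The form of \<open>S\<close> lies between \<open>\<epsilon>\<close> and
  \<open>norm S\<close>, so that of the rescaled difference lies between 0 and
  \<open>1 - \<epsilon> / ?K\<close>. This brings \<open>S\<close> within reach of the binomial
  series, for square roots, and of the Neumann series, for inverses.\<close>

lemma norm_one_minus_scaled:
  assumes S: "self_adjoint S" "\<And>x. \<epsilon> * (norm x)\<^sup>2 \<le> inner x (apply_op S x)" "0 < \<epsilon>"
  shows "norm (1 - (1 / (norm S + \<epsilon>)) *\<^sub>R S) < 1"
proof -
  let ?K = "norm S + \<epsilon>"
  have K: "?K > 0" using S(3) by (simp add: add_nonneg_pos)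
  have "norm (1 - (1 / ?K) *\<^sub>R S) \<le> 1 - \<epsilon> / ?K"
  proof (rule norm_le_of_form)
    show "self_adjoint (1 - (1 / ?K) *\<^sub>R S)"
      using S(1) unfolding self_adjoint_def by (intro is_adjoint_diff is_adjoint_one is_adjoint_scaleR)
    fix x
    have e: "inner x (apply_op (1 - (1 / ?K) *\<^sub>R S) x) = (norm x)\<^sup>2 - inner x (apply_op S x) / ?K"
      by (simp add: inner_diff_right dot_square_norm)
    have "inner x (apply_op S x) \<le> ?K * (norm x)\<^sup>2"
      using form_le_norm[of x S] S(3) by (simp add: distrib_right add_increasing2)
    then show "0 \<le> inner x (apply_op (1 - (1 / ?K) *\<^sub>R S) x)"
      unfolding e using K by (simp add: field_simps)
    show "inner x (apply_op (1 - (1 / ?K) *\<^sub>R S) x) \<le> (1 - \<epsilon> / ?K) * (norm x)\<^sup>2"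
      unfolding e using divide_right_mono[OF S(2)[of x], of ?K] K by (simp add: left_diff_distrib)
  qed (use K in \<open>simp add: field_simps\<close>)
  also have "\<dots> < 1" using K S(3) by simp
  finally show ?thesis .
qed

section \<open>Von Neumann algebras and tracial states\<close>

lemma commutant_mult:
  fixes a b :: "'a::semigroup_mult"
  assumes "a \<in> commutant B" "b \<in> commutant B"
  shows "a * b \<in> commutant B"
  unfolding commutant_def
proof (intro CollectI ballI)
  fix x assume "x \<in> B"
  then have "x * a = a * x" "x * b = b * x" using assms unfolding commutant_def by blast+
  then show "x * (a * b) = a * b * x" by (metis mult.assoc)
qed

lemma commutant_closed:
  fixes a b :: "'a::ring_1"
  assumes "a \<in> commutant B" "b \<in> commutant B"
  shows "a + b \<in> commutant B" "a - b \<in> commutant B"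
  using assms unfolding commutant_def
  by (simp_all only: distrib_left distrib_right left_diff_distrib right_diff_distrib mem_Collect_eq) simp_all

lemma scaleC_mult_bounded_op:
  fixes S T :: "'h::chilbert_space bounded_op"
  shows "(a *\<^sub>C S) * T = a *\<^sub>C (S * T)" "S * (a *\<^sub>C T) = a *\<^sub>C (S * T)"
  by (rule bounded_op_eqI, simp add: apply_op_scaleC)+

lemma commutant_scaleC:
  fixes a :: "'h::chilbert_space bounded_op"
  shows "a \<in> commutant B \<Longrightarrow> r *\<^sub>C a \<in> commutant B"
  unfolding commutant_def by (simp only: scaleC_mult_bounded_op mem_Collect_eq) simp

lemma commutant_inverse:
  fixes a b :: "'a::monoid_mult"
  assumes "a \<in> commutant B" "a * b = 1" "b * a = 1"
  shows "b \<in> commutant B"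
  unfolding commutant_def
proof (intro CollectI ballI)
  fix x assume "x \<in> B"
  then have xa: "x * a = a * x" using assms(1) unfolding commutant_def by blast
  have "x * b = b * a * x * b" by (simp only: assms(3) mult_1)
  also have "\<dots> = b * (x * a) * b" by (simp only: xa mult.assoc)
  also have "\<dots> = b * x" by (simp only: mult.assoc assms(2) mult_1_right)
  finally show "x * b = b * x" .
qed

lemma commutant_limit:
  fixes X :: "nat \<Rightarrow> 'h::chilbert_space bounded_op"
  assumes "\<And>n. X n \<in> commutant B" "X \<longlonglongrightarrow> a"
  shows "a \<in> commutant B"
  unfolding commutant_def
proof (intro CollectI ballI)
  fix b assume "b \<in> B"
  then have "b * X n = X n * b" for n using assms(1)[of n] unfolding commutant_def by blast
  moreover have "(\<lambda>n. b * X n) \<longlonglongrightarrow> b * a" "(\<lambda>n. X n * b) \<longlonglongrightarrow> a * b"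
    by (intro tendsto_mult tendsto_const assms(2))+
  ultimately show "b * a = a * b" using LIMSEQ_unique by simp
qed

text \<open>\<open>A\<close> is itself a commutant, namely that of \<open>commutant A\<close>;
  except for adjoints, all closure properties are inherited from this.\<close>

lemma von_neumann_algebraD:
  fixes A :: "'h::chilbert_space bounded_op set"
  assumes "von_neumann_algebra A"
  shows "a \<in> A \<Longrightarrow> b \<in> A \<Longrightarrow> a + b \<in> A" "a \<in> A \<Longrightarrow> b \<in> A \<Longrightarrow> a * b \<in> A"
    "a \<in> A \<Longrightarrow> b \<in> A \<Longrightarrow> a - b \<in> A" "1 \<in> A" "0 \<in> A" "a \<in> A \<Longrightarrow> r *\<^sub>C a \<in> A" "a \<in> A \<Longrightarrow> t *\<^sub>R a \<in> A"
    "a \<in> A \<Longrightarrow> a * b = 1 \<Longrightarrow> b * a = 1 \<Longrightarrow> b \<in> A" "(\<And>n. X n \<in> A) \<Longrightarrow> X \<longlonglongrightarrow> a \<Longrightarrow> a \<in> A"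
    "a \<in> A \<Longrightarrow> is_adjoint a b \<Longrightarrow> b \<in> A"
proof -
  have A: "commutant (commutant A) = A" using assms by (simp add: von_neumann_algebra_def)
  show "a \<in> A \<Longrightarrow> b \<in> A \<Longrightarrow> a + b \<in> A" "a \<in> A \<Longrightarrow> b \<in> A \<Longrightarrow> a * b \<in> A"
    "a \<in> A \<Longrightarrow> b \<in> A \<Longrightarrow> a - b \<in> A"
    using commutant_closed[of a "commutant A" b] commutant_mult[of a "commutant A" b] unfolding A by blast+
  show "1 \<in> A" "0 \<in> A" by (subst A[symmetric], simp add: commutant_def)+
  show "a \<in> A \<Longrightarrow> r *\<^sub>C a \<in> A" for r using commutant_scaleC[of a "commutant A"] unfolding A by blast
  then show "a \<in> A \<Longrightarrow> t *\<^sub>R a \<in> A" by (simp add: scaleR_bounded_op_eq)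
  show "a \<in> A \<Longrightarrow> a * b = 1 \<Longrightarrow> b * a = 1 \<Longrightarrow> b \<in> A"
    using commutant_inverse[of a "commutant A" b] unfolding A by blast
  show "(\<And>n. X n \<in> A) \<Longrightarrow> X \<longlonglongrightarrow> a \<Longrightarrow> a \<in> A"
    using commutant_limit[of X "commutant A" a] unfolding A by blast
  show "a \<in> A \<Longrightarrow> is_adjoint a b \<Longrightarrow> b \<in> A"
    using assms adj_eqI by (auto simp: von_neumann_algebra_def)
qed

lemma von_neumann_algebra_inverse_hull:
  assumes "X \<in> von_neumann_algebra hull B" "X * Y = 1" "Y * X = 1"
  shows "Y \<in> von_neumann_algebra hull B"
  using assms von_neumann_algebraD(8) unfolding hull_def by blast

text \<open>After division by \<open>?K\<close> the operator is \<open>1 - Y\<close> with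
  \<open>norm Y < 1\<close>, and the binomial series gives the root. Its partial sums are
  self-adjoint elements of \<open>A\<close>, and both properties pass to norm limits.\<close>

lemma von_neumann_algebra_sqrt:
  fixes A :: "'h::chilbert_space bounded_op set"
  assumes A: "von_neumann_algebra A" and S: "S \<in> A" "self_adjoint S"
    and \<epsilon>: "0 < \<epsilon>" "\<And>x. \<epsilon> * (norm x)\<^sup>2 \<le> inner x (apply_op S x)"
  shows "\<exists>T\<in>A. self_adjoint T \<and> T * T = S"
proof -
  let ?K = "norm S + \<epsilon>"
  define Y where "Y = 1 - (1 / ?K) *\<^sub>R S"
  have K: "?K > 0" using \<epsilon>(1) by (simp add: add_nonneg_pos)
  have Y: "Y \<in> A" "self_adjoint Y" "norm Y < 1"
    using S von_neumann_algebraD(3,4,7)[OF A] norm_one_minus_scaled[OF S(2) \<epsilon>(2,1)]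
    by (auto simp: Y_def self_adjoint_def intro: is_adjoint_diff is_adjoint_one is_adjoint_scaleR)
  define g where "g = (\<lambda>n. ((1/2 gchoose n) * (-1) ^ n :: real) *\<^sub>R Y ^ n)"
  have g: "summable g" "suminf g * suminf g = 1 - Y"
    using sqrt_one_minus_series[OF Y(3)] by (simp_all add: g_def)
  have Yn: "Y ^ n \<in> A" for n
    by (induction n) (use Y von_neumann_algebraD(2,4)[OF A] in auto)
  have part: "(\<Sum>i<n. g i) \<in> A \<and> self_adjoint (\<Sum>i<n. g i)" for n
  proof (induction n)
    case 0
    then show ?case using von_neumann_algebraD(5)[OF A] is_adjoint_scaleR[OF is_adjoint_one, of 0]
      by (simp add: self_adjoint_def)
  next
    case (Suc n)
    have "g n \<in> A" "self_adjoint (g n)"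
      using Yn[of n] self_adjoint_power[OF Y(2), of n] von_neumann_algebraD(7)[OF A]
      by (auto simp: g_def self_adjoint_def intro: is_adjoint_scaleR)
    then show ?case using Suc von_neumann_algebraD(1)[OF A]
      by (auto simp: self_adjoint_def intro: is_adjoint_add)
  qed
  have lim: "(\<lambda>n. \<Sum>i<n. g i) \<longlonglongrightarrow> suminf g" using g(1) by (rule summable_LIMSEQ)
  have "suminf g \<in> A" "self_adjoint (suminf g)"
    using von_neumann_algebraD(9)[OF A _ lim] self_adjoint_limit[OF _ lim] part by auto
  moreover have "(sqrt ?K *\<^sub>R suminf g) * (sqrt ?K *\<^sub>R suminf g) = S"
    using K by (simp add: g(2) Y_def)
  ultimately show ?thesis
    using von_neumann_algebraD(7)[OF A]
    by (intro bexI[of _ "sqrt ?K *\<^sub>R suminf g"]) (auto simp: self_adjoint_def intro: is_adjoint_scaleR)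
qed

locale tracial_state =
  fixes A :: "'h::chilbert_space bounded_op set" and \<phi> :: "'h bounded_op \<Rightarrow> complex"
  assumes A: "von_neumann_algebra A" and state: "state_on A \<phi>"
    and trace: "a \<in> A \<Longrightarrow> b \<in> A \<Longrightarrow> \<phi> (a * b) = \<phi> (b * a)"
begin

abbreviation "\<tau> x \<equiv> Re (\<phi> x)"

lemmas A_simps [simp] = von_neumann_algebraD(1-7)[OF A]

lemma A_power [simp]: "a \<in> A \<Longrightarrow> a ^ n \<in> A"
  by (induction n) auto

lemma \<phi>_linear [simp]: "a \<in> A \<Longrightarrow> b \<in> A \<Longrightarrow> \<phi> (a + b) = \<phi> a + \<phi> b" "a \<in> A \<Longrightarrow> \<phi> (c *\<^sub>C a) = c * \<phi> a"
  "\<phi> 1 = 1"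
  using state by (auto simp: state_on_def linear_on_def)

lemma \<phi>_scaleR [simp]: "a \<in> A \<Longrightarrow> \<phi> (r *\<^sub>R a) = complex_of_real r * \<phi> a"
  by (simp add: scaleR_bounded_op_eq)

lemma \<phi>_diff [simp]: "a \<in> A \<Longrightarrow> b \<in> A \<Longrightarrow> \<phi> (a - b) = \<phi> a - \<phi> b"
  using \<phi>_linear(1)[of a "-1 *\<^sub>R b"] \<phi>_scaleR[of b "-1"] A_simps(7)[of b "-1"] by simp

lemma \<phi>_adjoint_square:
  assumes "a \<in> A" "is_adjoint a b"
  shows "Im (\<phi> (b * a)) = 0" "0 \<le> \<tau> (b * a)"
proof -
  have "\<phi> (b * a) \<in> \<real>\<^sub>\<ge>\<^sub>0"
    using state assms adj_eqI[OF assms(2)] by (auto simp: state_on_def)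
  then show "Im (\<phi> (b * a)) = 0" "0 \<le> \<tau> (b * a)"
    by (auto simp: complex_nonneg_Reals_iff)
qed

text \<open>\<open>\<phi>\<close> is real on \<open>(b + cnj z) (a + z)\<close> for every scalar
  \<open>z\<close>. The choice \<open>z = 1\<close> compares the imaginary parts of
  \<open>\<phi> a\<close> and \<open>\<phi> b\<close>, the choice \<open>z = \<i>\<close> their real
  parts.\<close>

lemma \<phi>_adjoint:
  assumes a: "a \<in> A" "is_adjoint a b"
  shows "\<phi> b = cnj (\<phi> a)"
proof -
  have b: "b \<in> A" using von_neumann_algebraD(10)[OF A] a by blast
  have "Im (\<phi> ((b + cnj z *\<^sub>C 1) * (a + z *\<^sub>C 1))) = 0" for z
    using a by (intro \<phi>_adjoint_square(1) is_adjoint_add is_adjoint_scaleC is_adjoint_one) auto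
  moreover have "\<phi> ((b + cnj z *\<^sub>C 1) * (a + z *\<^sub>C 1)) = \<phi> (b * a) + z * \<phi> b + cnj z * \<phi> a + cnj z * z" for z
    using a b by (simp add: distrib_left distrib_right scaleC_mult_bounded_op)
  ultimately have *: "Im (\<phi> (b * a) + z * \<phi> b + cnj z * \<phi> a + cnj z * z) = 0" for z by simp
  have "Im (\<phi> b) + Im (\<phi> a) = 0" using *[of 1] \<phi>_adjoint_square(1)[OF a] by simp
  moreover have "Re (\<phi> b) - Re (\<phi> a) = 0" using *[of \<i>] \<phi>_adjoint_square(1)[OF a] by simp
  ultimately show ?thesis by (simp add: complex_eq_iff)
qed

lemma \<phi>_self_adjoint: "a \<in> A \<Longrightarrow> self_adjoint a \<Longrightarrow> \<phi> a = complex_of_real (\<tau> a)"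
  using \<phi>_adjoint[of a a] by (simp add: self_adjoint_def complex_eq_iff)

text \<open>Positivity of a state concerns operators of the form \<open>adj a * a\<close>, so a
  square root is called for, and the series producing it asks for a gap. Hence the shift by an
  arbitrarily small \<open>e\<close>.\<close>

lemma \<tau>_lower_bound:
  assumes a: "a \<in> A" "self_adjoint a" and r: "\<And>x. r * (norm x)\<^sup>2 \<le> inner x (apply_op a x)"
  shows "r \<le> \<tau> a"
proof (rule field_le_epsilon)
  fix e :: real assume e: "0 < e"
  let ?S = "a + (e - r) *\<^sub>R 1"
  have S: "?S \<in> A" "self_adjoint ?S"
    using a unfolding self_adjoint_def by (auto intro: is_adjoint_add is_adjoint_scaleR is_adjoint_one)
  have "e * (norm x)\<^sup>2 \<le> inner x (apply_op ?S x)" for x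
    using r[of x] by (simp add: inner_add_right dot_square_norm algebra_simps)
  from von_neumann_algebra_sqrt[OF A S e this]
  obtain T where T: "T \<in> A" "self_adjoint T" "T * T = ?S" by blast
  have "0 \<le> \<tau> ?S" using \<phi>_adjoint_square(2)[of T T] T by (simp add: self_adjoint_def)
  then show "r \<le> \<tau> a + e" using a by simp
qed

text \<open>Cauchy-Schwarz for the state against the unit, then
  \<open>b * a \<le> (norm a)\<^sup>2\<close>. This norm continuity later carries freeness to norm
  limits.\<close>

lemma \<tau>_norm_bound:
  assumes a: "a \<in> A" "is_adjoint a b"
  shows "\<bar>\<tau> a\<bar> \<le> norm a"
proof -
  have b: "b \<in> A" using von_neumann_algebraD(10)[OF A] a by blast
  have ba: "self_adjoint (b * a)"
    unfolding self_adjoint_def by (intro is_adjoint_mult a is_adjoint_sym)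
  have "(\<tau> a)\<^sup>2 \<le> \<tau> (b * a) * 1"
  proof (rule quadratic_nonneg_imp)
    fix t
    have "0 \<le> \<tau> ((b + t *\<^sub>R 1) * (a + t *\<^sub>R 1))"
      using a by (intro \<phi>_adjoint_square(2) is_adjoint_add is_adjoint_scaleR is_adjoint_one) auto
    also have "\<dots> = \<tau> (b * a) + 2 * \<tau> a * t + 1 * t\<^sup>2"
      using a b \<phi>_adjoint[OF a] by (simp add: distrib_left distrib_right power2_eq_square)
    finally show "0 \<le> \<tau> (b * a) + 2 * \<tau> a * t + 1 * t\<^sup>2" .
  qed
  also have "\<tau> (b * a) * 1 \<le> (norm a)\<^sup>2"
  proof -
    let ?S = "(norm a)\<^sup>2 *\<^sub>R 1 - b * a"
    have "0 \<le> \<tau> ?S"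
    proof (rule \<tau>_lower_bound)
      show "self_adjoint ?S"
        using ba unfolding self_adjoint_def by (intro is_adjoint_diff is_adjoint_scaleR is_adjoint_one)
      fix x
      have "inner x (apply_op (b * a) x) = (norm (apply_op a x))\<^sup>2"
        using is_adjoint_inner[OF is_adjoint_sym[OF a(2)], of "apply_op a x" x]
        by (simp add: dot_square_norm inner_commute)
      also have "\<dots> \<le> (norm a * norm x)\<^sup>2" by (intro power_mono norm_apply_op) simp
      finally show "0 * (norm x)\<^sup>2 \<le> inner x (apply_op ?S x)"
        by (simp add: inner_diff_right dot_square_norm power_mult_distrib)
    qed (use a b in simp)
    then show ?thesis using a b by simp
  qed
  finally show ?thesis by (simp add: abs_le_square_iff[symmetric])
qed

text \<open>Restricting to operators for which an adjoint is at hand avoids the Riesz representation theorem.\<close>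

definition "adjointable = {a \<in> A. \<exists>b. is_adjoint a b}"

lemma adjointable_inverse:
  assumes "a \<in> A" "is_adjoint a a'" "a * b = 1" "b * a = 1" "a' * b' = 1" "b' * a' = 1"
  shows "b \<in> adjointable"
  using is_adjoint_inverse[of a a' b b'] von_neumann_algebraD(8)[OF A, of a b] assms
  by (auto simp: adjointable_def)

end

section \<open>Free pairs of subalgebras\<close>

text \<open>The index is the algebra of the first letter, and its negation forces the next letter
  into the other algebra. This form, made for induction, replaces the lists of indices and letters
  in \<open>free_family\<close>.\<close>

inductive alternating :: "('a::monoid_mult \<Rightarrow> real) \<Rightarrow> (bool \<Rightarrow> 'a set) \<Rightarrow> bool \<Rightarrow> 'a \<Rightarrow> bool"
  for \<tau> :: "'a \<Rightarrow> real" and F :: "bool \<Rightarrow> 'a set" where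
  single: "a \<in> F i \<Longrightarrow> \<tau> a = 0 \<Longrightarrow> alternating \<tau> F i a"
| Cons: "a \<in> F i \<Longrightarrow> \<tau> a = 0 \<Longrightarrow> alternating \<tau> F (\<not> i) x \<Longrightarrow> alternating \<tau> F i (a * x)"

definition real_subalgebra :: "'a::real_algebra_1 set \<Rightarrow> bool" where
  "real_subalgebra B \<longleftrightarrow> subspace B \<and> 1 \<in> B \<and> (\<forall>x\<in>B. \<forall>y\<in>B. x * y \<in> B)"

lemma real_subalgebraD:
  assumes "real_subalgebra B"
  shows "0 \<in> B" "1 \<in> B" "x \<in> B \<Longrightarrow> y \<in> B \<Longrightarrow> x + y \<in> B" "x \<in> B \<Longrightarrow> y \<in> B \<Longrightarrow> x - y \<in> B"
    "x \<in> B \<Longrightarrow> - x \<in> B" "x \<in> B \<Longrightarrow> r *\<^sub>R x \<in> B" "x \<in> B \<Longrightarrow> y \<in> B \<Longrightarrow> x * y \<in> B"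
    "x \<in> B \<Longrightarrow> x ^ n \<in> B"
proof -
  have s: "subspace B" using assms by (simp add: real_subalgebra_def)
  show "0 \<in> B" "x \<in> B \<Longrightarrow> y \<in> B \<Longrightarrow> x + y \<in> B" "x \<in> B \<Longrightarrow> y \<in> B \<Longrightarrow> x - y \<in> B"
    "x \<in> B \<Longrightarrow> - x \<in> B" "x \<in> B \<Longrightarrow> r *\<^sub>R x \<in> B"
    using s by (auto intro: subspace_0 subspace_add subspace_diff subspace_neg subspace_scale)
  show one: "1 \<in> B" and m: "x \<in> B \<Longrightarrow> y \<in> B \<Longrightarrow> x * y \<in> B" for x y
    using assms by (auto simp: real_subalgebra_def)
  show "x \<in> B \<Longrightarrow> x ^ n \<in> B" by (induction n) (auto intro: one m)
qed

text \<open>Modelled on the real part of the trace. The bound by the norm is the analytic input: it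
  gives the continuity used for freeness of closures and for the remainders of Neumann
  series.\<close>

locale tracial_functional =
  fixes C :: "'a::real_normed_algebra_1 set" and \<tau> :: "'a \<Rightarrow> real"
  assumes C: "real_subalgebra C"
    and \<tau>_add: "x \<in> C \<Longrightarrow> y \<in> C \<Longrightarrow> \<tau> (x + y) = \<tau> x + \<tau> y"
    and \<tau>_scaleR: "x \<in> C \<Longrightarrow> \<tau> (r *\<^sub>R x) = r * \<tau> x"
    and \<tau>_one: "\<tau> 1 = 1"
    and \<tau>_commute: "x \<in> C \<Longrightarrow> y \<in> C \<Longrightarrow> \<tau> (x * y) = \<tau> (y * x)"
    and \<tau>_bound: "x \<in> C \<Longrightarrow> \<bar>\<tau> x\<bar> \<le> norm x"
begin

lemmas C_simps [simp] = real_subalgebraD[OF C]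

lemma \<tau>_zero [simp]: "\<tau> 0 = 0"
  using \<tau>_scaleR[of 1 0] by simp

lemma \<tau>_minus: "x \<in> C \<Longrightarrow> \<tau> (- x) = - \<tau> x"
  using \<tau>_scaleR[of x "-1"] by simp

lemma \<tau>_diff: "x \<in> C \<Longrightarrow> y \<in> C \<Longrightarrow> \<tau> (x - y) = \<tau> x - \<tau> y"
  using \<tau>_add[of x "- y"] by (simp add: \<tau>_minus)

lemmas \<tau>_simps = \<tau>_add \<tau>_scaleR \<tau>_one \<tau>_minus \<tau>_diff

lemma \<tau>_tendsto:
  assumes "\<And>n. X n \<in> C" "x \<in> C" "X \<longlonglongrightarrow> x"
  shows "(\<lambda>n. \<tau> (X n)) \<longlonglongrightarrow> \<tau> x"
proof (rule Lim_null[THEN iffD2], rule Lim_null_comparison)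
  show "\<forall>\<^sub>F n in sequentially. norm (\<tau> (X n) - \<tau> x) \<le> norm (X n - x)"
    using \<tau>_bound[of "X n - x" for n] assms by (auto simp: \<tau>_diff)
  show "(\<lambda>n. norm (X n - x)) \<longlonglongrightarrow> 0"
    using assms(3) by (simp add: LIM_zero tendsto_norm_zero)
qed

text \<open>Each letter from a closure is approximated by elements of \<open>F i\<close>, recentred
  by subtracting their traces, which tend to 0. The products are alternating words over
  \<open>F\<close>, and continuity of \<open>\<tau>\<close> finishes. So inverses and resolvents may
  serve as letters.\<close>

lemma alternating_closure:
  assumes F: "\<And>i. real_subalgebra (F i)" "\<And>i. F i \<subseteq> C"
    and free: "\<And>i x. alternating \<tau> F i x \<Longrightarrow> \<tau> x = 0"
    and alt: "alternating \<tau> (\<lambda>i. C \<inter> closure (F i)) i x"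
  shows "\<tau> x = 0"
proof -
  have app: "\<exists>X. (\<forall>n::nat. X n \<in> F i \<and> \<tau> (X n) = 0) \<and> X \<longlonglongrightarrow> a"
    if a: "a \<in> C \<inter> closure (F i)" "\<tau> a = 0" for i a
  proof -
    obtain X where X: "\<And>n. X n \<in> F i" "X \<longlonglongrightarrow> a"
      using a closure_sequential by blast
    have C: "X n \<in> C" for n using X F by blast
    have "(\<lambda>n. \<tau> (X n)) \<longlonglongrightarrow> 0" using \<tau>_tendsto[OF C _ X(2)] a by simp
    then have "(\<lambda>n. X n - \<tau> (X n) *\<^sub>R 1) \<longlonglongrightarrow> a - 0 *\<^sub>R 1"
      by (intro tendsto_diff tendsto_scaleR X tendsto_const)
    then show ?thesis
      using X C by (intro exI[of _ "\<lambda>n. X n - \<tau> (X n) *\<^sub>R 1"])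
        (auto simp: \<tau>_simps intro!: real_subalgebraD[OF F(1)])
  qed
  have C': "alternating \<tau> F i x \<Longrightarrow> x \<in> C" for i x
    by (induction rule: alternating.induct) (use F(2) in \<open>auto intro!: C_simps\<close>)
  have "x \<in> C \<and> (\<exists>X. (\<forall>n::nat. alternating \<tau> F i (X n)) \<and> X \<longlonglongrightarrow> x)"
    using alt
  proof (induction rule: alternating.induct)
    case (single a i)
    then show ?case using app[OF single] by (blast intro: alternating.single)
  next
    case (Cons a i x)
    then obtain X where X: "\<And>n. alternating \<tau> F (\<not> i) (X n)" "X \<longlonglongrightarrow> x" by auto
    obtain Y where Y: "\<And>n. Y n \<in> F i" "\<And>n. \<tau> (Y n) = 0" "Y \<longlonglongrightarrow> a"
      using app[OF Cons(1,2)] by auto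
    have "alternating \<tau> F i (Y n * X n)" for n by (intro alternating.Cons X Y)
    moreover have "(\<lambda>n. Y n * X n) \<longlonglongrightarrow> a * x" by (intro tendsto_mult X Y)
    ultimately show ?case using Cons by (auto intro!: exI[of _ "\<lambda>n. Y n * X n"])
  qed
  then obtain X where X: "x \<in> C" "\<And>n. alternating \<tau> F i (X n)" "X \<longlonglongrightarrow> x" by blast
  have "(\<lambda>n. \<tau> (X n)) \<longlonglongrightarrow> \<tau> x" using X C' by (intro \<tau>_tendsto) auto
  moreover have "\<tau> (X n) = 0" for n using free X by blast
  ultimately show ?thesis by (simp add: LIMSEQ_const_iff)
qed

end

text \<open>Elimination for \<open>constant_regression_moments\<close>. There \<open>P\<close>,
  \<open>Q\<close>, \<open>\<beta>\<close> are the traces of \<open>p\<close>, \<open>q\<close>,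
  \<open>p * p\<close>; \<open>A\<close>, \<open>B\<close>, \<open>t\<close> those of
  \<open>a * U * p\<close>, \<open>p * a * U * p\<close>, \<open>p * a\<close>; \<open>k\<close>
  that of \<open>p * (1 + \<kappa> u)\<close> and \<open>y\<close> that of
  \<open>v * q\<close>.\<close>

lemma regression_equations:
  fixes \<alpha> \<beta> c d m w x y z A B P Q t k :: real
  assumes ne: "m \<noteq> 0" "w \<noteq> 1" "P \<noteq> 0" "c \<noteq> 0" "w \<noteq> 0"
    and P: "P = 1 + \<alpha>" "Q * P = c" "c * (Q * (\<beta> - P)) = d * \<alpha>"
    and z: "z * m = w * x * (1 + m)"
    and A: "(1 - w) * A = \<alpha> - m" and B: "(1 - w) * B = \<beta> - t" and t: "(1 - w) * t = P - w * (1 + m)"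
    and k: "k * m = P * m + ((1 + m) * P * - 1 + t)" and y: "y * (1 + m) = x * (1 + m) - m * Q"
    and E: "z * A = c * m" "z * (Q * B + k * A * y) = d * m"
  shows "w * (1 + m) * (c\<^sup>2 * \<alpha> + (d - c\<^sup>2) * m) = m * (c\<^sup>2 * \<alpha> + d + (d - c\<^sup>2) * m)"
    and "x * (1 + m) * (c\<^sup>2 * \<alpha> + d + (d - c\<^sup>2) * m) = c ^ 3 * m"
proof -
  define L where "L = \<alpha> - m"
  have A0: "A \<noteq> 0" using E(1) ne by auto
  have "(1 - w) * (k * m) = (1 - w) * (w * A)"
    using k t A P(1) by algebra
  then have km: "k * m = w * A" using ne by simp
  have "(z * k) * m = (w * c) * m" using km E(1) by algebra
  then have zk: "z * k = w * c" using ne by simp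
  \<comment> \<open>The second equation of \<open>E\<close> times \<open>1 + m\<close>:
    \<open>z * k = w * c\<close> removes \<open>k\<close>, and the relations for \<open>y\<close>
    and \<open>z\<close> remove \<open>y\<close> and \<open>x\<close>.\<close>
  have "z * Q * B * (1 + m) + c * A * (z * m - w * m * Q) = d * m * (1 + m)"
    using E(2) zk y z by algebra
  then have "m * (c * Q * B * (1 + m) + c\<^sup>2 * m * A - c * Q * w * A\<^sup>2) = m * (d * (1 + m) * A)"
    using E(1) by algebra
  then have e: "c * Q * B * (1 + m) + c\<^sup>2 * m * A - c * Q * w * A\<^sup>2 = d * (1 + m) * A"
    using ne by simp
  have B': "(1 - w) * (1 - w) * (c * Q * B) = d * \<alpha> * (1 - w) - c * Q * w * L"
    using B t P unfolding L_def by algebra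
  have A': "(1 - w) * A = L" using A by (simp add: L_def)
  have "(1 + m) * (d * \<alpha> * (1 - w) - c * Q * w * L) + c\<^sup>2 * m * L * (1 - w) - c * Q * w * L\<^sup>2
      = d * (1 + m) * L * (1 - w)"
    using e B' A' by algebra
  \<comment> \<open>The terms containing \<open>c * Q * w * L\<close> combine because
    \<open>(1 + m) + L = 1 + \<alpha> = P\<close>; then \<open>Q * P = c\<close> removes the last
    unknown \<open>Q\<close>.\<close>
  then have "P * ((1 + m) * d * \<alpha> * (1 - w) - c\<^sup>2 * w * L + c\<^sup>2 * m * L * (1 - w)) = P * (d * (1 + m) * L * (1 - w))"
    using P(1,2) unfolding L_def by algebra
  then have "(1 + m) * d * \<alpha> * (1 - w) - c\<^sup>2 * w * L + c\<^sup>2 * m * L * (1 - w) = d * (1 + m) * L * (1 - w)"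
    using ne by simp
  then have f: "(1 - w) * m * (c\<^sup>2 * \<alpha> + d + (d - c\<^sup>2) * m) = c\<^sup>2 * w * L"
    unfolding L_def by algebra
  then show "w * (1 + m) * (c\<^sup>2 * \<alpha> + (d - c\<^sup>2) * m) = m * (c\<^sup>2 * \<alpha> + d + (d - c\<^sup>2) * m)"
    unfolding L_def by algebra
  \<comment> \<open>Here \<open>w * x * (1 + m)\<close> is \<open>z * m\<close>, and
    \<open>z * L = (1 - w) * c * m\<close> disposes of the \<open>L\<close> in
    \<open>f\<close>.\<close>
  have "(w * (1 - w)) * (x * (1 + m) * (c\<^sup>2 * \<alpha> + d + (d - c\<^sup>2) * m)) = (w * (1 - w)) * (c ^ 3 * m)"
    using f z E(1) A' by algebra
  then show "x * (1 + m) * (c\<^sup>2 * \<alpha> + d + (d - c\<^sup>2) * m) = c ^ 3 * m"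
    using ne by simp
qed

locale free_pair = tracial_functional C \<tau>
  for C :: "'a::real_normed_algebra_1 set" and \<tau> +
  fixes F :: "bool \<Rightarrow> 'a set"
  assumes F: "real_subalgebra (F i)" and F_le: "F i \<subseteq> C"
    and free: "alternating \<tau> F i x \<Longrightarrow> \<tau> x = 0"
begin

lemmas F_simps [simp] = real_subalgebraD[OF F]

lemma F_C [simp]: "x \<in> F i \<Longrightarrow> x \<in> C"
  using F_le by blast

lemma alternating_C: "alternating \<tau> F i x \<Longrightarrow> x \<in> C"
  by (induction rule: alternating.induct) auto

lemma alternating_Cons:
  assumes "a \<in> F i" "\<tau> a = 0" "alternating \<tau> F (\<not> i) x"
  shows "alternating \<tau> F i (a * x)"
  using assms by (rule alternating.Cons)

lemma \<tau>_alternating_Cons: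
  assumes "a \<in> F i" "\<tau> a = 0" "alternating \<tau> F j x" "j = (\<not> i)"
  shows "\<tau> (a * x) = 0"
  using assms by (auto intro: free[OF alternating.Cons])

text \<open>Centring: \<open>x\<close> is its trace times the unit plus a trace-zero element of
  \<open>F i\<close>. Letter by letter this reduces traces of general words to those of alternating
  ones.\<close>

lemma linear_cases:
  assumes "x \<in> F i" and "f 1 = 0" and "\<And>y. y \<in> F i \<Longrightarrow> \<tau> y = 0 \<Longrightarrow> f y = (0::real)"
    and "\<And>r y. y \<in> F i \<Longrightarrow> f (y + r *\<^sub>R 1) = f y + r * f 1"
  shows "f x = 0"
  using assms(4)[of "x - \<tau> x *\<^sub>R 1" "\<tau> x"] assms(3)[of "x - \<tau> x *\<^sub>R 1"] assms(1,2)
  by (simp add: \<tau>_simps)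

lemma \<tau>_mult:
  assumes "x \<in> F i" "y \<in> F (\<not> i)"
  shows "\<tau> (x * y) = \<tau> x * \<tau> y"
proof -
  let ?x = "x - \<tau> x *\<^sub>R 1" and ?y = "y - \<tau> y *\<^sub>R 1"
  have "alternating \<tau> F i (?x * ?y)"
    using assms by (intro alternating.Cons alternating.single[of ?y]) (auto simp: \<tau>_simps)
  then have "\<tau> (?x * ?y) = 0" by (rule free)
  moreover have "?x * ?y = x * y - \<tau> x *\<^sub>R y - \<tau> y *\<^sub>R x + (\<tau> x * \<tau> y) *\<^sub>R 1"
    by (simp add: algebra_simps)
  ultimately show ?thesis using assms by (simp add: \<tau>_simps)
qed


lemma alternating_word:
  assumes "u \<in> F True" "\<tau> u = 0" "v \<in> F False" "\<tau> v = 0"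
  shows "alternating \<tau> F False ((v * u) ^ n * v)"
proof (induction n)
  case 0
  then show ?case using assms by (auto intro: alternating.single)
next
  case (Suc n)
  have "alternating \<tau> F False (v * (u * ((v * u) ^ n * v)))"
    using alternating_Cons[OF assms(3,4), of "u * ((v * u) ^ n * v)"]
      alternating_Cons[OF assms(1,2), of "(v * u) ^ n * v"] Suc by simp
  then show ?case by (simp add: mult.assoc)
qed

text \<open>The index \<open>True\<close> stands for the algebra of \<open>U\<close>, the index \<open>False\<close> for that of \<open>V\<close>.\<close>

lemma \<tau>_word_left:
  assumes uv: "u \<in> F True" "\<tau> u = 0" "v \<in> F False" "\<tau> v = 0"
    and a: "a \<in> F True" and b: "b \<in> F False"
  shows "\<tau> (a * b * ((v * u) ^ Suc n * v)) = 0"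
proof -
  define w where "w = (v * u) ^ n * v"
  have w: "alternating \<tau> F False w" unfolding w_def by (rule alternating_word[OF uv])
  then have [simp]: "w \<in> C" "\<tau> w = 0" by (auto intro: alternating_C free)
  have au: "\<tau> (c * w) = 0" if "c \<in> F True" for c
  proof (rule linear_cases[OF that, of "\<lambda>c. \<tau> (c * w)"])
    show "\<tau> (c * w) = 0" if "c \<in> F True" "\<tau> c = 0" for c
      using \<tau>_alternating_Cons[OF that w] by simp
  qed (auto simp: \<tau>_simps distrib_right)
  have uw: "alternating \<tau> F True (u * w)"
    using alternating_Cons[OF uv(1,2), of w] w by simp
  \<comment> \<open>\<open>c\<close> will be \<open>b * v\<close>. Its scalar part lets
    \<open>a\<close> meet \<open>u\<close>, so that \<open>au\<close> applies to
    \<open>a * u\<close>; its centred part gives an alternating word once \<open>a\<close> is split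
    as well.\<close>
  have bv: "\<tau> (a * (c * (u * w))) = 0" if "c \<in> F False" for c
  proof (rule linear_cases[OF that, of "\<lambda>c. \<tau> (a * (c * (u * w)))"])
    have "\<tau> ((a * u) * w) = 0" using a uv by (intro au) auto
    then show "\<tau> (a * (1 * (u * w))) = 0" by (simp add: mult.assoc)
  next
    fix c assume c: "c \<in> F False" "\<tau> c = 0"
    then have alt: "alternating \<tau> F False (c * (u * w))"
      using alternating_Cons[OF c, of "u * w"] uw by simp
    show "\<tau> (a * (c * (u * w))) = 0"
    proof (rule linear_cases[OF a, of "\<lambda>a. \<tau> (a * (c * (u * w)))"])
      show "\<tau> (1 * (c * (u * w))) = 0" using free[OF alt] by simp
      show "\<tau> (a * (c * (u * w))) = 0" if "a \<in> F True" "\<tau> a = 0" for a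
        using \<tau>_alternating_Cons[OF that alt] by simp
    qed (use c uv in \<open>auto simp: \<tau>_simps distrib_right\<close>)
  qed (use a uv in \<open>auto simp: \<tau>_simps distrib_right distrib_left\<close>)
  have "a * b * ((v * u) ^ Suc n * v) = a * ((b * v) * (u * w))"
    by (simp add: w_def mult.assoc)
  then show ?thesis using bv[of "b * v"] b uv by simp
qed

text \<open>Splitting \<open>a'\<close>, \<open>b\<close> and \<open>a\<close> into scalar and
  centred parts leaves alternating words or the case of \<open>\<tau>_word_left\<close>. The
  positive exponent matters: for exponent 0 the trace can be nonzero, see
  \<open>\<tau>_abav\<close>.\<close>

lemma \<tau>_word:
  assumes uv: "u \<in> F True" "\<tau> u = 0" "v \<in> F False" "\<tau> v = 0"
    and a: "a \<in> F True" "a' \<in> F True" and b: "b \<in> F False"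
  shows "\<tau> (a * b * a' * ((v * u) ^ Suc n * v)) = 0"
proof -
  define w where "w = (v * u) ^ Suc n * v"
  have w: "alternating \<tau> F False w" unfolding w_def by (rule alternating_word[OF uv])
  then have [simp]: "w \<in> C" "\<tau> w = 0" by (auto intro: alternating_C free)
  have aw: "\<tau> (c * w) = 0" if "c \<in> F True" for c
    using \<tau>_word_left[OF uv that, of 1 n] by (simp add: w_def)
  show ?thesis unfolding w_def[symmetric]
  proof (rule linear_cases[OF a(2), of "\<lambda>a'. \<tau> (a * b * a' * w)"])
    show "\<tau> (a * b * 1 * w) = 0" using \<tau>_word_left[OF uv a(1) b, of n] by (simp add: w_def)
  next
    fix d assume d: "d \<in> F True" "\<tau> d = 0"
    show "\<tau> (a * b * d * w) = 0"
    proof (rule linear_cases[OF b, of "\<lambda>b. \<tau> (a * b * d * w)"])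
      show "\<tau> (a * 1 * d * w) = 0" using aw[of "a * d"] a d by simp
    next
      fix c assume c: "c \<in> F False" "\<tau> c = 0"
      then have alt: "alternating \<tau> F False (c * (d * w))"
        using alternating_Cons[OF c, of "d * w"] alternating_Cons[OF d, of w] w by simp
      have "\<tau> (a * (c * (d * w))) = 0"
      proof (rule linear_cases[OF a(1), of "\<lambda>a. \<tau> (a * (c * (d * w)))"])
        show "\<tau> (1 * (c * (d * w))) = 0" using free[OF alt] by simp
        show "\<tau> (a * (c * (d * w))) = 0" if "a \<in> F True" "\<tau> a = 0" for a
          using \<tau>_alternating_Cons[OF that alt] by simp
      qed (use c d in \<open>auto simp: \<tau>_simps distrib_right\<close>)
      then show "\<tau> (a * c * d * w) = 0" by (simp add: mult.assoc)
    qed (use a d in \<open>auto simp: \<tau>_simps distrib_right distrib_left\<close>)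
  qed (use a b in \<open>auto simp: \<tau>_simps distrib_right distrib_left\<close>)
qed

text \<open>The order-zero term of the Neumann series, the only one that survives. The centred part
  of \<open>a\<close> contributes nothing; with \<open>a\<close> replaced by its trace, cyclicity
  brings \<open>b\<close> next to \<open>v\<close>, and \<open>a'\<close> factors off.\<close>

lemma \<tau>_abav:
  assumes v: "v \<in> F False" "\<tau> v = 0"
    and a: "a \<in> F True" "a' \<in> F True" and b: "b \<in> F False"
  shows "\<tau> (a * b * a' * v) = \<tau> a * \<tau> a' * \<tau> (v * b)"
proof -
  define e where "e = a - \<tau> a *\<^sub>R 1"
  have e: "e \<in> F True" "\<tau> e = 0" using a by (auto simp: e_def \<tau>_simps)
  have bc: "\<tau> (e * (c * (d * v))) = 0" if d: "d \<in> F True" "\<tau> d = 0" and c: "c \<in> F False" for c d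
  proof (rule linear_cases[OF c, of "\<lambda>c. \<tau> (e * (c * (d * v)))"])
    show "\<tau> (e * (1 * (d * v))) = 0"
      using \<tau>_mult[of "e * d" True v] d v e by (simp add: mult.assoc)
    show "\<tau> (e * (c * (d * v))) = 0" if "c \<in> F False" "\<tau> c = 0" for c
      using alternating.single[of v F False \<tau>] alternating_Cons[OF d, of v]
        alternating_Cons[OF that, of "d * v"] v \<tau>_alternating_Cons[OF e, of False "c * (d * v)"]
      by simp
  qed (use d v e in \<open>auto simp: \<tau>_simps distrib_right distrib_left\<close>)
  have "\<tau> (e * (b * (a' * v))) = 0"
  proof (rule linear_cases[OF a(2), of "\<lambda>a'. \<tau> (e * (b * (a' * v)))"])
    show "\<tau> (e * (b * (1 * v))) = 0"
      using \<tau>_mult[of e True "b * v"] b v e by simp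
  qed (use bc b v e in \<open>auto simp: \<tau>_simps distrib_right distrib_left\<close>)
  moreover have "a * b * a' * v = e * (b * (a' * v)) + \<tau> a *\<^sub>R (b * a' * v)"
    by (simp add: e_def left_diff_distrib mult.assoc)
  ultimately have "\<tau> (a * b * a' * v) = \<tau> a * \<tau> (b * a' * v)"
    using a b v e by (simp add: \<tau>_simps)
  also have "\<tau> (b * a' * v) = \<tau> (a' * (v * b))"
    using \<tau>_commute[of b "a' * v"] a b v by (simp add: mult.assoc)
  also have "\<dots> = \<tau> a' * \<tau> (v * b)" using \<tau>_mult[of a' True "v * b"] a b v by simp
  finally show ?thesis by simp
qed

text \<open>Cyclicity turns the term of order \<open>k\<close> into \<open>\<kappa> ^ k\<close>
  times the trace of \<open>a b a' (v u)^k v\<close>, which is 0 for \<open>k > 0\<close> by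
  \<open>\<tau>_word\<close> and given by \<open>\<tau>_abav\<close> for
  \<open>k = 0\<close>.\<close>

lemma \<tau>_resolvent_word:
  assumes uv: "u \<in> F True" "\<tau> u = 0" "v \<in> F False" "\<tau> v = 0"
    and a: "a \<in> F True" "a' \<in> F True" and b: "b \<in> F False"
    and S: "S \<in> C" "S * (1 - \<kappa> *\<^sub>R (u * v)) = 1" "norm (\<kappa> *\<^sub>R (u * v)) < 1"
  shows "\<tau> (a' * v * S * a * b) = \<tau> a' * \<tau> a * \<tau> (v * b)"
proof -
  let ?x = "\<kappa> *\<^sub>R (u * v)" and ?L = "\<tau> a' * \<tau> a * \<tau> (v * b)"
  \<comment> \<open>Finite expansion with remainder. Since the terms of positive order have trace 0,
    the trace of the remainder does not depend on \<open>n\<close>; it is also bounded by a null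
    sequence.\<close>
  have geo: "S = (\<Sum>k<n. ?x ^ k) + S * ?x ^ n" for n
  proof (induction n)
    case (Suc n)
    have "S = 1 + S * ?x" using S(2) by (simp add: right_diff_distrib diff_eq_eq)
    then have "S * ?x ^ n = (1 + S * ?x) * ?x ^ n" by simp
    also have "\<dots> = ?x ^ n + S * ?x ^ Suc n" by (simp only: distrib_right mult_1 mult.assoc power_Suc)
    finally show ?case using Suc by (simp add: add.assoc)
  qed simp
  have term_eq: "\<tau> (a' * v * ?x ^ k * a * b) = (if k = 0 then ?L else 0)" for k
  proof -
    have "v * (u * v) ^ k = (v * u) ^ k * v"
      by (induction k) (auto simp: mult.assoc)
    then have "a' * v * ?x ^ k * a * b = \<kappa> ^ k *\<^sub>R (a' * ((v * u) ^ k * v) * (a * b))"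
      by (simp add: scaleR_power mult.assoc)
    also have "\<tau> \<dots> = \<kappa> ^ k * \<tau> (a' * ((v * u) ^ k * v) * (a * b))"
      using uv a b by (intro \<tau>_scaleR) auto
    also have "\<tau> (a' * ((v * u) ^ k * v) * (a * b)) = \<tau> (a * b * (a' * ((v * u) ^ k * v)))"
      using uv a b by (intro \<tau>_commute) auto
    also have "a * b * (a' * ((v * u) ^ k * v)) = a * b * a' * ((v * u) ^ k * v)"
      by (simp only: mult.assoc)
    also have "\<kappa> ^ k * \<tau> (a * b * a' * ((v * u) ^ k * v)) = (if k = 0 then ?L else 0)"
      using \<tau>_word[OF uv a b, of "k - 1"] \<tau>_abav[OF uv(3,4) a b] by (cases k) auto
    finally show ?thesis .
  qed
  have rem: "\<tau> (a' * v * S * a * b) - ?L = \<tau> (a' * v * S * ?x ^ Suc n * a * b)" for n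
  proof -
    have "a' * v * S * a * b = a' * v * ((\<Sum>k<Suc n. ?x ^ k) + S * ?x ^ Suc n) * a * b"
      by (simp only: geo[symmetric])
    also have "\<dots> = (\<Sum>k<Suc n. a' * v * ?x ^ k * a * b) + a' * v * S * ?x ^ Suc n * a * b"
      by (simp only: distrib_left distrib_right sum_distrib_left sum_distrib_right mult.assoc)
    also have "\<tau> \<dots> = \<tau> (\<Sum>k<Suc n. a' * v * ?x ^ k * a * b) + \<tau> (a' * v * S * ?x ^ Suc n * a * b)"
      using uv a b S by (intro \<tau>_add subspace_sum C[unfolded real_subalgebra_def, THEN conjunct1]) auto
    also have "\<tau> (\<Sum>k<Suc n. a' * v * ?x ^ k * a * b) = (\<Sum>k<Suc n. \<tau> (a' * v * ?x ^ k * a * b))"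
    proof -
      have "(\<Sum>k<j. a' * v * ?x ^ k * a * b) \<in> C \<and>
        \<tau> (\<Sum>k<j. a' * v * ?x ^ k * a * b) = (\<Sum>k<j. \<tau> (a' * v * ?x ^ k * a * b))" for j
        using uv a b by (induction j) (auto simp: \<tau>_add)
      then show ?thesis by blast
    qed
    also have "\<dots> = ?L" by (simp only: term_eq) simp
    finally show ?thesis by simp
  qed
  have "(\<lambda>n. norm (a' * v * S) * norm ?x ^ Suc n * norm (a * b)) \<longlonglongrightarrow> norm (a' * v * S) * 0 * norm (a * b)"
    using S(3) by (intro tendsto_mult tendsto_const LIMSEQ_Suc LIMSEQ_power_zero) auto
  moreover have "\<bar>\<tau> (a' * v * S * a * b) - ?L\<bar> \<le> norm (a' * v * S) * norm ?x ^ Suc n * norm (a * b)" for n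
  proof -
    have "\<bar>\<tau> (a' * v * S * ?x ^ Suc n * (a * b))\<bar> \<le> norm (a' * v * S * ?x ^ Suc n * (a * b))"
      using uv a b S by (intro \<tau>_bound) auto
    also have "\<dots> \<le> norm (a' * v * S) * norm (?x ^ Suc n) * norm (a * b)"
      by (meson norm_mult_ineq mult_right_mono norm_ge_zero order_trans)
    also have "\<dots> \<le> norm (a' * v * S) * norm ?x ^ Suc n * norm (a * b)"
      by (intro mult_right_mono mult_left_mono norm_power_ineq) auto
    finally show ?thesis unfolding rem[of n] by (simp add: mult.assoc)
  qed
  ultimately have "\<bar>\<tau> (a' * v * S * a * b) - ?L\<bar> \<le> 0"
    by (intro LIMSEQ_le_const[where X = "\<lambda>n. norm (a' * v * S) * norm ?x ^ Suc n * norm (a * b)"]) auto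
  then show ?thesis by simp
qed


text \<open>The traces of the resolvent \<open>R\<close> of \<open>U * V\<close> against
  \<open>q * p\<close> and \<open>q * p * q * p\<close> are found twice, from the regressions and
  from \<open>\<tau>_resolvent_word\<close>. Comparison gives \<open>E1\<close> and
  \<open>E2\<close>, the input of the elimination.\<close>

lemma constant_regression_moments:
  fixes U V p q a b S :: 'a and c d m w x \<kappa> z :: real
  assumes \<kappa>_def: "\<kappa> = (1 + m) / m" and z_def: "z = w * x * ((1 + m) / m)"
    and U: "U \<in> F True" and p: "p \<in> F True" "p * (1 - U) = 1" "(1 - U) * p = 1"
    and V: "V \<in> F False" and q: "q \<in> F False" "q * V = 1" "V * q = 1"
    and a: "a \<in> F True" "a * (1 - w *\<^sub>R U) = 1" "(1 - w *\<^sub>R U) * a = 1"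
    and b: "b \<in> F False" "b * (1 - x *\<^sub>R V) = 1" "(1 - x *\<^sub>R V) * b = 1"
    and m: "\<tau> a = 1 + m" "\<tau> b = 1 + m" "m \<noteq> 0" "1 + m \<noteq> 0"
    and wx: "w \<noteq> 0" "w \<noteq> 1" "x \<noteq> 0"
    and u: "u = (1 / (1 + m)) *\<^sub>R a - 1" and v: "v = (1 / (1 + m)) *\<^sub>R b - 1"
    and S: "S \<in> C" "S * (1 - \<kappa> *\<^sub>R (u * v)) = 1" "(1 - \<kappa> *\<^sub>R (u * v)) * S = 1"
      "norm (\<kappa> *\<^sub>R (u * v)) < 1"
    and c: "c \<noteq> 0" "\<tau> (q * p) = c" "\<tau> (q * p * (U * V)) = c * \<tau> (U * V)"
    and d: "\<tau> (q * p * (q * p)) = d" "\<tau> (q * p * (q * p) * (U * V)) = d * \<tau> (U * V)"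
    and R: "\<And>R. R \<in> C \<Longrightarrow> R * (1 - z *\<^sub>R (U * V)) = 1 \<Longrightarrow> (1 - z *\<^sub>R (U * V)) * R = 1 \<Longrightarrow>
        \<tau> (q * p * R) = c * \<tau> R \<and> \<tau> (q * p * (q * p) * R) = d * \<tau> R"
    and \<alpha>: "\<alpha> = \<tau> p - 1"
  shows "w * (1 + m) * (c\<^sup>2 * \<alpha> + (d - c\<^sup>2) * m) = m * (c\<^sup>2 * \<alpha> + d + (d - c\<^sup>2) * m)"
    and "x * (1 + m) * (c\<^sup>2 * \<alpha> + d + (d - c\<^sup>2) * m) = c ^ 3 * m"
proof -
  have uv: "u \<in> F True" "\<tau> u = 0" "v \<in> F False" "\<tau> v = 0"
    using a b m by (auto simp: u v \<tau>_simps)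
  have au: "a = (1 + m) *\<^sub>R (1 + u)" and bv: "b = (1 + m) *\<^sub>R (1 + v)"
    using m by (simp_all add: u v)
  have Up: "U * p = p - 1" and pU: "p * U = p - 1"
    using p by (simp_all add: algebra_simps)
  have aU: "w *\<^sub>R (a * U) = a - 1" using a by (simp add: algebra_simps)
  have Ua: "w *\<^sub>R (U * a) = a - 1" using a by (simp add: algebra_simps)
  have Vb: "x *\<^sub>R (V * b) = b - 1" using b by (simp add: algebra_simps)
  have bV: "x *\<^sub>R (b * V) = b - 1" using b by (simp add: algebra_simps)
  \<comment> \<open>Resolvent identities for \<open>U\<close>, between \<open>a\<close> at the
    parameter \<open>w\<close> and \<open>p\<close> at the parameter 1.\<close>
  have aUp: "(1 - w) *\<^sub>R (a * U * p) = p - a"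
  proof -
    have "(1 - w) *\<^sub>R (a * U * p) = a * (U * p) - (w *\<^sub>R (a * U)) * p"
      by (simp add: algebra_simps)
    also have "\<dots> = p - a" unfolding Up aU by (simp add: algebra_simps)
    finally show ?thesis .
  qed
  have Upa: "(1 - w) *\<^sub>R (U * p * a) = p - a"
  proof -
    have "(1 - w) *\<^sub>R (U * p * a) = p * U * a - p * (w *\<^sub>R (U * a))"
      unfolding Up pU[symmetric] by (simp add: algebra_simps)
    also have "\<dots> = p - a" unfolding pU Ua by (simp add: algebra_simps)
    finally show ?thesis .
  qed
  have pa: "(1 - w) *\<^sub>R (p * a) = p - w *\<^sub>R a"
  proof -
    have "p * a = a + p * (U * a)"
      using arg_cong[OF p(2), of "\<lambda>y. y * a"] by (simp add: algebra_simps)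
    then have "w *\<^sub>R (p * a) = w *\<^sub>R a + p * (w *\<^sub>R (U * a))"
      by (metis mult_scaleR_right scaleR_add_right)
    then have "w *\<^sub>R (p * a) = w *\<^sub>R a + p * a - p" unfolding Ua by (simp add: algebra_simps)
    then show ?thesis by (simp add: algebra_simps)
  qed
  define R where "R = (1 / (1 + m)) *\<^sub>R (b * S * a)"
  have R_C: "R \<in> C" using a b S by (simp add: R_def)
  \<comment> \<open>Sandwiching turns \<open>z * U * V\<close> into
    \<open>\<kappa> * (a - 1) * (b - 1)\<close>, where \<open>a - 1 = m + (1 + m) * u\<close> and
    likewise for \<open>b\<close>. The relation \<open>\<kappa> * m = 1 + m\<close> is the one that
    cancels the terms linear in \<open>u\<close> and \<open>v\<close>.\<close>
  have fact: "a * (1 - z *\<^sub>R (U * V)) * b = (1 + m) *\<^sub>R (1 - \<kappa> *\<^sub>R (u * v))"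
  proof -
    have double: "(r * 2) *\<^sub>R y = r *\<^sub>R y + r *\<^sub>R y"
      "(s * (r * 2)) *\<^sub>R y = (s * r) *\<^sub>R y + (s * r) *\<^sub>R y" for r s and y :: 'a
      by (simp_all flip: scaleR_add_left)
    have "a * (1 - z *\<^sub>R (U * V)) * b = a * b - \<kappa> *\<^sub>R ((w *\<^sub>R (a * U)) * (x *\<^sub>R (V * b)))"
      by (simp add: algebra_simps z_def \<kappa>_def)
    also have "\<dots> = a * b - \<kappa> *\<^sub>R ((a - 1) * (b - 1))"
      by (simp only: aU Vb)
    also have "\<dots> = ((1 + m) * (1 + m)) *\<^sub>R (1 + u + v + u * v) - (\<kappa> * m * m) *\<^sub>R 1
        - (\<kappa> * m * (1 + m)) *\<^sub>R (u + v) - (\<kappa> * (1 + m) * (1 + m)) *\<^sub>R (u * v)"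
      unfolding au bv by (simp add: algebra_simps double)
    also have "\<kappa> * m = 1 + m" using m by (simp add: \<kappa>_def)
    also have "((1 + m) * (1 + m)) *\<^sub>R (1 + u + v + u * v) - ((1 + m) * m) *\<^sub>R 1
        - ((1 + m) * (1 + m)) *\<^sub>R (u + v) - (\<kappa> * (1 + m) * (1 + m)) *\<^sub>R (u * v)
      = (1 + m) *\<^sub>R 1 + ((1 + m) * (1 + m) - \<kappa> * (1 + m) * (1 + m)) *\<^sub>R (u * v)"
      by (simp add: algebra_simps double)
    also have "(1 + m) * (1 + m) - \<kappa> * (1 + m) * (1 + m) = - ((1 + m) * \<kappa>)"
      using m by (simp add: \<kappa>_def field_simps)
    also have "(1 + m) *\<^sub>R 1 + (- ((1 + m) * \<kappa>)) *\<^sub>R (u * v) = (1 + m) *\<^sub>R (1 - \<kappa> *\<^sub>R (u * v))"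
      by (simp add: algebra_simps)
    finally show ?thesis .
  qed
  have D: "1 - z *\<^sub>R (U * V) = (1 - w *\<^sub>R U) * ((1 + m) *\<^sub>R (1 - \<kappa> *\<^sub>R (u * v))) * (1 - x *\<^sub>R V)"
  proof -
    have "(1 - w *\<^sub>R U) * (a * (1 - z *\<^sub>R (U * V)) * b) * (1 - x *\<^sub>R V)
      = ((1 - w *\<^sub>R U) * a) * (1 - z *\<^sub>R (U * V)) * (b * (1 - x *\<^sub>R V))"
      by (simp only: mult.assoc)
    then show ?thesis unfolding fact a(3) b(2) by simp
  qed
  have RD: "R * (1 - z *\<^sub>R (U * V)) = 1"
  proof -
    have "R * (1 - z *\<^sub>R (U * V)) = b * (S * ((a * (1 - w *\<^sub>R U)) * (1 - \<kappa> *\<^sub>R (u * v)))) * (1 - x *\<^sub>R V)"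
      unfolding D R_def using m by (simp add: mult.assoc)
    then show ?thesis unfolding a(2) using S(2) b(2) by simp
  qed
  have DR: "(1 - z *\<^sub>R (U * V)) * R = 1"
  proof -
    have "(1 - z *\<^sub>R (U * V)) * R = (1 - w *\<^sub>R U) * (((1 - \<kappa> *\<^sub>R (u * v)) * (((1 - x *\<^sub>R V) * b) * S)) * a)"
      unfolding D R_def using m by (simp add: mult.assoc)
    then show ?thesis unfolding b(3) using S(3) a(3) by simp
  qed
  \<comment> \<open>As \<open>V * q = 1\<close>, multiplying the resolvent identity by
    \<open>q\<close> trades \<open>R * q\<close> for \<open>R * U\<close>; each trace below thus
    loses one \<open>q\<close>.\<close>
  have Rq: "R * q = q + z *\<^sub>R (R * U)"
  proof -
    have "R * (1 - z *\<^sub>R (U * V)) * q = R * q - z *\<^sub>R (R * U * (V * q))" by (simp add: algebra_simps)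
    then show ?thesis unfolding RD q(3) by (simp add: algebra_simps)
  qed
  \<comment> \<open>One Neumann step, \<open>(1 + v) * S = 1 + (1 + \<kappa> u) * v * S\<close>,
    puts a \<open>v\<close> directly before \<open>S\<close>, the shape that
    \<open>\<tau>_resolvent_word\<close> evaluates.\<close>
  have R_expand: "y * R = y * a + (y * (1 + \<kappa> *\<^sub>R u)) * v * S * a" for y
  proof -
    have "S = 1 + \<kappa> *\<^sub>R (u * v * S)"
      using S(3) by (simp add: left_diff_distrib diff_eq_eq)
    then have "(1 + v) * S = 1 + (1 + \<kappa> *\<^sub>R u) * v * S"
      by (simp add: distrib_right mult.assoc add.assoc add.commute)
    moreover have "R = (1 + v) * S * a"
      unfolding R_def using m by (simp add: v)
    ultimately have "R = (1 + (1 + \<kappa> *\<^sub>R u) * v * S) * a" by (simp only:)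
    then have "R = a + (1 + \<kappa> *\<^sub>R u) * v * S * a" by (simp only: distrib_right[of 1] mult_1_left)
    then show ?thesis by (simp only: distrib_left[of y a] mult.assoc)
  qed
  note mem = a(1) b(1) S(1) uv(1,3) U p(1) V q(1) R_C
  note K = \<tau>_resolvent_word[OF uv _ _ _ S(1,2,4)]
  have \<tau>R: "\<tau> R = 1 + m"
    using R_expand[of 1] K[of a "1 + \<kappa> *\<^sub>R u" 1] a b S uv m by (simp add: \<tau>_add)
  have UpR: "\<tau> (U * p * R) = \<tau> (U * p * a)"
    using R_expand[of "U * p"] K[of a "U * p * (1 + \<kappa> *\<^sub>R u)" 1] a b S uv U p m by (simp add: \<tau>_add)
  let ?k = "\<tau> (p * (1 + \<kappa> *\<^sub>R u))" and ?A = "\<tau> (a * U * p)" and ?B = "\<tau> (p * a * U * p)"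
  \<comment> \<open>Cyclicity lets \<open>a\<close> merge with \<open>U * p\<close>. The first term
    becomes a product of two free factors, the second a resolvent word with the outer letter
    \<open>q\<close>.\<close>
  have UpqpR: "\<tau> (U * p * q * p * R) = \<tau> q * ?B + ?k * ?A * \<tau> (v * q)"
  proof -
    have "\<tau> (U * p * q * p * R) = \<tau> ((U * p * q) * (p * a)) + \<tau> ((U * p * q) * (p * (1 + \<kappa> *\<^sub>R u) * v * S * a))"
      using mem R_expand[of "U * p * q * p"] by (simp add: \<tau>_add mult.assoc)
    also have "\<tau> ((U * p * q) * (p * a)) = \<tau> ((p * a) * (U * p * q))"
      using a b S uv U p q by (intro \<tau>_commute) auto
    also have "\<dots> = \<tau> ((p * a * U * p) * q)" by (simp add: mult.assoc)
    also have "\<dots> = ?B * \<tau> q"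
      using \<tau>_mult[of "p * a * U * p" True q] a U p q by simp
    also have "\<tau> ((U * p * q) * (p * (1 + \<kappa> *\<^sub>R u) * v * S * a))
        = \<tau> ((p * (1 + \<kappa> *\<^sub>R u) * v * S * a) * (U * p * q))"
      using a b S uv U p q by (intro \<tau>_commute) auto
    also have "\<dots> = \<tau> (p * (1 + \<kappa> *\<^sub>R u) * v * S * (a * U * p) * q)" by (simp only: mult.assoc)
    also have "\<dots> = ?k * ?A * \<tau> (v * q)"
      using a b S uv U p q by (intro K) auto
    finally show ?thesis by simp
  qed
  have \<tau>pq: "\<tau> p * \<tau> q = c"
    using \<tau>_mult[of q False p] p q c by simp
  have E1: "z * ?A = c * m"
  proof -
    have "\<tau> (q * p * R) = \<tau> (p * (R * q))"
      using \<tau>_commute[of q "p * R"] mem by (simp add: mult.assoc)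
    also have "\<dots> = c + z * \<tau> (p * R * U)"
      unfolding Rq using mem c(2) \<tau>_commute[of p q] by (simp add: distrib_left \<tau>_simps mult.assoc)
    also have "\<tau> (p * R * U) = \<tau> (U * p * R)"
      using \<tau>_commute[of U "p * R"] mem by (simp add: mult.assoc)
    also have "\<dots> = ?A" unfolding UpR using \<tau>_commute[of "U * p" a] mem by (simp add: mult.assoc)
    finally show ?thesis using R[OF R_C RD DR] \<tau>R by (simp add: algebra_simps)
  qed
  have E2: "z * (\<tau> q * ?B + ?k * ?A * \<tau> (v * q)) = d * m"
  proof -
    have "\<tau> (q * p * (q * p) * R) = \<tau> (p * q * p * (R * q))"
      using \<tau>_commute[of q "p * q * p * R"] mem by (simp add: mult.assoc)
    also have "\<dots> = d + z * \<tau> (p * q * p * R * U)"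
      unfolding Rq using mem d(1) \<tau>_commute[of "p * q * p" q] by (simp add: distrib_left \<tau>_simps mult.assoc)
    also have "\<tau> (p * q * p * R * U) = \<tau> (U * p * q * p * R)"
      using \<tau>_commute[of U "p * q * p * R"] mem by (simp add: mult.assoc)
    finally show ?thesis using R[OF R_C RD DR] \<tau>R UpqpR by (simp add: algebra_simps)
  qed
  \<comment> \<open>The regressions tested on \<open>U * V\<close> itself. Eliminating
    \<open>\<tau> (U * V)\<close> between \<open>UV1\<close> and \<open>UV2\<close> relates the
    trace of \<open>p * p\<close> to \<open>d\<close>.\<close>
  have UV1: "\<tau> p - 1 = c * \<tau> (U * V)"
  proof -
    have "\<tau> (q * p * (U * V)) = \<tau> (p * U * (V * q))"
      using \<tau>_commute[of q "p * (U * V)"] mem by (simp add: mult.assoc)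
    then show ?thesis using c(3) mem unfolding pU q(3) by (simp add: \<tau>_simps)
  qed
  have UV2: "\<tau> q * (\<tau> (p * p) - \<tau> p) = d * \<tau> (U * V)"
  proof -
    have "\<tau> (q * p * (q * p) * (U * V)) = \<tau> (p * q * (p * U * (V * q)))"
      using \<tau>_commute[of q "p * (q * p) * (U * V)"] mem by (simp add: mult.assoc)
    also have "\<dots> = \<tau> (p * q * (p - 1))" unfolding pU q(3) by simp
    also have "\<dots> = \<tau> (q * ((p - 1) * p))"
      using \<tau>_commute[of p "q * (p - 1)"] mem by (simp add: mult.assoc)
    also have "\<dots> = \<tau> q * (\<tau> (p * p) - \<tau> p)"
      using \<tau>_mult[of q False "(p - 1) * p"] mem by (simp add: left_diff_distrib \<tau>_simps)
    finally show ?thesis using d(2) by simp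
  qed
  have \<tau>A: "(1 - w) * ?A = \<alpha> - m"
    using arg_cong[OF aUp, of \<tau>] mem m by (simp add: \<tau>_simps \<alpha>)
  have \<tau>B: "(1 - w) * ?B = \<tau> (p * p) - \<tau> (p * a)"
  proof -
    have "(1 - w) *\<^sub>R (p * a * U * p) = p * ((1 - w) *\<^sub>R (a * U * p))" by (simp add: mult.assoc)
    also have "\<dots> = p * p - p * a" unfolding aUp by (simp add: right_diff_distrib)
    finally have "\<tau> ((1 - w) *\<^sub>R (p * a * U * p)) = \<tau> (p * p - p * a)" by simp
    then show ?thesis using mem by (simp add: \<tau>_simps)
  qed
  have \<tau>pa: "(1 - w) * \<tau> (p * a) = \<tau> p - w * (1 + m)"
    using arg_cong[OF pa, of \<tau>] mem m by (simp add: \<tau>_simps)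
  have k: "?k * m = \<tau> p * m + ((1 + m) * \<tau> p * - 1 + \<tau> (p * a))"
  proof -
    have "m * \<kappa> = 1 + m" using m(3) by (simp add: \<kappa>_def)
    then have "m *\<^sub>R (p * (1 + \<kappa> *\<^sub>R u)) = m *\<^sub>R p + (1 + m) *\<^sub>R (p * u)"
      by (simp add: distrib_left scaleR_add_right)
    also have "(1 + m) *\<^sub>R (p * u) = p * a - (1 + m) *\<^sub>R p"
      using m by (simp add: u right_diff_distrib scaleR_diff_right)
    finally have "\<tau> (m *\<^sub>R (p * (1 + \<kappa> *\<^sub>R u))) = \<tau> (m *\<^sub>R p + (p * a - (1 + m) *\<^sub>R p))"
      by simp
    then show ?thesis using mem by (simp add: \<tau>_simps algebra_simps)
  qed
  have y: "\<tau> (v * q) * (1 + m) = x * (1 + m) - m * \<tau> q"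
  proof -
    have "(b - x *\<^sub>R (b * V)) * q = q" unfolding bV by simp
    then have bq: "b * q = q + x *\<^sub>R b" by (simp add: left_diff_distrib mult.assoc q diff_eq_eq)
    have "(1 + m) *\<^sub>R (v * q) = b * q - (1 + m) *\<^sub>R q"
      using m by (simp add: v left_diff_distrib scaleR_diff_right)
    then have "\<tau> ((1 + m) *\<^sub>R (v * q)) = \<tau> (q + x *\<^sub>R b - (1 + m) *\<^sub>R q)" unfolding bq by simp
    then show ?thesis using mem m by (simp add: \<tau>_simps algebra_simps)
  qed
  have zm: "z * m = w * x * (1 + m)" using m by (simp add: z_def)
  have P: "\<tau> p = 1 + \<alpha>" "\<tau> q * \<tau> p = c" "c * (\<tau> q * (\<tau> (p * p) - \<tau> p)) = d * \<alpha>"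
    using \<alpha> \<tau>pq UV1 UV2 by (auto simp: mult.commute)
  have ne: "\<tau> p \<noteq> 0" using \<tau>pq c by auto
  note eqs = regression_equations[OF m(3) wx(2) ne c(1) wx(1) P zm \<tau>A \<tau>B \<tau>pa k y E1 E2]
  show "w * (1 + m) * (c\<^sup>2 * \<alpha> + (d - c\<^sup>2) * m) = m * (c\<^sup>2 * \<alpha> + d + (d - c\<^sup>2) * m)"
    and "x * (1 + m) * (c\<^sup>2 * \<alpha> + d + (d - c\<^sup>2) * m) = c ^ 3 * m"
    by (fact eqs)+
qed

end

section \<open>Generating functions of the free Poisson and free binomial distributions\<close>

text \<open>
  At \<open>w = s - h\<close> the factor \<open>k\<close> is 0, so the last term is harmless although its argument has the
  value 0 / 0 at the left end point. This case is needed for the free binomial distribution with \<open>\<sigma> = 1\<close>.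
\<close>

lemma arcsin_antiderivative:
  fixes s h w x k :: real
  assumes h: "h > 0" and w: "w \<le> s - h" and x: "s - h < x" "x < s + h" and k: "k = sqrt ((s - w)\<^sup>2 - h\<^sup>2)"
  shows "((\<lambda>x. sqrt (h\<^sup>2 - (x - s)\<^sup>2) + (s - w) * arcsin ((x - s) / h)
      - k * arcsin (((s - w) * (x - w) - k\<^sup>2) / (h * (x - w))))
    has_real_derivative sqrt (h\<^sup>2 - (x - s)\<^sup>2) / (x - w)) (at x)"
proof -
  define p where "p = h\<^sup>2 - (x - s)\<^sup>2"
  define t where "t = x - w"
  define S where "S = s - w"
  have t: "t > 0" using w x by (simp add: t_def)
  have "p = (h - (x - s)) * (h + (x - s))" by (simp add: p_def power2_eq_square algebra_simps)
  then have p: "p > 0" using x by simp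
  have S: "S \<ge> h" using w by (simp add: S_def)
  have k2: "k\<^sup>2 = S\<^sup>2 - h\<^sup>2" and k0: "k \<ge> 0"
    using S h by (auto simp: k S_def[symmetric] intro!: power_mono)
  have pt: "p = - t\<^sup>2 + 2 * S * t - k\<^sup>2"
    unfolding k2 by (simp add: p_def t_def S_def power2_eq_square algebra_simps)
  have arc1: "- 1 < (x - s) / h" "(x - s) / h < 1" using x h by (simp_all add: field_simps)
  have d1: "((\<lambda>x. sqrt (h\<^sup>2 - (x - s)\<^sup>2)) has_real_derivative - (x - s) / sqrt p) (at x)"
    using p unfolding p_def by (auto intro!: derivative_eq_intros simp: field_simps)
  have "1 - ((x - s) / h)\<^sup>2 = p / h\<^sup>2" using h by (simp add: p_def power_divide field_simps)
  then have "sqrt (1 - ((x - s) / h)\<^sup>2) = sqrt p / h" using h by (simp add: real_sqrt_divide)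
  moreover have "((\<lambda>x. arcsin ((x - s) / h)) has_real_derivative
      inverse (sqrt (1 - ((x - s) / h)\<^sup>2)) * (1 / h)) (at x)"
    using h by (intro DERIV_chain2[of arcsin _ "\<lambda>x. (x - s) / h"] DERIV_arcsin arc1)
      (auto intro!: derivative_eq_intros)
  ultimately have d2: "((\<lambda>x. arcsin ((x - s) / h)) has_real_derivative 1 / sqrt p) (at x)"
    using h by simp
  have d3: "((\<lambda>x. k * arcsin (((s - w) * (x - w) - k\<^sup>2) / (h * (x - w)))) has_real_derivative
      k\<^sup>2 / (t * sqrt p)) (at x)"
  proof (cases "k = 0")
    case False
    then have k0: "k > 0" using k0 by simp
    define y where "y = (S * t - k\<^sup>2) / (h * t)"
    \<comment> \<open>This is \<open>1 - y\<^sup>2\<close> up to the factor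
      \<open>(h * t)\<^sup>2\<close>: it keeps the argument of the arcsine strictly between -1 and 1
      and makes the derivative explicit.\<close>
    have "(h * t)\<^sup>2 - (S * t - k\<^sup>2)\<^sup>2 = k\<^sup>2 * p"
      unfolding pt using k2 by algebra
    moreover have "y * (h * t) = S * t - k\<^sup>2" using h t by (simp add: y_def)
    ultimately have "(h * t)\<^sup>2 - (y * (h * t))\<^sup>2 = k\<^sup>2 * p" by simp
    then have "(1 - y\<^sup>2) * (h * t)\<^sup>2 = k\<^sup>2 * p"
      by (simp add: left_diff_distrib power_mult_distrib)
    then have y2: "1 - y\<^sup>2 = (k\<^sup>2 * p) / (h * t)\<^sup>2" using h t by (simp add: eq_divide_eq)
    also have "\<dots> > 0" using k0 p h t by simp
    finally have "y\<^sup>2 < 1" by simp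
    then have arc: "\<bar>y\<bar> < 1" by (simp add: abs_square_less_1)
    have sq: "sqrt (1 - y\<^sup>2) = k * sqrt p / (h * t)"
      using k0 h t unfolding y2 by (simp add: real_sqrt_divide real_sqrt_mult)
    have "((\<lambda>x. ((s - w) * (x - w) - k\<^sup>2) / (h * (x - w))) has_real_derivative
        ((s - w) * (h * (x - w)) - ((s - w) * (x - w) - k\<^sup>2) * h) / (h * (x - w) * (h * (x - w)))) (at x)"
      using h t unfolding t_def by (auto intro!: derivative_eq_intros)
    also have "((s - w) * (h * (x - w)) - ((s - w) * (x - w) - k\<^sup>2) * h) / (h * (x - w) * (h * (x - w)))
        = k\<^sup>2 / (h * t\<^sup>2)"
      using h t by (simp add: t_def[symmetric] S_def[symmetric] field_simps power2_eq_square)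
    finally have "((\<lambda>x. arcsin (((s - w) * (x - w) - k\<^sup>2) / (h * (x - w)))) has_real_derivative
        inverse (sqrt (1 - y\<^sup>2)) * (k\<^sup>2 / (h * t\<^sup>2))) (at x)"
      using DERIV_arcsin[of y] arc
      by (intro DERIV_chain2[of arcsin]) (simp_all only: abs_less_iff y_def t_def S_def minus_less_iff)
    from DERIV_cmult[OF this, of k] show ?thesis
    proof (rule DERIV_cong)
      show "k * (inverse (sqrt (1 - y\<^sup>2)) * (k\<^sup>2 / (h * t\<^sup>2))) = k\<^sup>2 / (t * sqrt p)"
        unfolding sq using k0 p h t by (simp add: field_simps power2_eq_square)
    qed
  qed simp
  have "- (x - s) / sqrt p + (s - w) * (1 / sqrt p) - k\<^sup>2 / (t * sqrt p) = sqrt p / t"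
  proof -
    have "- (x - s) / sqrt p + (s - w) * (1 / sqrt p) - k\<^sup>2 / (t * sqrt p)
      = (- (x - s) * t + S * t - k\<^sup>2) / (t * sqrt p)"
      using t p by (simp add: S_def field_simps)
    also have "- (x - s) * t + S * t - k\<^sup>2 = p" unfolding pt by (simp add: S_def t_def power2_eq_square algebra_simps)
    also have "p / (t * sqrt p) = sqrt p / t" using p t by (simp add: field_simps)
    finally show ?thesis .
  qed
  then show ?thesis
    using DERIV_diff[OF DERIV_add[OF d1 DERIV_cmult[OF d2, of "s - w"]] d3] by (simp add: p_def t_def)
qed

text \<open>Cauchy transform of an unnormalised semicircle density at a real point left of its
  support, end point included. Across the interval the arcsines of the antiderivative run from
  \<open>- pi / 2\<close> to \<open>pi / 2\<close>, the second one being void if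
  \<open>k = 0\<close>.\<close>

lemma has_integral_semicircle_left:
  fixes a b w :: real
  assumes ab: "a < b" and w: "w \<le> a"
  shows "has_bochner_integral lborel
    (\<lambda>x. indicator {a<..<b} x * (sqrt ((x - a) * (b - x)) / (x - w)))
    (pi * ((a + b) / 2 - w - sqrt ((a - w) * (b - w))))"
proof -
  define s h where "s = (a + b) / 2" and "h = (b - a) / 2"
  have h: "h > 0" and a: "a = s - h" and b: "b = s + h" using ab by (auto simp: s_def h_def field_simps)
  define k where "k = sqrt ((s - w)\<^sup>2 - h\<^sup>2)"
  have kab: "k = sqrt ((a - w) * (b - w))" by (simp add: k_def a b power2_eq_square algebra_simps)
  have k2: "k\<^sup>2 = (s - w)\<^sup>2 - h\<^sup>2" unfolding k_def using w a h by (intro real_sqrt_pow2) (simp add: power_mono)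
  define F where "F = (\<lambda>x. sqrt (h\<^sup>2 - (x - s)\<^sup>2) + (s - w) * arcsin ((x - s) / h)
      - k * arcsin (((s - w) * (x - w) - k\<^sup>2) / (h * (x - w))))"
  have p: "(x - a) * (b - x) = h\<^sup>2 - (x - s)\<^sup>2" for x by (simp add: a b power2_eq_square algebra_simps)
  define f where "f = (\<lambda>x. sqrt ((x - a) * (b - x)) / (x - w))"
  have DF: "(F has_real_derivative f x) (at x)" if "a < x" "x < b" for x
    unfolding F_def f_def p using arcsin_antiderivative[OF h _ _ _ k_def, of x] that w by (auto simp: a b)
  have contF: "continuous_on {a..b} F"
  proof -
    have c1: "continuous_on {a..b} (\<lambda>x. arcsin ((x - s) / h))"
      using h by (intro continuous_intros) (auto simp: a b field_simps)
    have c2: "continuous_on {a..b} (\<lambda>x. k * arcsin (((s - w) * (x - w) - k\<^sup>2) / (h * (x - w))))"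
    proof (cases "k = 0")
      case False
      have wa: "w < a" using False w by (cases "w = a") (auto simp: kab)
      have "- 1 \<le> ((s - w) * (x - w) - k\<^sup>2) / (h * (x - w)) \<and>
          ((s - w) * (x - w) - k\<^sup>2) / (h * (x - w)) \<le> 1" if x: "x \<in> {a..b}" for x
      proof -
        have "(h * (x - w))\<^sup>2 - ((s - w) * (x - w) - k\<^sup>2)\<^sup>2 = k\<^sup>2 * ((x - a) * (b - x))"
          unfolding p using k2 by algebra
        also have "\<dots> \<ge> 0" using x by auto
        finally have "\<bar>(s - w) * (x - w) - k\<^sup>2\<bar> \<le> \<bar>h * (x - w)\<bar>" by (simp add: abs_le_square_iff)
        then have "\<bar>((s - w) * (x - w) - k\<^sup>2) / (h * (x - w))\<bar> \<le> 1"
          using h wa x by (simp add: abs_mult)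
        then show ?thesis unfolding abs_le_iff by linarith
      qed
      then show ?thesis
        using wa h by (intro continuous_intros) auto
    qed simp
    show ?thesis unfolding F_def by (intro continuous_intros c1 c2)
  qed
  have ends: "F b - F a = pi * (s - w - k)"
  proof (cases "k = 0")
    case True
    then show ?thesis using h by (simp add: F_def a b field_simps)
  next
    case False
    then have "w \<noteq> a" by (auto simp: kab)
    then have wa: "0 < a - w" "0 < b - w" using w ab by auto
    have "(s - w) * (b - w) - k\<^sup>2 = h * (b - w)" "(s - w) * (a - w) - k\<^sup>2 = - (h * (a - w))"
      unfolding k2 by (simp_all add: a b power2_eq_square algebra_simps)
    then have e: "((s - w) * (b - w) - k\<^sup>2) / (h * (b - w)) = 1"
        "((s - w) * (a - w) - k\<^sup>2) / (h * (a - w)) = - 1"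
      using wa h by simp_all
    have F: "F b = (s - w) * (pi / 2) - k * (pi / 2)" "F a = (s - w) * - (pi / 2) - k * - (pi / 2)"
      using h unfolding F_def e by (simp_all add: a b)
    show ?thesis unfolding F by (simp add: field_simps)
  qed
  have f0: "0 \<le> f x" if "a < x" "x < b" for x using that w by (auto simp: f_def)
  have fc: "isCont f x" if "a < x" "x < b" for x
    unfolding f_def using that w by (intro continuous_intros) auto
  have lim: "(F \<longlongrightarrow> F a) (at_right a)" "(F \<longlongrightarrow> F b) (at_left b)"
    using contF ab by (auto intro: continuous_on_Icc_at_rightD continuous_on_Icc_at_leftD)
  have "set_integrable lborel (einterval (ereal a) (ereal b)) f"
    and "(LBINT x=ereal a..ereal b. f x) = F b - F a"
    by (rule interval_integral_FTC_nonneg[where F = F];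
        use ab DF fc f0 lim in \<open>auto simp: ereal_tendsto_simps\<close>)+
  then show ?thesis
    using ab unfolding ends interval_lebesgue_integral_def set_integrable_def set_lebesgue_integral_def
    by (simp add: has_bochner_integral_iff f_def einterval_eq kab s_def)
qed

text \<open>Reflection of the interval in its midpoint, \<open>x \<mapsto> a + b - x\<close>, leads
  back to the left-hand case.\<close>

lemma has_integral_semicircle_right:
  fixes a b w :: real
  assumes ab: "a < b" and w: "b \<le> w"
  shows "has_bochner_integral lborel
    (\<lambda>x. indicator {a<..<b} x * (sqrt ((x - a) * (b - x)) / (w - x)))
    (pi * (w - (a + b) / 2 - sqrt ((w - a) * (w - b))))"
proof -
  have "has_bochner_integral lborel
    (\<lambda>x. indicator {a<..<b} x * (sqrt ((x - a) * (b - x)) / (x - (a + b - w))))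
    (pi * (w - (a + b) / 2 - sqrt ((w - a) * (w - b))))"
    using has_integral_semicircle_left[of a b "a + b - w"] ab w by (simp add: field_simps mult.commute)
  from lborel_has_bochner_integral_real_affine_iff[of "-1", THEN iffD1, OF _ this, of "a + b"]
  have "has_bochner_integral lborel
    (\<lambda>x. indicator {a<..<b} (a + b - x) * (sqrt ((b - x) * (x - a)) / (w - x)))
    (pi * (w - (a + b) / 2 - sqrt ((w - a) * (w - b))))" by simp
  moreover have "indicator {a<..<b} (a + b - x) = (indicator {a<..<b} x :: real)" for x
    by (auto simp: indicator_def)
  ultimately show ?thesis by (simp add: mult.commute)
qed

lemma nn_integral_add_measure:
  assumes sets: "sets N = sets M" and f: "f \<in> borel_measurable M"
  shows "nn_integral (M \<oplus>\<^sub>M N) f = nn_integral M f + nn_integral N f"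
proof -
  have sp: "space (M \<oplus>\<^sub>M N) = space M" "space N = space M"
    by (rule sets_eq_imp_space_eq, simp add: sets)+
  show ?thesis using f
  proof (induction rule: borel_measurable_induct)
    case (cong f g)
    have "nn_integral K f = nn_integral K g" if "K \<in> {M, N, M \<oplus>\<^sub>M N}" for K
      using that cong(3) by (intro nn_integral_cong) (auto simp: sp)
    then show ?case using cong.IH by simp
  next
    case (set A)
    then show ?case by (simp add: sets emeasure_add_measure)
  next
    case (mult u c)
    have "u \<in> borel_measurable K" if "K \<in> {M, N, M \<oplus>\<^sub>M N}" for K
      using that mult(2) by (auto simp: measurable_def sets sp)
    then show ?case using mult.IH by (simp add: nn_integral_cmult distrib_left)
  next
    case (add u v)
    have m: "u \<in> borel_measurable K" "v \<in> borel_measurable K" if "K \<in> {M, N, M \<oplus>\<^sub>M N}" for K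
      using that add(1,3) by (auto simp: measurable_def sets sp)
    have "nn_integral K (\<lambda>x. v x + u x) = nn_integral K v + nn_integral K u" if "K \<in> {M, N, M \<oplus>\<^sub>M N}" for K
      using m[OF that] by (rule nn_integral_add[rotated])
    then show ?case using add.IH by (simp add: ac_simps)
  next
    case (seq U)
    have m: "U i \<in> borel_measurable K" if "K \<in> {M, N, M \<oplus>\<^sub>M N}" for K i
      using that seq(1)[of i] by (auto simp: measurable_def sets sp)
    have "(SUP i. U i) = (\<lambda>x. SUP i. U i x)" by (rule ext) (simp add: image_comp)
    then have eq: "nn_integral K (SUP i. U i) = (SUP i. nn_integral K (U i))" if "K \<in> {M, N, M \<oplus>\<^sub>M N}" for K
      using nn_integral_monotone_convergence_SUP[OF seq(3), of K] m[OF that] by simp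
    have inc: "incseq (\<lambda>i. nn_integral K (U i))" for K
      using seq(3) by (auto simp: incseq_def le_fun_def intro!: nn_integral_mono)
    have "nn_integral (M \<oplus>\<^sub>M N) (SUP i. U i) = (SUP i. nn_integral M (U i) + nn_integral N (U i))"
      unfolding seq.IH[symmetric] by (rule eq) simp
    also have "\<dots> = (SUP i. nn_integral M (U i)) + (SUP i. nn_integral N (U i))"
      by (rule ennreal_SUP_add[OF inc inc])
    also have "\<dots> = nn_integral M (SUP i. U i) + nn_integral N (SUP i. U i)"
      by (intro arg_cong2[where f = "(+)"] eq[symmetric]) simp_all
    finally show ?case .
  qed
qed

lemma has_bochner_integral_add_measure:
  fixes f :: "'a \<Rightarrow> real"
  assumes sets: "sets N = sets M"
    and M: "has_bochner_integral M f x" and N: "has_bochner_integral N f y"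
  shows "has_bochner_integral (M \<oplus>\<^sub>M N) f (x + y)"
proof -
  have [measurable]: "f \<in> borel_measurable M" using M by (auto simp: has_bochner_integral_iff)
  then have mN: "f \<in> borel_measurable N" "f \<in> borel_measurable (M \<oplus>\<^sub>M N)"
    by (simp_all add: measurable_cong_sets[OF sets_add_measure refl] measurable_cong_sets[OF sets refl])
  have nn: "nn_integral (M \<oplus>\<^sub>M N) (\<lambda>x. ennreal (g (f x)))
      = nn_integral M (\<lambda>x. ennreal (g (f x))) + nn_integral N (\<lambda>x. ennreal (g (f x)))"
    if "g \<in> borel_measurable borel" for g :: "real \<Rightarrow> real"
  proof -
    have [measurable]: "(\<lambda>x. g (f x)) \<in> borel_measurable M"
      by (rule measurable_compose[OF _ that]) measurable
    show ?thesis by (intro nn_integral_add_measure sets) measurable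
  qed
  have int: "integrable M f" "integrable N f" using M N by (auto simp: has_bochner_integral_iff)
  have fin: "nn_integral K (\<lambda>x. ennreal (f x)) < \<infinity>" "nn_integral K (\<lambda>x. ennreal (- f x)) < \<infinity>"
    if "integrable K f" for K using that by (auto simp: real_integrable_def less_top)
  have I: "integrable (M \<oplus>\<^sub>M N) f"
    unfolding real_integrable_def using mN nn[of "\<lambda>x. x"] nn[of uminus] fin[OF int(1)] fin[OF int(2)]
    by (simp add: less_top)
  have "integral\<^sup>L (M \<oplus>\<^sub>M N) f = integral\<^sup>L M f + integral\<^sup>L N f"
    unfolding real_lebesgue_integral_def[OF I] real_lebesgue_integral_def[OF int(1)]
      real_lebesgue_integral_def[OF int(2)]
    using nn[of "\<lambda>x. x"] nn[of uminus] fin[OF int(1)] fin[OF int(2)]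
    by (simp add: enn2real_plus)
  then show ?thesis using I M N by (simp add: has_bochner_integral_iff)
qed

lemma AE_add_measure:
  assumes borel: "sets M = sets borel" "sets N = sets borel" and pred: "{x. P x} \<in> sets borel"
    and AE: "AE x in M. P x" "AE x in N. P x"
  shows "AE x in M \<oplus>\<^sub>M N. P x"
proof -
  have sets: "sets N = sets M" by (simp add: borel)
  have sp: "space (M \<oplus>\<^sub>M N) = space M" "space N = space M"
    by (rule sets_eq_imp_space_eq, simp add: sets)+
  have P: "{x \<in> space M. P x} \<in> sets M" using pred sets_eq_imp_space_eq[OF borel(1)] borel(1) by simp
  have nP: "{x \<in> space M. \<not> P x} \<in> sets M"
    using sets.compl_sets[OF P] by (rule back_subst[of "\<lambda>A. A \<in> sets M"]) auto
  then have "emeasure M {x \<in> space M. \<not> P x} = 0" "emeasure N {x \<in> space M. \<not> P x} = 0"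
    using AE AE_iff_measurable[of _ M P] AE_iff_measurable[of _ N P] sets sp by auto
  then have "emeasure (M \<oplus>\<^sub>M N) {x \<in> space M. \<not> P x} = 0"
    by (simp add: emeasure_add_measure[OF sets])
  then show ?thesis
    using nP AE_iff_measurable[of "{x \<in> space M. \<not> P x}" "M \<oplus>\<^sub>M N" P] by (simp add: sp)
qed

lemma AE_scaled_return: "AE x in scale_measure r (return borel (a::real)). x = a"
  by (rule AE_I'[of "UNIV - {a}"]) (auto simp: null_sets_def)

lemma has_bochner_integral_scaled_return:
  fixes f :: "real \<Rightarrow> real"
  assumes "f \<in> borel_measurable borel" "0 \<le> r"
  shows "has_bochner_integral (scale_measure (ennreal r) (return borel a)) f (r * f a)"
proof -
  let ?K = "scale_measure (ennreal r) (return borel a)"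
  have K: "emeasure ?K (space ?K) = ennreal r"
    by (simp add: space_scale_measure)
  interpret finite_measure ?K by rule (simp only: K, simp)
  have "measure ?K (space ?K) = r" using K assms(2) by (simp add: measure_def)
  then have "has_bochner_integral ?K (\<lambda>_. f a) (r * f a)"
    by (simp add: has_bochner_integral_iff)
  moreover have "has_bochner_integral ?K f (r * f a) \<longleftrightarrow> has_bochner_integral ?K (\<lambda>_. f a) (r * f a)"
  proof (rule has_bochner_integral_cong_AE)
    show "f \<in> borel_measurable ?K" using assms(1) by (simp add: measurable_def space_scale_measure)
    show "AE x in ?K. f x = f a"
      using AE_scaled_return[where r = "ennreal r" and a = a] by (rule AE_mp) (rule AE_I2, simp)
  qed simp
  ultimately show ?thesis by simp
qed


lemma has_bochner_integral_indicator_density: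
  fixes f g :: "real \<Rightarrow> real"
  assumes "f \<in> borel_measurable borel" "g \<in> borel_measurable borel" "\<And>x. a < x \<Longrightarrow> x < b \<Longrightarrow> 0 \<le> g x"
    and "has_bochner_integral lborel (\<lambda>x. indicator {a<..<b} x * (g x * f x)) I"
  shows "has_bochner_integral (density lborel (\<lambda>x. ennreal (indicator {a<..<b} x * g x))) f I"
proof (rule has_bochner_integral_density)
  have [measurable]: "f \<in> borel_measurable borel" "g \<in> borel_measurable borel" by (fact assms)+
  show "f \<in> borel_measurable lborel" "(\<lambda>x. indicator {a<..<b} x * g x) \<in> borel_measurable lborel"
    by measurable
  show "AE x in lborel. 0 \<le> indicator {a<..<b} x * g x"
    by (rule AE_I2) (simp add: indicator_def assms(3))
  show "has_bochner_integral lborel (\<lambda>x. (indicator {a<..<b} x * g x) *\<^sub>R f x) I"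
    using assms(4) by (simp add: mult.assoc)
qed

lemma AE_indicator_density:
  fixes g :: "real \<Rightarrow> real"
  assumes "g \<in> borel_measurable borel"
  shows "AE x in density lborel (\<lambda>x. ennreal (indicator {a<..<b} x * g x)). a < x \<and> x < b"
proof (subst AE_density)
  have [measurable]: "g \<in> borel_measurable borel" by (fact assms)
  show "(\<lambda>x. ennreal (indicator {a<..<b} x * g x)) \<in> borel_measurable lborel" by measurable
  show "AE x in lborel. 0 < ennreal (indicator {a<..<b} x * g x) \<longrightarrow> a < x \<and> x < b"
    by (rule AE_I2) (simp add: indicator_def)
qed

lemma prob_space_has_bochner_integral_one:
  assumes "has_bochner_integral M (\<lambda>_. 1::real) 1"
  shows "prob_space M"
proof
  have "(\<integral>\<^sup>+x. ennreal 1 \<partial>M) = ennreal 1"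
    using assms by (subst nn_integral_eq_integral) (auto simp: has_bochner_integral_iff)
  then show "emeasure M (space M) = 1" by simp
qed

text \<open>For \<open>\<rho> > 1\<close> the atom at 0 has mass 0. Partial fractions split
  \<open>1 / (x * (1 - w * x))\<close> into poles at 0 and at \<open>W = 1 / w\<close>, hence into
  two semicircle integrals; isolating the remaining square root and squaring gives the quadratic
  equation.\<close>

lemma free_poisson_generating_function:
  fixes \<alpha> \<rho> :: real
  assumes \<alpha>: "\<alpha> > 0" and \<rho>: "\<rho> > 1"
  defines "b \<equiv> \<alpha> * (1 + sqrt \<rho>)\<^sup>2"
  shows "prob_space (free_poisson \<alpha> \<rho>)" "sets (free_poisson \<alpha> \<rho>) = sets borel"
    and "AE x in free_poisson \<alpha> \<rho>. \<bar>x\<bar> \<le> b"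
    and "\<And>w m. 0 < w \<Longrightarrow> w * b < 1 \<Longrightarrow> m = (\<integral>x. 1 / (1 - w * x) \<partial>free_poisson \<alpha> \<rho>) - 1 \<Longrightarrow>
      \<alpha> * w * m\<^sup>2 + (\<alpha> * w * (1 + \<rho>) - 1) * m + \<alpha> * w * \<rho> = 0"
proof -
  define a where "a = \<alpha> * (1 - sqrt \<rho>)\<^sup>2"
  have sq: "(sqrt \<rho>)\<^sup>2 = \<rho>" "sqrt \<rho> > 1" using \<rho> by auto
  have ab: "0 < a" "a < b"
  proof -
    show "0 < a" using \<alpha> sq(2) by (simp add: a_def)
    have "(1 - sqrt \<rho>)\<^sup>2 < (1 + sqrt \<rho>)\<^sup>2" using sq(2) by (simp add: power2_eq_square algebra_simps)
    then show "a < b" using \<alpha> by (simp add: a_def b_def)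
  qed
  \<comment> \<open>That \<open>a * b\<close> is a perfect square makes the integral with the pole
    at 0 free of roots.\<close>
  have sum: "a + b = 2 * \<alpha> * (1 + \<rho>)" and prod: "a * b = (\<alpha> * (\<rho> - 1))\<^sup>2"
  proof -
    have "(1 - sqrt \<rho>) * (1 + sqrt \<rho>) = 1 - \<rho>" using sq(1) by (simp add: algebra_simps power2_eq_square)
    then have "a * b = \<alpha>\<^sup>2 * (1 - \<rho>)\<^sup>2"
      unfolding a_def b_def by (simp add: power2_eq_square mult_ac flip: \<open>_ = 1 - \<rho>\<close>)
    then show "a * b = (\<alpha> * (\<rho> - 1))\<^sup>2" by (simp add: power_mult_distrib power2_commute)
    show "a + b = 2 * \<alpha> * (1 + \<rho>)"
      using sq(1) by (simp add: a_def b_def power2_eq_square algebra_simps)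
  qed
  define g where "g = (\<lambda>x. 1 / (2 * pi * \<alpha> * x) * sqrt (4 * \<rho> * \<alpha>\<^sup>2 - (x - \<alpha> * (1 + \<rho>))\<^sup>2))"
  have g_eq: "g x = 1 / (2 * pi * \<alpha>) * (sqrt ((x - a) * (b - x)) / x)" for x
  proof -
    have "4 * \<rho> * \<alpha>\<^sup>2 - (x - \<alpha> * (1 + \<rho>))\<^sup>2 = (x - a) * (b - x)"
      using sum prod by algebra
    then show ?thesis by (simp add: g_def)
  qed
  have gm [measurable]: "g \<in> borel_measurable borel" unfolding g_def by measurable
  have g0: "0 \<le> g x" if "a < x" "x < b" for x
    using that \<alpha> ab by (simp add: g_eq)
  let ?D = "density lborel (\<lambda>x. ennreal (indicator {a<..<b} x * g x))"
  have fp: "free_poisson \<alpha> \<rho> = scale_measure (ennreal 0) (return borel 0) \<oplus>\<^sub>M ?D"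
    unfolding free_poisson_def a_def b_def g_def using \<rho> by (simp add: max_def)
  have FP: "has_bochner_integral (free_poisson \<alpha> \<rho>) f I"
    if "f \<in> borel_measurable borel" "has_bochner_integral lborel (\<lambda>x. indicator {a<..<b} x * (g x * f x)) I"
    for f :: "real \<Rightarrow> real" and I
    using has_bochner_integral_add_measure[OF _ has_bochner_integral_scaled_return[OF that(1), of 0 0]
        has_bochner_integral_indicator_density[OF that(1) _ g0 that(2)]]
    by (simp add: fp)
  have left: "has_bochner_integral lborel (\<lambda>x. indicator {a<..<b} x * (sqrt ((x - a) * (b - x)) / x))
      (pi * (\<alpha> * (1 + \<rho>) - \<alpha> * (\<rho> - 1)))"
    using has_integral_semicircle_left[OF ab(2), of 0] ab sum \<alpha> \<rho> by (simp add: prod)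
  show "prob_space (free_poisson \<alpha> \<rho>)"
  proof (rule prob_space_has_bochner_integral_one, rule FP)
    have "1 / (2 * pi * \<alpha>) * (pi * (\<alpha> * (1 + \<rho>) - \<alpha> * (\<rho> - 1))) = 1"
      using \<alpha> by (simp add: field_simps)
    with has_bochner_integral_mult_right[OF left, of "1 / (2 * pi * \<alpha>)"]
    show "has_bochner_integral lborel (\<lambda>x. indicator {a<..<b} x * (g x * 1)) 1"
      by (simp only: g_eq mult_1_right mult.left_commute[of "indicator _ _"])
  qed simp
  show "sets (free_poisson \<alpha> \<rho>) = sets borel" by (simp add: fp)
  show "AE x in free_poisson \<alpha> \<rho>. \<bar>x\<bar> \<le> b"
    unfolding fp
  proof (rule AE_add_measure)
    show "AE x in scale_measure (ennreal 0) (return borel 0). \<bar>x\<bar> \<le> b"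
      using AE_scaled_return by eventually_elim (use ab in auto)
    show "AE x in ?D. \<bar>x\<bar> \<le> b"
      using AE_indicator_density[OF gm] by eventually_elim (use ab in auto)
  qed auto
  fix w m assume w: "0 < w" "w * b < 1" and m: "m = (\<integral>x. 1 / (1 - w * x) \<partial>free_poisson \<alpha> \<rho>) - 1"
  define W where "W = 1 / w"
  have W: "b < W" using w by (simp add: W_def field_simps)
  have right: "has_bochner_integral lborel (\<lambda>x. indicator {a<..<b} x * (sqrt ((x - a) * (b - x)) / (W - x)))
      (pi * (W - \<alpha> * (1 + \<rho>) - sqrt ((W - a) * (W - b))))"
    using has_integral_semicircle_right[OF ab(2), of W] W sum by simp
  let ?I = "1 / (2 * pi * \<alpha>) * (pi * (\<alpha> * (1 + \<rho>) - \<alpha> * (\<rho> - 1)) + pi * (W - \<alpha> * (1 + \<rho>) - sqrt ((W - a) * (W - b))))"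
  have "has_bochner_integral lborel (\<lambda>x. indicator {a<..<b} x * (g x * (1 / (1 - w * x)))) ?I"
  proof (rule has_bochner_integral_cong[THEN iffD1, OF refl _ refl
        has_bochner_integral_mult_right[OF has_bochner_integral_add[OF left right], of "1 / (2 * pi * \<alpha>)"]])
    fix x
    show "1 / (2 * pi * \<alpha>) * (indicator {a<..<b} x * (sqrt ((x - a) * (b - x)) / x)
        + indicator {a<..<b} x * (sqrt ((x - a) * (b - x)) / (W - x)))
      = indicator {a<..<b} x * (g x * (1 / (1 - w * x)))"
    proof (cases "x \<in> {a<..<b}")
      case True
      then have "0 < x" "x < W" using ab W by auto
      then have "1 / x + 1 / (W - x) = 1 / x * (1 / (1 - w * x))"
        using w by (simp add: W_def field_simps)
      then have "sqrt ((x - a) * (b - x)) / x + sqrt ((x - a) * (b - x)) / (W - x)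
          = sqrt ((x - a) * (b - x)) / x * (1 / (1 - w * x))"
        by (metis (no_types, opaque_lifting) mult.assoc distrib_left times_divide_eq_right mult_1_right)
      then show ?thesis using True by (simp add: g_eq)
    qed simp
  qed
  from FP[OF _ this] have "(\<integral>x. 1 / (1 - w * x) \<partial>free_poisson \<alpha> \<rho>) = ?I"
    by (simp add: has_bochner_integral_iff)
  also have "?I = (\<alpha> * (1 + \<rho>) - \<alpha> * (\<rho> - 1) + (W - \<alpha> * (1 + \<rho>) - sqrt ((W - a) * (W - b)))) / (2 * \<alpha>)"
    unfolding distrib_left[symmetric] by simp
  finally have "2 * \<alpha> * (m + 1)
      = \<alpha> * (1 + \<rho>) - \<alpha> * (\<rho> - 1) + (W - \<alpha> * (1 + \<rho>) - sqrt ((W - a) * (W - b)))"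
    using \<alpha> unfolding m by simp
  then have "sqrt ((W - a) * (W - b)) = W - \<alpha> * (1 + \<rho>) - 2 * \<alpha> * m"
    by (simp add: algebra_simps)
  moreover have "(sqrt ((W - a) * (W - b)))\<^sup>2 = (W - a) * (W - b)"
    using W ab by (intro real_sqrt_pow2) auto
  ultimately have "(W - \<alpha> * (1 + \<rho>) - 2 * \<alpha> * m)\<^sup>2 = (W - a) * (W - b)" by simp
  also have "\<dots> = W\<^sup>2 - W * (a + b) + a * b"
    by (simp add: algebra_simps power2_eq_square)
  finally have "(4 * \<alpha>) * (\<alpha> * m\<^sup>2 + (\<alpha> * (1 + \<rho>) - W) * m + \<alpha> * \<rho>) = 0"
    unfolding sum prod by algebra
  then have "\<alpha> * m\<^sup>2 + (\<alpha> * (1 + \<rho>) - W) * m + \<alpha> * \<rho> = 0" using \<alpha> by simp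
  then have "w * (\<alpha> * m\<^sup>2 + (\<alpha> * (1 + \<rho>) - W) * m + \<alpha> * \<rho>) = 0" by simp
  then show "\<alpha> * w * m\<^sup>2 + (\<alpha> * w * (1 + \<rho>) - 1) * m + \<alpha> * w * \<rho> = 0"
    using w by (simp add: W_def algebra_simps)
qed

text \<open>For \<open>\<theta> > 1\<close> there is no atom at 1, but for
  \<open>\<sigma> < 1\<close> there is one at 0. The integrand has the three poles 0, 1 and
  \<open>W = 1 / w\<close>. At \<open>\<sigma> = 1\<close> the lower end \<open>a\<close> is 0, so a
  pole sits at the end of the support.\<close>

lemma free_binomial_generating_function:
  fixes \<sigma> \<theta> :: real
  assumes \<sigma>: "\<sigma> > 0" and \<theta>: "\<theta> > 1"
  shows "prob_space (free_binomial \<sigma> \<theta>)" "sets (free_binomial \<sigma> \<theta>) = sets borel"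
    and "AE x in free_binomial \<sigma> \<theta>. \<bar>x\<bar> \<le> 1"
    and "\<And>w m. 0 < w \<Longrightarrow> w < 1 \<Longrightarrow> m = (\<integral>x. 1 / (1 - w * x) \<partial>free_binomial \<sigma> \<theta>) - 1 \<Longrightarrow>
      (1 - w) * m\<^sup>2 + (\<sigma> + \<theta> - w * (1 + \<sigma>)) * m + - (w * \<sigma>) = 0"
proof -
  define n where "n = \<sigma> + \<theta>"
  have n: "n > 1" "n > \<sigma>" using \<sigma> \<theta> by (auto simp: n_def)
  define P Q where "P = sqrt (\<sigma> / n * (1 - 1 / n))" and "Q = sqrt (1 / n * (1 - \<sigma> / n))"
  define a b where "a = free_binomial_lower \<sigma> \<theta>" and "b = free_binomial_upper \<sigma> \<theta>"
  have a_eq: "a = (P - Q)\<^sup>2" and b_eq: "b = (P + Q)\<^sup>2"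
    by (simp_all add: a_def b_def P_def Q_def n_def free_binomial_lower_def free_binomial_upper_def)
  have PQ: "P > 0" "Q > 0" using \<sigma> n by (auto simp: P_def Q_def)
  have P2: "P\<^sup>2 = \<sigma> * (n - 1) / n\<^sup>2"
    unfolding P_def using \<sigma> n by (subst real_sqrt_pow2) (auto simp: field_simps power2_eq_square)
  have Q2: "Q\<^sup>2 = \<theta> / n\<^sup>2"
    unfolding Q_def using \<sigma> n by (subst real_sqrt_pow2) (auto simp: field_simps power2_eq_square n_def)
  define s where "s = P\<^sup>2 + Q\<^sup>2"
  have ab: "0 \<le> a" "a < b"
  proof -
    show "0 \<le> a" by (simp add: a_eq)
    show "a < b" using PQ by (simp add: a_eq b_eq power2_eq_square algebra_simps)
  qed
  have sum: "a + b = 2 * s" by (simp add: a_eq b_eq s_def power2_eq_square algebra_simps)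
  have s_eq: "n\<^sup>2 * s = \<sigma> * (n - 1) + \<theta>" using n by (simp add: s_def P2 Q2 field_simps)
  have dPQ: "n * (P\<^sup>2 - Q\<^sup>2) = \<sigma> - 1"
  proof -
    have "n * (n * (P\<^sup>2 - Q\<^sup>2)) = n\<^sup>2 * P\<^sup>2 - n\<^sup>2 * Q\<^sup>2" by (simp add: power2_eq_square algebra_simps)
    also have "\<dots> = \<sigma> * (n - 1) - \<theta>" using n by (simp add: P2 Q2)
    also have "\<dots> = n * (\<sigma> - 1)" by (simp add: n_def algebra_simps)
    finally show ?thesis using n by simp
  qed
  have ab_prod: "n\<^sup>2 * (a * b) = (\<sigma> - 1)\<^sup>2"
  proof -
    have "n\<^sup>2 * (a * b) = (n * (P\<^sup>2 - Q\<^sup>2))\<^sup>2"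
      by (simp add: a_eq b_eq power2_eq_square algebra_simps)
    then show ?thesis by (simp add: dPQ)
  qed
  have ab_prod1: "n\<^sup>2 * ((1 - a) * (1 - b)) = (\<theta> - 1)\<^sup>2"
  proof -
    have "n\<^sup>2 * ((1 - a) * (1 - b)) = n\<^sup>2 - n\<^sup>2 * (a + b) + n\<^sup>2 * (a * b)" by (simp add: algebra_simps)
    also have "\<dots> = n\<^sup>2 - 2 * (\<sigma> * (n - 1) + \<theta>) + (\<sigma> - 1)\<^sup>2"
      unfolding sum ab_prod s_eq[symmetric] by simp
    also have "\<dots> = (\<theta> - 1)\<^sup>2" by (simp add: n_def power2_eq_square algebra_simps)
    finally show ?thesis .
  qed
  \<comment> \<open>Product and sum of \<open>1 - a\<close> and \<open>1 - b\<close> are positive,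
    hence both numbers are.\<close>
  have b1: "b < 1"
  proof -
    have "0 < n\<^sup>2 * ((1 - a) * (1 - b))" using \<theta> by (simp add: ab_prod1)
    then have "0 < (1 - a) * (1 - b)" using n by (simp add: zero_less_mult_iff)
    moreover have "n\<^sup>2 * s < n\<^sup>2 * 1"
    proof -
      have "0 < \<theta> * (\<theta> - 1) + \<sigma> * \<theta> + \<sigma>" using \<sigma> \<theta> by (intro add_pos_pos mult_pos_pos) auto
      then show ?thesis unfolding s_eq by (simp add: n_def power2_eq_square algebra_simps)
    qed
    then have "s < 1" using n by simp
    then have "0 < (1 - a) + (1 - b)" using sum by simp
    ultimately show ?thesis by (auto simp: zero_less_mult_iff)
  qed
  have sqab: "n * sqrt (a * b) = \<bar>\<sigma> - 1\<bar>"
    using arg_cong[OF ab_prod, of sqrt] n by (simp add: real_sqrt_mult)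
  have sqab1: "n * sqrt ((1 - a) * (1 - b)) = \<theta> - 1"
    using arg_cong[OF ab_prod1, of sqrt] n \<theta> by (simp add: real_sqrt_mult)
  let ?r = "\<lambda>x. sqrt ((x - a) * (b - x))"
  define g where "g = (\<lambda>x. (\<sigma> + \<theta>) * sqrt ((x - a) * (b - x)) / (2 * pi * x * (1 - x)))"
  have gm [measurable]: "g \<in> borel_measurable borel" unfolding g_def by measurable
  have g_eq: "g x = n / (2 * pi) * (?r x * (1 / (x * (1 - x))))" for x
    by (simp add: g_def n_def)
  have g0: "0 \<le> g x" if "a < x" "x < b" for x
    using that n ab b1 by (simp add: g_eq)
  let ?D = "density lborel (\<lambda>x. ennreal (indicator {a<..<b} x * g x))"
  \<comment> \<open>The mass at 0. The form
    \<open>2 * e = 1 - \<sigma> + \<bar>\<sigma> - 1\<bar>\<close> offsets the absolute value coming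
    from \<open>n * sqrt (a * b)\<close>, so that one computation covers \<open>\<sigma> < 1\<close>
    and \<open>\<sigma> \<ge> 1\<close>.\<close>
  define e where "e = (if \<sigma> < 1 then 1 - \<sigma> else 0)"
  have e: "0 \<le> e" "2 * e = 1 - \<sigma> + \<bar>\<sigma> - 1\<bar>" by (auto simp: e_def)
  let ?K = "scale_measure (ennreal e) (return borel 0) \<oplus>\<^sub>M ?D \<oplus>\<^sub>M scale_measure (ennreal 0) (return borel 1)"
  have fb: "free_binomial \<sigma> \<theta> = ?K"
    unfolding free_binomial_def a_def b_def g_def e_def using \<sigma> \<theta> by simp
  have FB: "has_bochner_integral (free_binomial \<sigma> \<theta>) f (e * f 0 + I)"
    if "f \<in> borel_measurable borel" "has_bochner_integral lborel (\<lambda>x. indicator {a<..<b} x * (g x * f x)) I"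
    for f :: "real \<Rightarrow> real" and I
    using has_bochner_integral_add_measure[OF _ has_bochner_integral_add_measure[OF _
          has_bochner_integral_scaled_return[OF that(1) e(1), of 0]
          has_bochner_integral_indicator_density[OF that(1) gm g0 that(2)]]
        has_bochner_integral_scaled_return[OF that(1), of 0 1]]
    by (simp add: fb)
  have left: "has_bochner_integral lborel (\<lambda>x. indicator {a<..<b} x * (?r x / x))
      (pi * (s - sqrt (a * b)))"
    using has_integral_semicircle_left[OF ab(2), of 0] ab sum by simp
  have right: "has_bochner_integral lborel (\<lambda>x. indicator {a<..<b} x * (?r x / (w - x)))
      (pi * (w - s - sqrt ((w - a) * (w - b))))" if "b \<le> w" for w
    using has_integral_semicircle_right[OF ab(2) that] sum by simp
  show "prob_space (free_binomial \<sigma> \<theta>)"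
  proof (rule prob_space_has_bochner_integral_one)
    let ?I = "n / (2 * pi) * (pi * (s - sqrt (a * b)) + pi * (1 - s - sqrt ((1 - a) * (1 - b))))"
    have "has_bochner_integral lborel (\<lambda>x. indicator {a<..<b} x * (g x * 1)) ?I"
    proof -
      have J: "has_bochner_integral lborel
          (\<lambda>x. n / (2 * pi) * (indicator {a<..<b} x * (?r x / x) + indicator {a<..<b} x * (?r x / (1 - x)))) ?I"
        using b1 by (intro has_bochner_integral_mult_right has_bochner_integral_add left right) simp
      have eq: "n / (2 * pi) * (indicator {a<..<b} x * (?r x / x) + indicator {a<..<b} x * (?r x / (1 - x)))
        = indicator {a<..<b} x * (g x * 1)" for x
      proof (cases "x \<in> {a<..<b}")
        case True
        then have x: "0 < x" "x < 1" using ab b1 by auto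
        then have "1 / (x * (1 - x)) = 1 / x + 1 / (1 - x)" by (simp add: field_simps)
        then show ?thesis using True by (simp add: g_eq distrib_left)
      qed simp
      from J show ?thesis unfolding eq .
    qed
    from FB[OF _ this] have "has_bochner_integral (free_binomial \<sigma> \<theta>) (\<lambda>_. 1) (e + ?I)" by simp
    moreover have "e + ?I = 1"
    proof -
      have "2 * ?I = n - n * sqrt (a * b) - n * sqrt ((1 - a) * (1 - b))" by (simp add: field_simps)
      also have "\<dots> = n - \<bar>\<sigma> - 1\<bar> - (\<theta> - 1)" by (simp only: sqab sqab1)
      finally have "2 * ?I = n - \<bar>\<sigma> - 1\<bar> - (\<theta> - 1)" .
      moreover have "x = 1" if "2 * J = n - \<bar>\<sigma> - 1\<bar> - (\<theta> - 1)" "x = e + J" for x J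
        using that e(2) n_def by linarith
      ultimately show ?thesis by blast
    qed
    ultimately show "has_bochner_integral (free_binomial \<sigma> \<theta>) (\<lambda>_. 1::real) 1" by simp
  qed
  show "sets (free_binomial \<sigma> \<theta>) = sets borel" by (simp add: fb)
  show "AE x in free_binomial \<sigma> \<theta>. \<bar>x\<bar> \<le> 1"
    unfolding fb
  proof (intro AE_add_measure)
    show "AE x in scale_measure (ennreal e) (return borel 0). \<bar>x\<bar> \<le> (1::real)"
      using AE_scaled_return by eventually_elim auto
    show "AE x in scale_measure (ennreal 0) (return borel 1). \<bar>x\<bar> \<le> (1::real)"
      using AE_scaled_return by eventually_elim auto
    show "AE x in ?D. \<bar>x\<bar> \<le> 1"
      using AE_indicator_density[OF gm] by eventually_elim (use ab b1 in auto)
  qed auto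
  fix w m assume w: "0 < w" "w < 1" and m: "m = (\<integral>x. 1 / (1 - w * x) \<partial>free_binomial \<sigma> \<theta>) - 1"
  define W where "W = 1 / w"
  have W: "1 < W" using w by (simp add: W_def field_simps)
  define T where "T = sqrt ((W - a) * (W - b))"
  define I where "I = n / (2 * pi) * (pi * (s - sqrt (a * b))
      + 1 / (1 - w) * (pi * (1 - s - sqrt ((1 - a) * (1 - b))))
      - w / (1 - w) * (pi * (W - s - T)))"
  have "has_bochner_integral lborel (\<lambda>x. indicator {a<..<b} x * (g x * (1 / (1 - w * x)))) I"
  proof -
    have J: "has_bochner_integral lborel
        (\<lambda>x. n / (2 * pi) * (indicator {a<..<b} x * (?r x / x) + 1 / (1 - w) * (indicator {a<..<b} x * (?r x / (1 - x)))
        - w / (1 - w) * (indicator {a<..<b} x * (?r x / (W - x))))) I"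
      unfolding I_def T_def using b1 W
      by (intro has_bochner_integral_mult_right has_bochner_integral_add has_bochner_integral_diff left right)
        simp_all
    have eq: "n / (2 * pi) * (indicator {a<..<b} x * (?r x / x) + 1 / (1 - w) * (indicator {a<..<b} x * (?r x / (1 - x)))
        - w / (1 - w) * (indicator {a<..<b} x * (?r x / (W - x))))
      = indicator {a<..<b} x * (g x * (1 / (1 - w * x)))" for x
    proof (cases "x \<in> {a<..<b}")
      case True
      then have x: "0 < x" "x < 1" using ab b1 by auto
      have wx: "w * x < 1" using x w mult_strict_mono[of w 1 x 1] by simp
      have Wx: "1 / (W - x) = w / (1 - w * x)" using w by (simp add: W_def field_simps)
      have "1 / (x * (1 - x)) * (1 / (1 - w * x)) = 1 / x + 1 / (1 - w) * (1 / (1 - x)) - w / (1 - w) * (1 / (W - x))"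
      proof -
        define X Y Z where "X = 1 - x" and "Y = 1 - w * x" and "Z = 1 - w"
        have nz: "X \<noteq> 0" "Y \<noteq> 0" "Z \<noteq> 0" "x \<noteq> 0" using x w wx by (auto simp: X_def Y_def Z_def)
        have "1 / x + 1 / Z * (1 / X) - w / Z * (w / Y) = (Z * X * Y + x * Y - w * w * x * X) / (x * X * Y * Z)"
          using nz by (simp add: field_simps)
        also have "Z * X * Y + x * Y - w * w * x * X = Z"
          by (simp add: X_def Y_def Z_def algebra_simps)
        also have "Z / (x * X * Y * Z) = 1 / (x * X) * (1 / Y)" using nz by simp
        finally show ?thesis unfolding Wx X_def Y_def Z_def by simp
      qed
      then have "g x * (1 / (1 - w * x)) = n / (2 * pi) * (?r x *
          (1 / x + 1 / (1 - w) * (1 / (1 - x)) - w / (1 - w) * (1 / (W - x))))"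
        unfolding g_eq by (simp only: mult.assoc)
      then show ?thesis using True by (simp add: algebra_simps)
    qed simp
    from J show ?thesis unfolding eq .
  qed
  from FB[OF _ this] have "(\<integral>x. 1 / (1 - w * x) \<partial>free_binomial \<sigma> \<theta>) = e + I"
    by (simp add: has_bochner_integral_iff)
  then have mI: "1 + m = e + I" by (simp add: m)
  have "2 * (1 - w) * I = (1 - w) * (n * s - n * sqrt (a * b)) + (n - n * s - n * sqrt ((1 - a) * (1 - b)))
      - w * (n * (W - s - T))"
  proof -
    define Z where "Z = 1 - w"
    have "Z \<noteq> 0" using w by (simp add: Z_def)
    then show ?thesis unfolding I_def Z_def[symmetric] by (simp add: field_simps)
  qed
  also have "\<dots> = (1 - w) * (n * s - \<bar>\<sigma> - 1\<bar>) + (n - n * s - (\<theta> - 1)) - (n - w * n * s - w * n * T)"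
    unfolding sqab sqab1 using w by (simp add: W_def algebra_simps)
  finally have "2 * (1 - w) * I + (1 - w) * (2 * e) = (1 - w) * (1 - \<sigma>) + 1 - \<theta> + w * n * T"
    unfolding e(2) by (simp add: algebra_simps)
  then have "2 * (1 - w) * (1 + m) = (1 - w) * (1 - \<sigma>) + 1 - \<theta> + w * n * T"
    unfolding mI by (simp add: algebra_simps)
  \<comment> \<open>The left side is the derivative in \<open>m\<close> of the desired quadratic
    polynomial, so the square of \<open>w * n * T\<close> has to come out as its
    discriminant.\<close>
  then have root: "2 * (1 - w) * m + (n - w * (1 + \<sigma>)) = w * n * T"
    by (simp add: n_def algebra_simps)
  have "T\<^sup>2 = (W - a) * (W - b)" unfolding T_def using W b1 ab by (intro real_sqrt_pow2) auto
  then have "w\<^sup>2 * T\<^sup>2 = w\<^sup>2 * ((W - a) * (W - b))" by simp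
  also have "\<dots> = (w * W - w * a) * (w * W - w * b)"
    by (simp add: power2_eq_square algebra_simps)
  also have "w * W = 1" using w by (simp add: W_def)
  finally have "(w * n * T)\<^sup>2 = n\<^sup>2 * ((1 - w * a) * (1 - w * b))"
    by (simp add: power_mult_distrib)
  also have "\<dots> = n\<^sup>2 - 2 * w * (n\<^sup>2 * s) + w\<^sup>2 * (n\<^sup>2 * (a * b))"
  proof -
    have "n\<^sup>2 * ((1 - w * a) * (1 - w * b)) = n\<^sup>2 - w * n\<^sup>2 * (a + b) + w\<^sup>2 * (n\<^sup>2 * (a * b))"
      by (simp add: power2_eq_square algebra_simps)
    then show ?thesis by (simp add: sum)
  qed
  also have "\<dots> = (n - w * (1 + \<sigma>))\<^sup>2 + 4 * w * \<sigma> * (1 - w)"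
    unfolding s_eq ab_prod by (simp add: n_def power2_eq_square algebra_simps)
  finally have "(2 * (1 - w) * m + (n - w * (1 + \<sigma>)))\<^sup>2 = (n - w * (1 + \<sigma>))\<^sup>2 + 4 * w * \<sigma> * (1 - w)"
    unfolding root .
  then have "4 * (1 - w) * ((1 - w) * m\<^sup>2 + (n - w * (1 + \<sigma>)) * m + - (w * \<sigma>)) = 0"
    by (simp add: power2_eq_square algebra_simps)
  then show "(1 - w) * m\<^sup>2 + (\<sigma> + \<theta> - w * (1 + \<sigma>)) * m + - (w * \<sigma>) = 0"
    using w by (simp add: n_def)
qed

section \<open>Comparison of moments\<close>

text \<open>Once the lower coefficients vanish, dividing by \<open>w ^ n\<close> and letting
  \<open>w\<close> tend to 0 from the right isolates \<open>c n\<close>.\<close>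

lemma power_series_zero_coeffs:
  fixes c :: "nat \<Rightarrow> real"
  assumes K: "K > 0" "\<And>n. \<bar>c n\<bar> \<le> L * K ^ n" and \<delta>: "\<delta> > 0"
    and zero: "\<And>w. 0 < w \<Longrightarrow> w < \<delta> \<Longrightarrow> (\<Sum>n. c n * w ^ n) = 0"
  shows "c n = 0"
proof (induction n rule: less_induct)
  case (less n)
  \<comment> \<open>The point \<open>1 / (2 * K)\<close> lies inside the disc of convergence
    guaranteed by the bound on the coefficients.\<close>
  have sm: "summable (\<lambda>k. c (k + j) * (1 / (2 * K)) ^ k)" for j
  proof (rule summable_comparison_test')
    show "summable (\<lambda>k. L * K ^ j * (1 / 2) ^ k)" by (intro summable_mult summable_geometric) simp
    fix k
    have "\<bar>c (k + j)\<bar> * (1 / (2 * K)) ^ k \<le> L * K ^ (k + j) * (1 / (2 * K)) ^ k"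
      using K by (intro mult_right_mono) auto
    also have "\<dots> = L * K ^ j * (1 / 2) ^ k"
      using K(1) by (simp add: power_add power_divide power_mult_distrib)
    finally show "norm (c (k + j) * (1 / (2 * K)) ^ k) \<le> L * K ^ j * (1 / 2) ^ k"
      using K(1) by (simp add: abs_mult)
  qed
  define f where "f = (\<lambda>w. \<Sum>k. c (k + n) * w ^ k)"
  have "isCont f 0"
    unfolding f_def using isCont_powser[OF sm[of n], of 0] K(1) by simp
  then have "(f \<longlongrightarrow> f 0) (at_right 0)" unfolding isCont_def by (rule tendsto_mono[OF at_le, rotated]) simp
  moreover have "eventually (\<lambda>w. f w = 0) (at_right 0)"
  proof (rule eventually_at_right_real[THEN eventually_mono])
    show "0 < min \<delta> (1 / (2 * K))" using \<delta> K by simp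
    fix w assume w: "w \<in> {0<..<min \<delta> (1 / (2 * K))}"
    have "summable (\<lambda>k. c k * w ^ k)"
      using powser_inside[of c "1 / (2 * K)" w] sm[of 0] w K(1) by simp
    from suminf_split_initial_segment[OF this, of n]
    have "0 = (\<Sum>k. c (k + n) * w ^ (k + n))" using zero[of w] w less by simp
    also have "\<dots> = (\<Sum>k. w ^ n * (c (k + n) * w ^ k))" by (simp add: power_add mult_ac)
    also have "\<dots> = w ^ n * f w"
      unfolding f_def using powser_inside[of "\<lambda>k. c (k + n)" "1 / (2 * K)" w] sm[of n] w K(1)
      by (intro suminf_mult) simp
    finally show "f w = 0" using w by simp
  qed
  ultimately have "f 0 = 0"
    using tendsto_unique[of "at_right (0::real)" f "f 0" 0] tendsto_eventually[of f 0] by simp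
  moreover have "f 0 = c n" unfolding f_def using powser_zero[of "\<lambda>k. c (k + n)"] by simp
  ultimately show ?case by simp
qed

lemma prob_space_moments:
  fixes r :: real
  assumes \<nu>: "prob_space \<nu>" "sets \<nu> = sets borel" and r: "AE x in \<nu>. \<bar>x\<bar> \<le> r" "r > 0"
  shows "\<bar>\<integral>x. x ^ n \<partial>\<nu>\<bar> \<le> r ^ n"
    and "0 < w \<Longrightarrow> w * r < 1 \<Longrightarrow> (\<lambda>n. (\<integral>x. x ^ n \<partial>\<nu>) * w ^ n) sums (\<integral>x. 1 / (1 - w * x) \<partial>\<nu>)"
proof -
  interpret prob_space \<nu> by fact
  have meas: "f \<in> borel_measurable \<nu>" if "f \<in> borel_measurable borel" for f :: "real \<Rightarrow> real"
    using that by (simp add: measurable_cong_sets[OF \<nu>(2) refl])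
  have bound: "AE x in \<nu>. norm (x ^ n) \<le> r ^ n" for n
    using r(1) by eventually_elim (simp add: power_abs power_mono)
  have int: "integrable \<nu> (\<lambda>x. x ^ n)" for n
    by (rule integrable_const_bound[OF bound]) (simp add: meas)
  have nb: "(\<integral>x. norm (x ^ n) \<partial>\<nu>) \<le> r ^ n" for n
  proof -
    have "(\<integral>x. norm (x ^ n) \<partial>\<nu>) \<le> (\<integral>x. r ^ n \<partial>\<nu>)"
      using int[of n] bound[of n] by (intro integral_mono_AE) auto
    then show ?thesis by (simp add: prob_space)
  qed
  show "\<bar>\<integral>x. x ^ n \<partial>\<nu>\<bar> \<le> r ^ n"
    using order_trans[OF integral_norm_bound nb[of n]] by simp
  assume w: "0 < w" "w * r < 1"
  have "(\<lambda>n. \<integral>x. x ^ n * w ^ n \<partial>\<nu>) sums (\<integral>x. (\<Sum>n. x ^ n * w ^ n) \<partial>\<nu>)"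
  proof (rule sums_integral)
    show "integrable \<nu> (\<lambda>x. x ^ n * w ^ n)" for n using int by simp
    show "AE x in \<nu>. summable (\<lambda>n. norm (x ^ n * w ^ n))"
      using r(1)
    proof eventually_elim
      case (elim x)
      have "\<bar>x * w\<bar> = w * \<bar>x\<bar>" using w by (simp add: abs_mult)
      also have "\<dots> \<le> w * r" using elim w by (intro mult_left_mono) auto
      finally have "\<bar>x * w\<bar> < 1" using w by linarith
      then have "summable (\<lambda>n. \<bar>x * w\<bar> ^ n)" by (intro summable_geometric) simp
      then show ?case by (simp add: power_abs flip: power_mult_distrib)
    qed
    have "summable (\<lambda>n. (r * w) ^ n)" using w r(2) by (intro summable_geometric) (simp add: mult.commute)
    then show "summable (\<lambda>n. \<integral>x. norm (x ^ n * w ^ n) \<partial>\<nu>)"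
    proof (rule summable_comparison_test')
      fix n
      have "(\<integral>x. norm (x ^ n * w ^ n) \<partial>\<nu>) = (\<integral>x. norm (x ^ n) \<partial>\<nu>) * w ^ n"
        using w by (simp add: abs_mult)
      also have "\<dots> \<le> r ^ n * w ^ n" using nb[of n] w by (intro mult_right_mono) auto
      finally show "norm (\<integral>x. norm (x ^ n * w ^ n) \<partial>\<nu>) \<le> (r * w) ^ n"
        by (simp add: power_mult_distrib)
    qed
  qed
  moreover have "(\<integral>x. (\<Sum>n. x ^ n * w ^ n) \<partial>\<nu>) = (\<integral>x. 1 / (1 - w * x) \<partial>\<nu>)"
  proof (rule integral_cong_AE)
    show "AE x in \<nu>. (\<Sum>n. x ^ n * w ^ n) = 1 / (1 - w * x)"
      using r(1)
    proof eventually_elim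
      case (elim x)
      have "\<bar>w * x\<bar> = w * \<bar>x\<bar>" using w by (simp add: abs_mult)
      also have "\<dots> \<le> w * r" using elim w by (intro mult_left_mono) auto
      finally have "\<bar>w * x\<bar> < 1" using w by linarith
      then show ?case using suminf_geometric[of "w * x"] by (simp add: power_mult_distrib mult.commute)
    qed
  qed (rule meas, measurable)+
  ultimately show "(\<lambda>n. (\<integral>x. x ^ n \<partial>\<nu>) * w ^ n) sums (\<integral>x. 1 / (1 - w * x) \<partial>\<nu>)"
    by simp
qed

lemma geometric_bound_summable:
  fixes f :: "nat \<Rightarrow> real"
  assumes "\<And>n. \<bar>f n\<bar> \<le> K ^ n" "\<bar>w\<bar> * K < 1" "K > 0"
  shows "summable (\<lambda>n. f n * w ^ n)"
proof (rule summable_comparison_test')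
  show "summable (\<lambda>n. (\<bar>w\<bar> * K) ^ n)" using assms by (intro summable_geometric) (simp add: abs_mult)
  show "norm (f n * w ^ n) \<le> (\<bar>w\<bar> * K) ^ n" for n
    using mult_left_mono[OF assms(1)[of n], of "\<bar>w\<bar> ^ n"]
    by (simp add: abs_mult power_abs power_mult_distrib mult.commute)
qed

lemma geometric_bound_isCont:
  fixes f :: "nat \<Rightarrow> real"
  assumes "\<And>n. \<bar>f n\<bar> \<le> K ^ n" "\<bar>w\<bar> * K < 1" "K > 0"
  shows "isCont (\<lambda>w. \<Sum>n. f n * w ^ n) w"
proof -
  have "\<bar>w\<bar> < 1 / K" using assms by (simp add: pos_less_divide_eq)
  then obtain v where "\<bar>w\<bar> < v" "v < 1 / K" using dense by blast
  then have "\<bar>v\<bar> * K < 1" "\<bar>w\<bar> < \<bar>v\<bar>" using assms(3) by (auto simp: pos_less_divide_eq)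
  then show ?thesis
    using isCont_powser[OF geometric_bound_summable[OF assms(1) _ assms(3), of v]] by simp
qed

text \<open>Both generating functions minus 1 are the root of the quadratic equation that tends to 0 with \<open>w\<close>.\<close>

lemma moments_eqI:
  fixes f A B C :: "_ \<Rightarrow> real"
  assumes \<nu>: "prob_space \<nu>" "sets \<nu> = sets borel" and r: "AE x in \<nu>. \<bar>x\<bar> \<le> r" "r > 0"
    and f: "f 0 = 1" "\<And>n. \<bar>f n\<bar> \<le> K ^ n" "K > 0"
    and lim: "(A \<longlongrightarrow> A0) (at_right 0)" "(B \<longlongrightarrow> B0) (at_right 0)" "B0 \<noteq> 0"
    and eq_f: "eventually (\<lambda>w. \<forall>m. m = (\<Sum>n. f n * w ^ n) - 1 \<longrightarrow> A w * m\<^sup>2 + B w * m + C w = 0) (at_right 0)"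
    and eq_\<nu>: "eventually (\<lambda>w. \<forall>m. m = (\<integral>x. 1 / (1 - w * x) \<partial>\<nu>) - 1 \<longrightarrow> A w * m\<^sup>2 + B w * m + C w = 0) (at_right 0)"
  shows "f n = (\<integral>x. x ^ n \<partial>\<nu>)"
proof -
  define g where "g = (\<lambda>n. \<integral>x. x ^ n \<partial>\<nu>)"
  have g: "g 0 = 1" "\<And>n. \<bar>g n\<bar> \<le> r ^ n"
    using prob_space_moments(1)[OF \<nu> r] \<nu>(1) by (auto simp: g_def prob_space.prob_space)
  define F G where "F = (\<lambda>w. \<Sum>n. f n * w ^ n)" and "G = (\<lambda>w. \<Sum>n. g n * w ^ n)"
  have limit: "((\<lambda>w. (\<Sum>n. h n * w ^ n) - 1) \<longlongrightarrow> 0) (at_right 0)"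
    if h: "h 0 = 1" "\<And>n. \<bar>h n\<bar> \<le> k ^ n" "k > 0" for h :: "nat \<Rightarrow> real" and k
  proof -
    have "isCont (\<lambda>w. \<Sum>n. h n * w ^ n) 0" using geometric_bound_isCont[OF h(2), of 0] h(3) by simp
    then have "((\<lambda>w. \<Sum>n. h n * w ^ n) \<longlongrightarrow> h 0) (at 0)" unfolding isCont_def powser_zero .
    then have "((\<lambda>w. \<Sum>n. h n * w ^ n) \<longlongrightarrow> h 0) (at_right 0)" by (rule tendsto_mono[OF at_le, rotated]) simp
    from tendsto_diff[OF this tendsto_const[of 1]] show ?thesis using h(1) by simp
  qed
  \<comment> \<open>In the difference of the two quadratic equations \<open>F w - G w\<close>
    factors out. The other factor is this expression; its limit \<open>B0\<close> is nonzero, so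
    \<open>F\<close> and \<open>G\<close> agree near 0.\<close>
  have "((\<lambda>w. A w * ((F w - 1) + (G w - 1)) + B w) \<longlongrightarrow> A0 * (0 + 0) + B0) (at_right 0)"
    unfolding F_def G_def by (intro tendsto_add tendsto_mult lim limit[OF f] limit[OF g r(2)])
  then have "eventually (\<lambda>w. A w * ((F w - 1) + (G w - 1)) + B w \<noteq> 0) (at_right 0)"
    using lim(3) by (intro tendsto_imp_eventually_ne[where c = B0]) simp_all
  moreover have "eventually (\<lambda>w. w \<in> {0<..<min (1 / r) (1 / K)}) (at_right 0)"
    using r(2) f(3) by (intro eventually_at_right_real) simp
  ultimately have "eventually (\<lambda>w. (\<Sum>n. (f n - g n) * w ^ n) = 0) (at_right 0)"
    using eq_f eq_\<nu>
  proof eventually_elim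
    case (elim w)
    have w: "0 < w" "w * r < 1" "\<bar>w\<bar> * K < 1" "\<bar>w\<bar> * r < 1" using elim r(2) f(3) by (auto simp: pos_less_divide_eq)
    have "G w = (\<integral>x. 1 / (1 - w * x) \<partial>\<nu>)"
      using prob_space_moments(2)[OF \<nu> r w(1,2)] by (simp add: G_def g_def sums_iff)
    then have "A w * (G w - 1)\<^sup>2 + B w * (G w - 1) + C w = 0" "A w * (F w - 1)\<^sup>2 + B w * (F w - 1) + C w = 0"
      using elim by (auto simp: F_def)
    then have "(F w - G w) * (A w * ((F w - 1) + (G w - 1)) + B w) = 0" by algebra
    then have "F w = G w" using elim by simp
    moreover have "(\<Sum>n. (f n - g n) * w ^ n) = F w - G w"
      unfolding F_def G_def
      using suminf_diff[OF geometric_bound_summable[OF f(2) w(3) f(3)] geometric_bound_summable[OF g(2) w(4) r(2)]]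
      by (simp add: left_diff_distrib)
    ultimately show ?case by simp
  qed
  then obtain \<delta> where \<delta>: "\<delta> > 0" "\<And>w. 0 < w \<Longrightarrow> w < \<delta> \<Longrightarrow> (\<Sum>n. (f n - g n) * w ^ n) = 0"
    by (auto simp: eventually_at_right_field)
  have "f n - g n = 0"
  proof (rule power_series_zero_coeffs[OF _ _ \<delta>])
    show "0 < max K r" using r by simp
    show "\<bar>f n - g n\<bar> \<le> 2 * max K r ^ n" for n
      using f(2)[of n] g(2)[of n] power_mono[of K "max K r" n] power_mono[of r "max K r" n] f(3) r(2) by simp
  qed
  then show ?thesis by (simp add: g_def)
qed

text \<open>Intermediate value theorem between 0, where the series is 1, and \<open>d\<close>, where
  the term of order \<open>N\<close> lifts it above 1. It supplies the \<open>x\<close> whose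
  resolvent has the same trace as that of a given \<open>w\<close>, and conversely.\<close>

lemma positive_series_small_values:
  fixes f :: "nat \<Rightarrow> real"
  assumes f: "f 0 = 1" "\<And>n. \<bar>f n\<bar> \<le> K ^ n" "K > 0" "\<And>n. 0 \<le> f n" and N: "N > 0" "f N > 0" and \<delta>: "\<delta> > 0"
  shows "\<exists>\<epsilon>>0. \<forall>y. 1 < y \<and> y < 1 + \<epsilon> \<longrightarrow> (\<exists>x. 0 < x \<and> x < \<delta> \<and> (\<Sum>n. f n * x ^ n) = y)"
proof -
  define G where "G = (\<lambda>x. \<Sum>n. f n * x ^ n)"
  define d where "d = min \<delta> (1 / K) / 2"
  have d: "0 < d" "d < \<delta>" "d * K < 1" using \<delta> f(3) by (auto simp: d_def min_def field_simps)
  have G0: "G 0 = 1" unfolding G_def powser_zero using f(1) .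
  have Gd: "G d > 1"
  proof -
    have "(\<Sum>n\<in>{0, N}. f n * d ^ n) \<le> G d"
      unfolding G_def using d f by (intro sum_le_suminf geometric_bound_summable[OF f(2)]) auto
    moreover have "0 < f N * d ^ N" using N d by simp
    ultimately show ?thesis using N f(1) by simp
  qed
  have cont: "\<forall>x. 0 \<le> x \<and> x \<le> d \<longrightarrow> isCont G x"
  proof (intro allI impI)
    fix x assume x: "0 \<le> x \<and> x \<le> d"
    then have "x * K \<le> d * K" using f(3) by (intro mult_right_mono) auto
    then have "\<bar>x\<bar> * K < 1" using d x by simp
    then show "isCont G x" unfolding G_def using f by (intro geometric_bound_isCont) auto
  qed
  show ?thesis
  proof (rule exI[of _ "G d - 1"], intro conjI allI impI)
    fix y assume y: "1 < y \<and> y < 1 + (G d - 1)"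
    then obtain x where x: "0 \<le> x" "x \<le> d" "G x = y" using IVT[of G 0 y d] G0 cont d by auto
    then have "x \<noteq> 0" using G0 y by auto
    then show "\<exists>x. 0 < x \<and> x < \<delta> \<and> (\<Sum>n. f n * x ^ n) = y"
      using x d unfolding G_def by (intro exI[of _ x]) auto
  qed (use Gd in simp)
qed

section \<open>The moment equations\<close>

text \<open>With \<open>Z\<close> the sum, \<open>Z - 1 = Y * Z\<close>; the bound 1/2 on
  \<open>norm Y\<close> absorbs half of \<open>norm Z\<close> and gives
  \<open>norm Z \<le> 2\<close>.\<close>

lemma geometric_series_estimates:
  fixes Y :: "'a::{real_normed_algebra_1, banach}"
  assumes "norm Y \<le> 1 / 2"
  shows "norm ((\<Sum>n. Y ^ n) - 1) \<le> 2 * norm Y"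
proof -
  define Z where "Z = (\<Sum>n. Y ^ n)"
  have "Y * Z = Z - 1" using neumann_series(2)[of Y] assms by (simp add: Z_def left_diff_distrib algebra_simps)
  then have Z: "Z - 1 = Y * Z" and Z': "1 + Y * Z = Z" by simp_all
  have "norm Z \<le> norm (1::'a) + norm (Y * Z)" using norm_triangle_ineq[of 1 "Y * Z"] unfolding Z' .
  also have "norm (Y * Z) \<le> 1 / 2 * norm Z"
    using norm_mult_ineq[of Y Z] mult_right_mono[OF assms, of "norm Z"] by simp
  finally have "norm Z \<le> 2" by simp
  then have "norm Y * norm Z \<le> norm Y * 2" by (intro mult_left_mono) auto
  then show ?thesis using norm_mult_ineq[of Y Z] unfolding Z_def[symmetric] Z by simp
qed

text \<open>Closure under Neumann series is the form of completeness that suits adjointable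
  operators: the adjoint of such a sum is the sum of the adjoint series, whereas a general norm
  limit comes without an adjoint at hand.\<close>

locale complete_free_pair = free_pair C \<tau> F
  for C :: "'a::{real_normed_algebra_1, banach} set" and \<tau> and F +
  assumes F_series: "Y \<in> F i \<Longrightarrow> norm Y < 1 \<Longrightarrow> (\<Sum>n. Y ^ n) \<in> F i"
    and C_series: "u \<in> F True \<Longrightarrow> v \<in> F False \<Longrightarrow> norm u * norm v < 1 \<Longrightarrow> (\<Sum>n. (u * v) ^ n) \<in> C"
begin

lemma \<tau>_power_bound: "X \<in> C \<Longrightarrow> \<bar>\<tau> (X ^ n)\<bar> \<le> (norm X + 1) ^ n"
  using \<tau>_bound[of "X ^ n"] norm_power_ineq[of X n] power_mono[of "norm X" "norm X + 1" n] by simp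

lemma \<tau>_series:
  assumes X: "X \<in> F i" and w: "norm (w *\<^sub>R X) < 1"
  shows "(\<lambda>n. \<tau> (X ^ n) * w ^ n) sums \<tau> (\<Sum>n. (w *\<^sub>R X) ^ n)"
  unfolding sums_def
proof -
  have part: "(\<Sum>k<n. (w *\<^sub>R X) ^ k) \<in> C \<and> \<tau> (\<Sum>k<n. (w *\<^sub>R X) ^ k) = (\<Sum>k<n. \<tau> (X ^ k) * w ^ k)" for n
    using X by (induction n) (auto simp: \<tau>_simps scaleR_power mult.commute)
  have "(\<lambda>n. \<tau> (\<Sum>k<n. (w *\<^sub>R X) ^ k)) \<longlonglongrightarrow> \<tau> (\<Sum>n. (w *\<^sub>R X) ^ n)"
    using part F_series[of "w *\<^sub>R X" i] X w neumann_series(1)[OF w]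
    by (intro \<tau>_tendsto summable_LIMSEQ) auto
  then show "(\<lambda>n. \<Sum>k<n. \<tau> (X ^ k) * w ^ k) \<longlonglongrightarrow> \<tau> (\<Sum>n. (w *\<^sub>R X) ^ n)" using part by simp
qed

text \<open>The resolvent differs from 1 by at most \<open>2 * w * norm X\<close>, and its trace
  obeys the same bound; the two errors add up to the constant 4. Thus \<open>u\<close> and
  \<open>v\<close> are of first order in \<open>w\<close> and \<open>x\<close>.\<close>

lemma centered_resolvent_norm:
  assumes X: "X \<in> F i" and w: "w > 0" "w * norm X \<le> 1 / 2"
    and m: "\<tau> (\<Sum>n. (w *\<^sub>R X) ^ n) = 1 + m" "m > 0"
  shows "norm ((1 / (1 + m)) *\<^sub>R (\<Sum>n. (w *\<^sub>R X) ^ n) - 1) \<le> 4 * w * norm X"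
proof -
  define a where "a = (\<Sum>n. (w *\<^sub>R X) ^ n)"
  have Y: "norm (w *\<^sub>R X) = w * norm X" using w by simp
  have a: "a \<in> C" unfolding a_def by (rule F_C, rule F_series[of _ i]) (use X w in simp_all)
  have est: "norm (a - 1) \<le> 2 * (w * norm X)"
    unfolding a_def Y[symmetric] by (rule geometric_series_estimates) (use w Y in simp)
  have "m = \<tau> (a - 1)" using a m by (simp add: \<tau>_simps a_def)
  then have "\<bar>m\<bar> \<le> norm (a - 1)" using \<tau>_bound[of "a - 1"] a by simp
  then have "norm ((a - 1) - m *\<^sub>R 1) \<le> 4 * w * norm X"
    using norm_triangle_ineq4[of "a - 1" "m *\<^sub>R 1"] est by simp
  moreover have "(1 / (1 + m)) *\<^sub>R a - 1 = (1 / (1 + m)) *\<^sub>R ((a - 1) - m *\<^sub>R 1)"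
  proof -
    have "(1 / (1 + m)) *\<^sub>R ((1 + m) *\<^sub>R (1::'a)) = 1" using m by simp
    then show ?thesis by (simp add: scaleR_diff_right scaleR_add_right scaleR_add_left algebra_simps)
  qed
  moreover have "norm ((1 / (1 + m)) *\<^sub>R ((a - 1) - m *\<^sub>R 1)) \<le> norm ((a - 1) - m *\<^sub>R 1)"
    using m mult_right_mono[of "1 / (1 + m)" 1 "norm ((a - 1) - m *\<^sub>R 1)"] by simp
  ultimately have "norm ((1 / (1 + m)) *\<^sub>R a - 1) \<le> 4 * w * norm X" by (metis order_trans)
  then show ?thesis unfolding a_def .
qed

text \<open>\<open>\<kappa>\<close> is at most \<open>2 / m\<close>, and
  \<open>norm u * norm v\<close> at most \<open>16 * w * x * norm U * norm V\<close>: this is the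
  origin of the 32 in the last hypothesis, which makes the series in \<open>\<kappa> u v\<close>
  converge although \<open>\<kappa>\<close> blows up for small \<open>m\<close>.\<close>

lemma moment_equations_pair:
  fixes U V p q :: 'a and c d m w x \<alpha> :: real
  assumes U: "U \<in> F True" and p: "p \<in> F True" "p * (1 - U) = 1" "(1 - U) * p = 1"
    and V: "V \<in> F False" and q: "q \<in> F False" "q * V = 1" "V * q = 1"
    and c: "c \<noteq> 0" "\<tau> (q * p) = c" "\<tau> (q * p * (U * V)) = c * \<tau> (U * V)"
    and d: "\<tau> (q * p * (q * p)) = d" "\<tau> (q * p * (q * p) * (U * V)) = d * \<tau> (U * V)"
    and R: "\<And>z R. R \<in> C \<Longrightarrow> R * (1 - z *\<^sub>R (U * V)) = 1 \<Longrightarrow> (1 - z *\<^sub>R (U * V)) * R = 1 \<Longrightarrow>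
        \<tau> (q * p * R) = c * \<tau> R \<and> \<tau> (q * p * (q * p) * R) = d * \<tau> R"
    and \<alpha>: "\<alpha> = \<tau> p - 1"
    and w: "0 < w" "w < 1" "w * norm U \<le> 1 / 2" and x: "0 < x" "x * norm V \<le> 1 / 2"
    and m: "0 < m" "m \<le> 1" "(\<Sum>n. \<tau> (U ^ n) * w ^ n) = 1 + m" "(\<Sum>n. \<tau> (V ^ n) * x ^ n) = 1 + m"
    and k: "32 * w * norm U * norm V * x < m"
  shows "w * (1 + m) * (c\<^sup>2 * \<alpha> + (d - c\<^sup>2) * m) = m * (c\<^sup>2 * \<alpha> + d + (d - c\<^sup>2) * m)"
    and "x * (1 + m) * (c\<^sup>2 * \<alpha> + d + (d - c\<^sup>2) * m) = c ^ 3 * m"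
proof -
  define a b where "a = (\<Sum>n. (w *\<^sub>R U) ^ n)" and "b = (\<Sum>n. (x *\<^sub>R V) ^ n)"
  have nU: "norm (w *\<^sub>R U) < 1" and nV: "norm (x *\<^sub>R V) < 1" using w x by simp_all
  have a: "a \<in> F True" "a * (1 - w *\<^sub>R U) = 1" "(1 - w *\<^sub>R U) * a = 1"
    using F_series[of "w *\<^sub>R U" True] U nU neumann_series[OF nU] by (auto simp: a_def)
  have b: "b \<in> F False" "b * (1 - x *\<^sub>R V) = 1" "(1 - x *\<^sub>R V) * b = 1"
    using F_series[of "x *\<^sub>R V" False] V nV neumann_series[OF nV] by (auto simp: b_def)
  have \<tau>a: "\<tau> a = 1 + m" and \<tau>b: "\<tau> b = 1 + m"
    using \<tau>_series[OF U nU] \<tau>_series[OF V nV] m by (auto simp: a_def b_def sums_iff)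
  define u v where "u = (1 / (1 + m)) *\<^sub>R a - 1" and "v = (1 / (1 + m)) *\<^sub>R b - 1"
  have nu: "norm u \<le> 4 * w * norm U" and nv: "norm v \<le> 4 * x * norm V"
    unfolding u_def v_def a_def b_def
    by (rule centered_resolvent_norm[OF U w(1,3) \<tau>a[unfolded a_def] m(1)]
        centered_resolvent_norm[OF V x \<tau>b[unfolded b_def] m(1)])+
  have uv: "u \<in> F True" "v \<in> F False" using a b by (auto simp: u_def v_def)
  define \<kappa> where \<kappa>_def: "\<kappa> = (1 + m) / m"
  have \<kappa>: "0 < \<kappa>" "\<kappa> \<le> 2 / m" using m by (auto simp: \<kappa>_def divide_right_mono)
  have small: "norm (\<kappa> *\<^sub>R u) * norm v < 1"
  proof -
    have "norm (\<kappa> *\<^sub>R u) * norm v = \<kappa> * (norm u * norm v)" using \<kappa> by simp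
    also have "\<dots> \<le> 2 / m * ((4 * w * norm U) * (4 * x * norm V))"
      using \<kappa> w x m nu nv by (intro mult_mono) auto
    also have "\<dots> = 32 * w * norm U * norm V * x / m" by simp
    also have "\<dots> < 1" using k m by simp
    finally show ?thesis .
  qed
  define S where "S = (\<Sum>n. (\<kappa> *\<^sub>R u * v) ^ n)"
  have n1: "norm (\<kappa> *\<^sub>R (u * v)) < 1" using norm_mult_ineq[of "\<kappa> *\<^sub>R u" v] small by simp
  have S: "S \<in> C" "S * (1 - \<kappa> *\<^sub>R (u * v)) = 1" "(1 - \<kappa> *\<^sub>R (u * v)) * S = 1"
    using C_series[of "\<kappa> *\<^sub>R u" v] uv small neumann_series[OF n1] by (auto simp: S_def)
  have m0: "m \<noteq> 0" and m1: "1 + m \<noteq> 0" and w0: "w \<noteq> 0" and w1: "w \<noteq> 1" and x0: "x \<noteq> 0"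
    using m w x by auto
  show "w * (1 + m) * (c\<^sup>2 * \<alpha> + (d - c\<^sup>2) * m) = m * (c\<^sup>2 * \<alpha> + d + (d - c\<^sup>2) * m)"
    "x * (1 + m) * (c\<^sup>2 * \<alpha> + d + (d - c\<^sup>2) * m) = c ^ 3 * m"
    by (rule constant_regression_moments[OF \<kappa>_def refl U p V q a b \<tau>a \<tau>b m0 m1 w0 w1 x0 u_def v_def
          S n1 c d _ \<alpha>], rule R; assumption)+
qed

text \<open>Either parameter may be prescribed; a partner with the same value of the generating
  function comes from \<open>positive_series_small_values\<close>, and the equations for that pair
  involve just one of the two.\<close>

lemma moment_equations_eventually:
  fixes U V p q :: 'a and c d \<alpha> :: real
  assumes U: "U \<in> F True" and p: "p \<in> F True" "p * (1 - U) = 1" "(1 - U) * p = 1"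
    and V: "V \<in> F False" and q: "q \<in> F False" "q * V = 1" "V * q = 1"
    and c: "c \<noteq> 0" "\<tau> (q * p) = c" "\<tau> (q * p * (U * V)) = c * \<tau> (U * V)"
    and d: "\<tau> (q * p * (q * p)) = d" "\<tau> (q * p * (q * p) * (U * V)) = d * \<tau> (U * V)"
    and R: "\<And>z R. R \<in> C \<Longrightarrow> R * (1 - z *\<^sub>R (U * V)) = 1 \<Longrightarrow> (1 - z *\<^sub>R (U * V)) * R = 1 \<Longrightarrow>
        \<tau> (q * p * R) = c * \<tau> R \<and> \<tau> (q * p * (q * p) * R) = d * \<tau> R"
    and \<alpha>: "\<alpha> = \<tau> p - 1"
    and pos: "\<And>n. 0 \<le> \<tau> (U ^ n)" "0 < \<tau> (U ^ 2)" "\<And>n. 0 \<le> \<tau> (V ^ n)" "0 < \<tau> V"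
  shows "eventually (\<lambda>w. \<forall>m. m = (\<Sum>n. \<tau> (U ^ n) * w ^ n) - 1 \<longrightarrow>
      w * (1 + m) * (c\<^sup>2 * \<alpha> + (d - c\<^sup>2) * m) = m * (c\<^sup>2 * \<alpha> + d + (d - c\<^sup>2) * m)) (at_right 0)"
    and "eventually (\<lambda>x. \<forall>m. m = (\<Sum>n. \<tau> (V ^ n) * x ^ n) - 1 \<longrightarrow>
      x * (1 + m) * (c\<^sup>2 * \<alpha> + d + (d - c\<^sup>2) * m) = c ^ 3 * m) (at_right 0)"
proof -
  define G where "G = (\<lambda>X w. \<Sum>n. \<tau> (X ^ n) * w ^ n)"
  have UV: "U \<in> C" "V \<in> C" using U V by auto
  have smb: "summable (\<lambda>n. \<tau> (X ^ n) * w ^ n)" if "X \<in> C" "0 < w" "w < 1 / (norm X + 1)" for X w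
    using that by (intro geometric_bound_summable[OF \<tau>_power_bound])
      (auto simp: pos_less_divide_eq add_nonneg_pos)
  have lower: "1 + \<tau> (X ^ N) * w ^ N \<le> G X w"
    if "X \<in> C" "0 < w" "w < 1 / (norm X + 1)" "N > 0" "\<And>n. 0 \<le> \<tau> (X ^ n)" for X w and N :: nat
  proof -
    have "(\<Sum>n\<in>{0, N}. \<tau> (X ^ n) * w ^ n) \<le> G X w"
      unfolding G_def using that by (intro sum_le_suminf smb) auto
    then show ?thesis using that by (simp add: \<tau>_one)
  qed
  have limG: "(G X \<longlongrightarrow> 1) (at_right 0)" if "X \<in> C" for X
  proof -
    have "isCont (G X) 0"
      unfolding G_def using geometric_bound_isCont[OF \<tau>_power_bound[OF that], of 0] by (simp add: add_nonneg_pos)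
    moreover have "G X 0 = 1" unfolding G_def powser_zero by (simp add: \<tau>_one)
    ultimately have "(G X \<longlongrightarrow> 1) (at 0)" by (simp add: isCont_def)
    then show ?thesis by (rule tendsto_mono[OF at_le, rotated]) simp
  qed
  \<comment> \<open>Besides \<open>w < 1\<close> and \<open>w * norm U \<le> 1 / 2\<close>, this
    secures \<open>32 * w * norm U * norm V < \<tau> V\<close>. As
    \<open>m \<ge> \<tau> V * x\<close>, the smallness condition then holds for every admissible
    \<open>x\<close>, however small.\<close>
  define \<delta>w where "\<delta>w = min (min 1 (1 / (2 * (norm U + 1)))) (\<tau> V / (32 * (norm U + 1) * (norm V + 1)))"
  define \<delta>x where "\<delta>x = 1 / (2 * (norm V + 1))"
  have \<delta>: "0 < \<delta>w" "0 < \<delta>x" using pos(4) by (auto simp: \<delta>w_def \<delta>x_def add_nonneg_pos intro!: divide_pos_pos mult_pos_pos)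
  have main: "w * (1 + m) * (c\<^sup>2 * \<alpha> + (d - c\<^sup>2) * m) = m * (c\<^sup>2 * \<alpha> + d + (d - c\<^sup>2) * m) \<and>
      x * (1 + m) * (c\<^sup>2 * \<alpha> + d + (d - c\<^sup>2) * m) = c ^ 3 * m"
    if w: "0 < w" "w < \<delta>w" and x: "0 < x" "x < \<delta>x" and m: "G U w = 1 + m" "G V x = 1 + m" "m \<le> 1" for w x m
  proof -
    have w': "w < 1" "w * (norm U + 1) < 1 / 2" "w * (32 * (norm U + 1) * (norm V + 1)) < \<tau> V"
      using w(2) unfolding \<delta>w_def min_less_iff_conj
      by (auto simp: pos_less_divide_eq add_nonneg_pos mult_ac)
    have wU: "w * norm U \<le> 1 / 2" using w'(2) w(1) by (simp add: distrib_left)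
    have "x * (norm V + 1) < 1 / 2" using x(2) unfolding \<delta>x_def by (simp add: pos_less_divide_eq add_nonneg_pos mult_ac)
    then have xV: "x * norm V \<le> 1 / 2" "x < 1 / (norm V + 1)" using x(1)
      by (simp_all add: distrib_left pos_less_divide_eq add_nonneg_pos)
    have mx: "\<tau> V * x \<le> m" using lower[OF UV(2) x(1) xV(2), of 1] pos(3) m(2) by simp
    then have m0: "0 < m" using pos(4) x(1) mult_pos_pos[of "\<tau> V" x] by linarith
    have "w * (32 * norm U * norm V) \<le> w * (32 * (norm U + 1) * (norm V + 1))"
      using w(1) by (intro mult_left_mono mult_mono) auto
    then have "w * (32 * norm U * norm V) < \<tau> V" using w'(3) by linarith
    then have "w * (32 * norm U * norm V) * x < \<tau> V * x" using x(1) by (intro mult_strict_right_mono)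
    then have k: "32 * w * norm U * norm V * x < m" using mx by (simp add: mult_ac)
    show ?thesis
      by (intro conjI; rule moment_equations_pair[OF U p V q c d _ \<alpha> w(1) w'(1) wU x(1) xV(1) m0 m(3)
            m(1,2)[unfolded G_def] k]; rule R; assumption)
  qed
  obtain \<epsilon>U where \<epsilon>U: "\<epsilon>U > 0" "\<And>y. 1 < y \<Longrightarrow> y < 1 + \<epsilon>U \<Longrightarrow> \<exists>w. 0 < w \<and> w < \<delta>w \<and> G U w = y"
    using positive_series_small_values[of "\<lambda>n. \<tau> (U ^ n)", OF _ \<tau>_power_bound[OF UV(1)] _ pos(1) _ pos(2) \<delta>(1)]
    by (auto simp: \<tau>_one add_nonneg_pos G_def)
  obtain \<epsilon>V where \<epsilon>V: "\<epsilon>V > 0" "\<And>y. 1 < y \<Longrightarrow> y < 1 + \<epsilon>V \<Longrightarrow> \<exists>x. 0 < x \<and> x < \<delta>x \<and> G V x = y"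
    using positive_series_small_values[of "\<lambda>n. \<tau> (V ^ n)", OF _ \<tau>_power_bound[OF UV(2)] _ pos(3), of 1 \<delta>x] pos(4) \<delta>(2)
    by (auto simp: \<tau>_one add_nonneg_pos G_def)
  have ev: "eventually (\<lambda>w. w \<in> {0<..<min e (1 / (norm X + 1))} \<and> G X w < 1 + e') (at_right 0)"
    if "X \<in> C" "0 < e" "0 < e'" for X and e e' :: real
    using that limG[OF that(1)]
    by (intro eventually_conj eventually_at_right_real order_tendstoD(2)) (auto simp: add_nonneg_pos)
  show "eventually (\<lambda>w. \<forall>m. m = (\<Sum>n. \<tau> (U ^ n) * w ^ n) - 1 \<longrightarrow>
      w * (1 + m) * (c\<^sup>2 * \<alpha> + (d - c\<^sup>2) * m) = m * (c\<^sup>2 * \<alpha> + d + (d - c\<^sup>2) * m)) (at_right 0)"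
    using ev[OF UV(1) \<delta>(1), of "min 1 \<epsilon>V", simplified, OF \<epsilon>V(1)]
  proof eventually_elim
    case (elim w)
    have "1 < G U w" using lower[OF UV(1), of w 2] pos(1,2) elim by (smt (verit) mult_pos_pos zero_less_power zero_less_numeral)
    moreover have g: "G U w < 1 + \<epsilon>V" "G U w - 1 \<le> 1" using elim by (auto simp: min_def split: if_splits)
    ultimately obtain x where "0 < x" "x < \<delta>x" "G V x = G U w" using \<epsilon>V(2)[of "G U w"] by auto
    then show ?case using main[of w x "G U w - 1"] elim g by (simp add: G_def)
  qed
  show "eventually (\<lambda>x. \<forall>m. m = (\<Sum>n. \<tau> (V ^ n) * x ^ n) - 1 \<longrightarrow>
      x * (1 + m) * (c\<^sup>2 * \<alpha> + d + (d - c\<^sup>2) * m) = c ^ 3 * m) (at_right 0)"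
    using ev[OF UV(2) \<delta>(2), of "min 1 \<epsilon>U", simplified, OF \<epsilon>U(1)]
  proof eventually_elim
    case (elim x)
    have "1 < G V x" using lower[OF UV(2), of x 1] pos(3,4) elim by (smt (verit) mult_pos_pos power_one_right zero_less_one)
    moreover have g: "G V x < 1 + \<epsilon>U" "G V x - 1 \<le> 1" using elim by (auto simp: min_def split: if_splits)
    ultimately obtain w where "0 < w" "w < \<delta>w" "G U w = G V x" using \<epsilon>U(2)[of "G V x"] by auto
    then show ?case using main[of w x "G V x - 1"] elim g by (simp add: G_def)
  qed
qed

end

section \<open>Algebras generated by free self-adjoint operators\<close>

lemma real_subalgebra_closure:
  fixes B :: "'a::real_normed_algebra_1 set"
  assumes B: "real_subalgebra B"
  shows "real_subalgebra (closure B)"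
proof -
  have *: "\<exists>X. (\<forall>n::nat. X n \<in> B) \<and> X \<longlonglongrightarrow> a" if "a \<in> closure B" for a
    using that unfolding closure_sequential .
  have seq: "a \<in> closure B" if "\<And>n::nat. X n \<in> B" "X \<longlonglongrightarrow> a" for X a
    unfolding closure_sequential using that by blast
  have one: "1 \<in> closure B" "0 \<in> closure B"
    using subsetD[OF closure_subset real_subalgebraD(1)[OF B]]
      subsetD[OF closure_subset real_subalgebraD(2)[OF B]] by blast+
  have add: "a + b \<in> closure B" and mult: "a * b \<in> closure B" if ab: "a \<in> closure B" "b \<in> closure B" for a b
  proof -
    obtain X Y where X: "\<And>n::nat. X n \<in> B" "X \<longlonglongrightarrow> a" and Y: "\<And>n::nat. Y n \<in> B" "Y \<longlonglongrightarrow> b"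
      using *[OF ab(1)] *[OF ab(2)] by blast
    show "a + b \<in> closure B" using real_subalgebraD(3)[OF B X(1) Y(1)] tendsto_add[OF X(2) Y(2)] by (rule seq)
    show "a * b \<in> closure B" using real_subalgebraD(7)[OF B X(1) Y(1)] tendsto_mult[OF X(2) Y(2)] by (rule seq)
  qed
  have scale: "r *\<^sub>R a \<in> closure B" if a: "a \<in> closure B" for a r
  proof -
    obtain X where X: "\<And>n::nat. X n \<in> B" "X \<longlonglongrightarrow> a" using *[OF a] by blast
    show ?thesis using real_subalgebraD(6)[OF B X(1)] tendsto_scaleR[OF tendsto_const X(2)] by (rule seq)
  qed
  show ?thesis unfolding real_subalgebra_def subspace_def by (intro conjI ballI allI one add mult scale)
qed

lemma real_subalgebra_Int:
  "real_subalgebra A \<Longrightarrow> real_subalgebra B \<Longrightarrow> real_subalgebra (A \<inter> B)"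
  by (simp add: real_subalgebra_def subspace_inter)

lemma real_subalgebra_span_powers:
  fixes x :: "'a::real_algebra_1"
  shows "real_subalgebra (span (range (\<lambda>n. x ^ n)))" (is "real_subalgebra ?S")
proof -
  have pow: "x ^ n \<in> ?S" for n by (rule span_base) simp
  have xn: "x ^ n * b \<in> ?S" if b: "b \<in> ?S" for n b
    using b
  proof (induction rule: span_induct_alt)
    case (step c y z)
    then obtain k where "y = x ^ k" by blast
    then have "x ^ n * (c *\<^sub>R y + z) = c *\<^sub>R x ^ (n + k) + x ^ n * z"
      by (simp add: distrib_left power_add)
    then show ?case using step(2) by (auto intro: span_add span_scale pow)
  qed (simp add: span_zero)
  have "a * b \<in> ?S" if a: "a \<in> ?S" and b: "b \<in> ?S" for a b
    using a
  proof (induction rule: span_induct_alt)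
    case (step c y z)
    then obtain k where "y = x ^ k" by blast
    then have "(c *\<^sub>R y + z) * b = c *\<^sub>R (x ^ k * b) + z * b"
      by (simp add: distrib_right)
    then show ?case using step(2) by (auto intro: span_add span_scale xn b)
  qed (simp add: span_zero)
  then show ?thesis using pow[of 0] by (simp add: real_subalgebra_def)
qed

lemma closure_power_series:
  fixes B :: "'a::{real_normed_algebra_1, banach} set"
  assumes B: "real_subalgebra B" and Y: "Y \<in> closure B" "norm Y < 1"
  shows "(\<Sum>n. Y ^ n) \<in> closure B"
proof -
  note cl = real_subalgebraD[OF real_subalgebra_closure[OF B]]
  have "(\<Sum>k<n. Y ^ k) \<in> closure B" for n
    by (induction n) (auto intro: cl Y)
  then have "(\<Sum>n. Y ^ n) \<in> closure (closure B)"
    unfolding closure_sequential[of _ "closure B"]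
    by (intro exI[of _ "\<lambda>n. \<Sum>k<n. Y ^ k"] conjI allI summable_LIMSEQ neumann_series(1) Y(2))
  then show ?thesis by simp
qed

text \<open>The square of \<open>norm (T x)\<close> is the inner product of \<open>S (T x)\<close>
  with \<open>x\<close>, and one factor cancels. It lets the Neumann series of the adjoint converge
  as well.\<close>

lemma norm_adjoint_le:
  assumes "is_adjoint S T"
  shows "norm T \<le> norm S"
proof (rule norm_bounded_op_le)
  fix x
  let ?z = "apply_op T x"
  have "(norm ?z)\<^sup>2 = inner (apply_op S ?z) x"
    using is_adjoint_inner[OF assms, of ?z x] by (simp add: dot_square_norm)
  also have "\<dots> \<le> norm (apply_op S ?z) * norm x" by (rule norm_cauchy_schwarz)
  also have "\<dots> \<le> norm S * norm ?z * norm x" by (intro mult_right_mono norm_apply_op) simp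
  finally have "norm ?z * norm ?z \<le> norm ?z * (norm S * norm x)" by (simp add: power2_eq_square mult_ac)
  then show "norm ?z \<le> norm S * norm x"
    by (cases "norm ?z = 0") (auto simp: mult_le_cancel_left)
qed simp

text \<open>Even powers give the squared norm of \<open>S ^ k\<close> applied to \<open>x\<close>,
  odd powers the form of \<open>S\<close> at that vector. This makes the moments of \<open>U\<close>
  and \<open>V\<close> nonnegative.\<close>

lemma positive_form_power:
  assumes S: "self_adjoint S" "\<And>x. 0 \<le> inner x (apply_op S x)"
  shows "0 \<le> inner x (apply_op (S ^ n) x)"
proof -
  have sa: "inner (apply_op (S ^ k) y) z = inner y (apply_op (S ^ k) z)" for k y z
    using is_adjoint_inner self_adjoint_power[OF S(1)] unfolding self_adjoint_def by blast
  consider k where "n = k + k" | k where "n = k + Suc k" by (cases "even n") (auto elim!: evenE oddE simp: mult_2)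
  then show ?thesis
  proof cases
    case 1
    then have "inner x (apply_op (S ^ n) x) = inner (apply_op (S ^ k) x) (apply_op (S ^ k) x)"
      by (simp only: power_add times_bounded_op.rep_eq sa)
    then show ?thesis by simp
  next
    case 2
    then have "S ^ n = S ^ k * (S * S ^ k)" by (simp only: power_add power_Suc)
    then have "inner x (apply_op (S ^ n) x) = inner (apply_op (S ^ k) x) (apply_op S (apply_op (S ^ k) x))"
      by (simp only: times_bounded_op.rep_eq sa)
    then show ?thesis using S(2) by simp
  qed
qed

lemma unital_subalgebra_hull: "unital_subalgebra (unital_subalgebra hull S)"
  by (rule hull_in) (unfold unital_subalgebra_def, blast)

lemma span_powers_subset_hull:
  fixes X :: "'h::chilbert_space bounded_op"
  shows "span (range (\<lambda>n. X ^ n)) \<subseteq> unital_subalgebra hull {X}" (is "_ \<subseteq> ?H")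
proof (rule span_minimal)
  have one: "1 \<in> ?H" and add: "\<And>a b. a \<in> ?H \<Longrightarrow> b \<in> ?H \<Longrightarrow> a + b \<in> ?H"
    and mult: "\<And>a b. a \<in> ?H \<Longrightarrow> b \<in> ?H \<Longrightarrow> a * b \<in> ?H" and scale: "\<And>c a. a \<in> ?H \<Longrightarrow> c *\<^sub>C a \<in> ?H"
    using unital_subalgebra_hull[of "{X}"] unfolding unital_subalgebra_def by blast+
  have X: "X \<in> ?H" by (rule hull_inc) simp
  have "X ^ n \<in> ?H" for n by (induction n) (simp_all add: one mult X)
  then show "range (\<lambda>n. X ^ n) \<subseteq> ?H" by blast
  have "0 \<in> ?H"
    using scale[OF one, of 0] scaleR_zero_left[of "1 :: 'h bounded_op", unfolded scaleR_bounded_op_eq] by simp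
  then show "subspace ?H" by (intro subspaceI) (simp_all add: add scaleR_bounded_op_eq scale)
qed

context tracial_state
begin

lemma adjointableI: "a \<in> A \<Longrightarrow> is_adjoint a b \<Longrightarrow> a \<in> adjointable"
  unfolding adjointable_def by blast

lemma adjointableE:
  assumes "a \<in> adjointable"
  obtains b where "a \<in> A" "is_adjoint a b"
  using assms unfolding adjointable_def by blast

lemma adjointable_subalgebra: "real_subalgebra adjointable"
proof -
  have one: "1 \<in> adjointable" by (rule adjointableI[OF _ is_adjoint_one]) simp
  have scale: "r *\<^sub>R a \<in> adjointable" if "a \<in> adjointable" for r a
    using that by (elim adjointableE) (rule adjointableI[OF _ is_adjoint_scaleR], simp_all)
  have add: "a + b \<in> adjointable" if "a \<in> adjointable" "b \<in> adjointable" for a b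
    using that by (elim adjointableE) (rule adjointableI[OF _ is_adjoint_add], simp_all)
  have mult: "a * b \<in> adjointable" if "a \<in> adjointable" "b \<in> adjointable" for a b
    using that by (elim adjointableE) (rule adjointableI[OF _ is_adjoint_mult], simp_all)
  have "0 \<in> adjointable" using scale[OF one, of 0] by simp
  then show ?thesis
    unfolding real_subalgebra_def by (intro conjI subspaceI ballI one add scale mult)
qed

lemma adjointable_A: "a \<in> adjointable \<Longrightarrow> a \<in> A"
  by (erule adjointableE)

sublocale tracial_functional adjointable "\<lambda>x. Re (\<phi> x)"
proof
  show "real_subalgebra adjointable" by (rule adjointable_subalgebra)
  show "Re (\<phi> 1) = 1" by simp
  fix x y and r :: real
  assume x: "x \<in> adjointable"
  then show "Re (\<phi> (r *\<^sub>R x)) = r * Re (\<phi> x)" by (simp add: adjointable_A)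
  show "\<bar>Re (\<phi> x)\<bar> \<le> norm x" using x by (elim adjointableE) (rule \<tau>_norm_bound)
  assume y: "y \<in> adjointable"
  show "Re (\<phi> (x + y)) = Re (\<phi> x) + Re (\<phi> y)" using x y by (simp add: adjointable_A)
  show "Re (\<phi> (x * y)) = Re (\<phi> (y * x))" using trace[of x y] x y by (simp only: adjointable_A)
qed

lemma adjointable_self_adjoint: "a \<in> A \<Longrightarrow> self_adjoint a \<Longrightarrow> a \<in> adjointable"
  unfolding self_adjoint_def by (rule adjointableI)

text \<open>The adjoint is the inverse of \<open>1 - Z\<close>; its Neumann series converges because
  passing to the adjoint does not increase the norm.\<close>

lemma adjointable_series:
  assumes Y: "Y \<in> adjointable" "norm Y < 1"
  shows "(\<Sum>n. Y ^ n) \<in> adjointable"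
proof -
  obtain Z where YA: "Y \<in> A" and Z: "is_adjoint Y Z" using Y by (elim adjointableE)
  then have nZ: "norm Z < 1" using norm_adjoint_le[OF Z] Y(2) by simp
  show ?thesis
  proof (rule adjointable_inverse)
    show "1 - Y \<in> A" using YA by simp
    show "is_adjoint (1 - Y) (1 - Z)" by (intro is_adjoint_diff is_adjoint_one Z)
  qed (rule neumann_series Y(2) nZ)+
qed

text \<open>Real combinations of powers of a self-adjoint operator have real trace, so on them a
  vanishing real part means \<open>\<phi> a = 0\<close>. An alternating word then unfolds into the
  lists required by \<open>free_family\<close>.\<close>

lemma free_span_powers:
  assumes free: "free_elements \<phi> X Y" and X: "X \<in> A" "self_adjoint X" and Y: "Y \<in> A" "self_adjoint Y"
  defines "B \<equiv> \<lambda>i. span (range (\<lambda>n. (if i then X else Y) ^ n))"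
  assumes alt: "alternating (\<lambda>x. Re (\<phi> x)) B i x"
  shows "\<tau> x = 0"
proof -
  let ?H = "\<lambda>i. unital_subalgebra hull {if i then X else Y}"
  have B: "a \<in> ?H i \<and> \<phi> a = 0" if a: "a \<in> B i" "\<tau> a = 0" for a i
  proof -
    let ?Z = "if i then X else Y"
    have Z: "?Z \<in> A" "self_adjoint ?Z" using X Y by auto
    have "subspace {y \<in> A. Im (\<phi> y) = 0}" using \<phi>_scaleR[of 1 0] by (auto simp: subspace_def)
    moreover have "?Z ^ n \<in> {y \<in> A. Im (\<phi> y) = 0}" for n
      using \<phi>_self_adjoint[OF _ self_adjoint_power[OF Z(2), of n]] Z(1)
      by (simp add: complex_eq_iff)
    ultimately have "B i \<subseteq> {y \<in> A. Im (\<phi> y) = 0}"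
      unfolding B_def by (intro span_minimal) auto
    then have "\<phi> a = 0" using a by (auto simp: complex_eq_iff)
    moreover have "a \<in> ?H i" using a(1) span_powers_subset_hull unfolding B_def by blast
    ultimately show ?thesis by blast
  qed
  have "\<exists>is as. is \<noteq> [] \<and> hd is = i \<and> distinct_adj is \<and> list_all2 (\<lambda>i a. a \<in> ?H i \<and> \<phi> a = 0) is as \<and> x = prod_list as"
    using alt
  proof (induction rule: alternating.induct)
    case (single a i)
    then show ?case using B[OF single] by (intro exI[of _ "[i]"] exI[of _ "[a]"]) simp
  next
    case (Cons a i x)
    then obtain js as where "js \<noteq> []" "hd js = (\<not> i)" "distinct_adj js"
      "list_all2 (\<lambda>i a. a \<in> ?H i \<and> \<phi> a = 0) js as" "x = prod_list as" by blast
    moreover have "distinct_adj (i # js)" using \<open>js \<noteq> []\<close> \<open>hd js = _\<close> \<open>distinct_adj js\<close> by (cases js) simp_all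
    ultimately show ?case using B[OF Cons(1,2)]
      by (intro exI[of _ "i # js"] exI[of _ "a # as"]) simp
  qed
  then obtain js as where js: "js \<noteq> [] \<and> distinct_adj js \<and> list_all2 (\<lambda>i a. a \<in> ?H i \<and> \<phi> a = 0) js as"
    and x: "x = prod_list as" by blast
  have "as \<noteq> []" using js by (auto dest: list_all2_lengthD)
  then have "as \<noteq> [] \<and> distinct_adj js \<and> list_all2 (\<lambda>i a. a \<in> ?H i \<and> \<phi> a = 0) js as"
    using js by blast
  then have "\<phi> (prod_list as) = 0"
    using free unfolding free_elements_def free_family_def by (elim allE[of _ js] allE[of _ as]) (erule mp)
  then show ?thesis by (simp add: x)
qed

lemma complete_free_pair_span_powers:
  assumes free: "free_elements \<phi> X Y" and X: "X \<in> A" "self_adjoint X" and Y: "Y \<in> A" "self_adjoint Y"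
  shows "complete_free_pair adjointable (\<lambda>x. Re (\<phi> x))
    (\<lambda>i. adjointable \<inter> closure (span (range (\<lambda>n. (if i then X else Y) ^ n))))"
proof -
  define B where "B = (\<lambda>i. span (range (\<lambda>n. (if i then X else Y) ^ n)))"
  have B: "real_subalgebra (B i)" for i unfolding B_def by (rule real_subalgebra_span_powers)
  have BC: "B i \<subseteq> adjointable" for i
    unfolding B_def
  proof (rule span_minimal)
    have "(if i then X else Y) \<in> adjointable" using X Y adjointable_self_adjoint by simp
    then show "range (\<lambda>n. (if i then X else Y) ^ n) \<subseteq> adjointable"
      using real_subalgebraD(8)[OF adjointable_subalgebra] by blast
    show "subspace adjointable" using adjointable_subalgebra by (simp add: real_subalgebra_def)
  qed
  have "complete_free_pair adjointable (\<lambda>x. Re (\<phi> x)) (\<lambda>i. adjointable \<inter> closure (B i))"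
  proof unfold_locales
    show "real_subalgebra (adjointable \<inter> closure (B i))" for i
      by (intro real_subalgebra_Int adjointable_subalgebra real_subalgebra_closure B)
    show "\<tau> x = 0" if "alternating \<tau> (\<lambda>i. adjointable \<inter> closure (B i)) i x" for i x
      using alternating_closure[OF B BC _ that] free_span_powers[OF free X Y] unfolding B_def by blast
    show "(\<Sum>n. Z ^ n) \<in> adjointable \<inter> closure (B i)" if "Z \<in> adjointable \<inter> closure (B i)" "norm Z < 1" for Z i
      using that adjointable_series closure_power_series[OF B] by blast
    show "(\<Sum>n. (u * v) ^ n) \<in> adjointable"
      if "u \<in> adjointable \<inter> closure (B True)" "v \<in> adjointable \<inter> closure (B False)" "norm u * norm v < 1" for u v
      using that norm_mult_ineq[of u v] real_subalgebraD(7)[OF adjointable_subalgebra]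
      by (intro adjointable_series) auto
  qed auto
  then show ?thesis unfolding B_def .
qed

end

section \<open>Constant regressions\<close>

theorem theorem4p3:
  fixes A :: "'h::chilbert_space bounded_op set"
    and \<phi> :: "'h bounded_op \<Rightarrow> complex"
    and E :: "'h bounded_op \<Rightarrow> 'h bounded_op"
    and U V sqrtV :: "'h bounded_op"
    and c d \<alpha> :: real
  assumes "wstar_probability_space A \<phi>"
    and "U \<in> A" and "V \<in> A" and "free_elements \<phi> U V"
    and "strictly_less 0 U" and "strictly_less U 1" and "strictly_less 0 V"
    and "\<not> (is_scalar U \<and> is_scalar V)"
    and "sqrtV \<in> A" and "positive_op sqrtV" and "sqrtV * sqrtV = V"
    and "op_invertible (sqrtV * (1 - U) * sqrtV)"
    and "conditional_expectation A \<phi> (generated_vna (sqrtV * U * sqrtV)) E"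
    and "E (op_inverse (sqrtV * (1 - U) * sqrtV)) = complex_of_real c *\<^sub>C 1"
    and "E ((op_inverse (sqrtV * (1 - U) * sqrtV))\<^sup>2) = complex_of_real d *\<^sub>C 1"
    and "\<alpha> = Re (\<phi> (U * op_inverse (1 - U)))"
  shows "d > c\<^sup>2
    \<and> has_distribution \<phi> V (free_poisson ((d - c\<^sup>2) / c ^ 3) ((c\<^sup>2 * \<alpha> + d) / (d - c\<^sup>2)))
    \<and> has_distribution \<phi> U (free_binomial (c\<^sup>2 * \<alpha> / (d - c\<^sup>2)) (d / (d - c\<^sup>2)))"
proof -
  note wstar = assms(1) and U_A = assms(2) and V_A = assms(3) and free_UV = assms(4)
    and U_pos = assms(5) and U_lt1 = assms(6) and V_pos = assms(7) and not_scalar = assms(8)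
    and s_A = assms(9) and s_pos = assms(10) and s_sq = assms(11) and W_inv = assms(12)
    and E = assms(13) and E1 = assms(14) and E2 = assms(15) and \<alpha> = assms(16)
  have vA: "von_neumann_algebra A" and faithful: "\<And>a. a \<in> A \<Longrightarrow> \<phi> (adj a * a) = 0 \<Longrightarrow> a = 0"
    using wstar by (auto simp: wstar_probability_space_def finite_von_neumann_algebra_def)
  interpret tracial_state A \<phi>
    using wstar vA by unfold_locales (auto simp: wstar_probability_space_def)
  define s where "s = sqrtV"
  have sV: "s * s = V" and s[simp]: "s \<in> A" and s_sa: "self_adjoint s"
    using s_sq s_A s_pos by (auto simp: s_def positive_op_def)
  note U_A[simp] V_A[simp]

  \<comment> \<open>Bounded inverses of \<open>V\<close> and \<open>1 - U\<close>\<close>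
  define W where "W = s * (1 - U) * s"
  obtain Wi where Wi: "W * Wi = 1" "Wi * W = 1" using W_inv by (auto simp: op_invertible_def W_def s_def)
  have inverse_unique: "y = z" if "x * y = 1" "z * x = 1" for x y z :: "'h bounded_op"
    using that by (metis mult.assoc mult_1_left mult_1_right)
  have op_inverse: "op_inverse x = y" if "x * y = 1" "y * x = 1" for x y :: "'h bounded_op"
    unfolding op_inverse_def using that inverse_unique by blast
  \<comment> \<open>A right inverse of \<open>s\<close>, read off from \<open>W * Wi = 1\<close>;
    \<open>Wi * W = 1\<close> gives a left inverse, so \<open>s\<close> is invertible and with it
    \<open>V\<close> and \<open>1 - U\<close>.\<close>
  define h where "h = (1 - U) * s * Wi"
  have sh: "s * h = 1" using Wi(1) by (simp add: h_def W_def mult.assoc)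
  have hs: "h * s = 1"
  proof -
    have "(Wi * s * (1 - U)) * s = 1" using Wi(2) by (simp add: W_def mult.assoc)
    then show ?thesis using inverse_unique[OF sh] by simp
  qed
  have Wi_A[simp]: "Wi \<in> A" using von_neumann_algebraD(8)[OF vA _ Wi] by (simp add: W_def)
  have h_A[simp]: "h \<in> A" by (simp add: h_def)
  define p q where "p = s * Wi * s" and "q = h * h"
  have p_A[simp]: "p \<in> A" and q_A[simp]: "q \<in> A" by (simp_all add: p_def q_def)
  have U1: "1 - U = h * W * h"
  proof -
    have "h * W * h = (h * s) * (1 - U) * (s * h)" by (simp only: W_def mult.assoc)
    then show ?thesis by (simp add: hs sh)
  qed
  have p1: "p * (1 - U) = 1"
  proof -
    have "p * (1 - U) = s * Wi * (s * h) * W * h" by (simp only: p_def U1 mult.assoc)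
    also have "\<dots> = s * (Wi * W) * h" by (simp add: sh mult.assoc)
    finally show ?thesis by (simp add: Wi sh)
  qed
  have p2: "(1 - U) * p = 1"
  proof -
    have "(1 - U) * p = h * W * (h * s) * Wi * s" by (simp only: p_def U1 mult.assoc)
    also have "\<dots> = h * (W * Wi) * s" by (simp add: hs mult.assoc)
    finally show ?thesis by (simp add: Wi hs)
  qed
  have qV: "q * V = 1"
  proof -
    have "q * V = h * (h * s) * s" by (simp only: q_def sV[symmetric] mult.assoc)
    then show ?thesis by (simp add: hs)
  qed
  have Vq: "V * q = 1"
  proof -
    have "V * q = s * (s * h) * h" by (simp only: q_def sV[symmetric] mult.assoc)
    then show ?thesis by (simp add: sh)
  qed
  have hph: "h * p * h = Wi"
  proof -
    have "h * p * h = (h * s) * Wi * (s * h)" by (simp only: p_def mult.assoc)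
    then show ?thesis by (simp add: hs sh)
  qed

  \<comment> \<open>Self-adjointness, spectral gaps and positive moments\<close>
  have U_sa: "self_adjoint U" and V_sa: "self_adjoint V"
    using U_pos V_pos by (auto simp: strictly_less_def)
  have sa_diff: "self_adjoint (1 - U)"
    using U_sa unfolding self_adjoint_def by (intro is_adjoint_diff is_adjoint_one)
  have p_sa: "self_adjoint p"
    using is_adjoint_inverse[of "1 - U" "1 - U" p p] sa_diff p1 p2 by (simp add: self_adjoint_def)
  have h_sa: "self_adjoint h"
    using is_adjoint_inverse[of s s h h] s_sa hs sh by (simp add: self_adjoint_def)
  have q_sa: "self_adjoint q"
    using is_adjoint_mult[of h h h h] h_sa by (simp add: self_adjoint_def q_def)
  have Wi_sa: "self_adjoint Wi"
    using is_adjoint_mult[OF is_adjoint_mult, of h h p p h h] h_sa p_sa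
    by (simp add: self_adjoint_def mult.assoc flip: hph)
  have form: "0 \<le> inner x (apply_op (T - S) x)" if "strictly_less S T" for S T :: "'h bounded_op" and x
    using that by (cases "x = 0") (auto simp: strictly_less_def Re_cinner intro: less_imp_le)
  have U_form: "0 \<le> inner x (apply_op U x)" and V_form: "0 \<le> inner x (apply_op V x)"
    and U1_form: "0 \<le> inner x (apply_op (1 - U) x)" for x
    using form[OF U_pos, of x] form[OF V_pos, of x] form[OF U_lt1, of x] by simp_all
  have q_form: "0 \<le> inner x (apply_op q x)" for x
  proof -
    have "inner (apply_op h x) (apply_op h x) = inner x (apply_op q x)"
      using is_adjoint_inner[of h h x "apply_op h x"] h_sa by (simp add: q_def self_adjoint_def)
    then show ?thesis by (metis inner_ge_zero)
  qed
  obtain \<epsilon> where \<epsilon>: "\<epsilon> > 0" "\<And>x. \<epsilon> * (norm x)\<^sup>2 \<le> inner x (apply_op V x)"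
    using form_lower_bound[OF V_sa V_form Vq] by blast
  obtain \<epsilon>' where \<epsilon>': "\<epsilon>' > 0" "\<And>x. \<epsilon>' * (norm x)\<^sup>2 \<le> inner x (apply_op (1 - U) x)"
    using form_lower_bound[OF sa_diff U1_form p2] by blast
  obtain \<epsilon>q where \<epsilon>q: "\<epsilon>q > 0" "\<And>x. \<epsilon>q * (norm x)\<^sup>2 \<le> inner x (apply_op q x)"
    using form_lower_bound[OF q_sa q_form qV] by blast
  obtain y :: 'h where y: "y \<noteq> 0" using ex_nonzero by blast
  \<comment> \<open>The gap of \<open>1 - U\<close> bounds the form of \<open>U\<close> by
    \<open>1 - \<epsilon>'\<close>. Hence \<open>p\<close> is the Neumann series of \<open>U\<close>
    at parameter 1 and lies in the closed algebra of \<open>U\<close>.\<close>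
  have U_norm: "norm U < 1"
  proof -
    have le: "inner x (apply_op U x) \<le> (1 - \<epsilon>') * (norm x)\<^sup>2" for x
      using \<epsilon>'(2)[of x] by (simp add: inner_diff_right dot_square_norm left_diff_distrib)
    have "0 \<le> (1 - \<epsilon>') * (norm y)\<^sup>2" using U_form[of y] le[of y] by linarith
    then have "0 \<le> 1 - \<epsilon>'" using y by (simp add: zero_le_mult_iff)
    then have "norm U \<le> 1 - \<epsilon>'" by (intro norm_le_of_form U_sa U_form le)
    then show ?thesis using \<epsilon>'(1) by simp
  qed
  have \<tau>V: "0 < \<tau> V" and \<tau>q: "0 < \<tau> q"
    using \<tau>_lower_bound[OF V_A V_sa \<epsilon>(2)] \<tau>_lower_bound[OF q_A q_sa \<epsilon>q(2)] \<epsilon>(1) \<epsilon>q(1) by simp_all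
  have \<tau>_pow: "0 \<le> \<tau> (U ^ n)" "0 \<le> \<tau> (V ^ n)" for n
    using positive_form_power[OF U_sa U_form, of _ n] positive_form_power[OF V_sa V_form, of _ n]
    by (auto intro!: \<tau>_lower_bound[where r = 0] self_adjoint_power U_sa V_sa)
  have faithful_sa: "x = 0" if "x \<in> A" "self_adjoint x" "\<tau> (x * x) = 0" for x
  proof (rule faithful[OF that(1)])
    have "adj x = x" using that(2) adj_eqI by (simp add: self_adjoint_def)
    then show "\<phi> (adj x * x) = 0"
      using \<phi>_adjoint_square(1)[of x x] that by (simp add: self_adjoint_def complex_eq_iff)
  qed
  have "U \<noteq> 0" using U_pos y by (auto simp: strictly_less_def Re_cinner)
  then have \<tau>U2: "0 < \<tau> (U ^ 2)"
    using faithful_sa[OF U_A U_sa] \<tau>_pow(1)[of 2] by (auto simp: power2_eq_square less_le)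

  \<comment> \<open>The inverses \<open>p\<close> and \<open>q\<close> inside the free pair\<close>
  define F where "F = (\<lambda>i. adjointable \<inter> closure (span (range (\<lambda>n. (if i then U else V) ^ n))))"
  interpret fp: complete_free_pair adjointable "\<lambda>x. Re (\<phi> x)" F
    unfolding F_def by (rule complete_free_pair_span_powers[OF free_UV U_A U_sa V_A V_sa])
  have span: "x \<in> span (range (\<lambda>n. x ^ n))" for x :: "'h bounded_op"
    by (rule span_base) (metis power_one_right rangeI)
  have UF: "U \<in> F True" and VF: "V \<in> F False"
    unfolding F_def if_True if_False
    by (rule IntI[OF adjointable_self_adjoint[OF U_A U_sa] subsetD[OF closure_subset span]]
        IntI[OF adjointable_self_adjoint[OF V_A V_sa] subsetD[OF closure_subset span]])+
  have pF: "p \<in> F True" and p_series: "p = (\<Sum>n. U ^ n)"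
  proof -
    show "p = (\<Sum>n. U ^ n)" using inverse_unique[OF neumann_series(2)[OF U_norm] p1] by simp
    then show "p \<in> F True" using fp.F_series[OF UF U_norm] by simp
  qed
  \<comment> \<open>The inverse of \<open>V\<close> is reached from the Neumann series of
    \<open>1 - V / K\<close>, whose norm is below 1 by the gap of \<open>V\<close>.\<close>
  have qF: "q \<in> F False"
  proof -
    define K where "K = norm V + \<epsilon>"
    have K: "K > 0" using \<epsilon>(1) by (simp add: K_def add_nonneg_pos)
    have n: "norm (1 - (1 / K) *\<^sub>R V) < 1"
      unfolding K_def by (rule norm_one_minus_scaled[OF V_sa \<epsilon>(2,1)])
    have "(\<Sum>n. (1 - (1 / K) *\<^sub>R V) ^ n) \<in> F False"
      by (rule fp.F_series[OF _ n]) (simp add: VF)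
    also have "(\<Sum>n. (1 - (1 / K) *\<^sub>R V) ^ n) = K *\<^sub>R q"
    proof (rule inverse_unique)
      have "1 - (1 - (1 / K) *\<^sub>R V) = (1 / K) *\<^sub>R V" by simp
      then show "(1 / K) *\<^sub>R V * (\<Sum>n. (1 - (1 / K) *\<^sub>R V) ^ n) = 1"
        using neumann_series(2)[OF n] by (simp only:)
      show "K *\<^sub>R q * ((1 / K) *\<^sub>R V) = 1" using qV K by simp
    qed
    finally have "(1 / K) *\<^sub>R (K *\<^sub>R q) \<in> F False" by (rule fp.F_simps(6))
    then show ?thesis using K by simp
  qed
  have \<alpha>p: "\<alpha> = \<tau> p - 1"
  proof -
    have "U * p = p - 1" using p2 by (simp add: left_diff_distrib algebra_simps)
    then show ?thesis using \<alpha> op_inverse[OF p2 p1] by simp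
  qed
  \<comment> \<open>The terms of order 0 and 2 in the series for \<open>\<tau> p\<close> already
    exceed 1, as faithfulness makes \<open>\<tau> (U ^ 2)\<close> positive.\<close>
  have \<alpha>_pos: "\<alpha> > 0"
  proof -
    have "(\<lambda>n. \<tau> (U ^ n)) sums \<tau> p"
      using fp.\<tau>_series[OF UF, of 1] U_norm by (simp add: p_series)
    then have "(\<Sum>n\<in>{0, 2}. \<tau> (U ^ n)) \<le> \<tau> p"
      using \<tau>_pow(1) sum_le_suminf[of "\<lambda>n. \<tau> (U ^ n)" "{0, 2}"] by (auto simp: sums_iff)
    then show ?thesis using \<tau>U2 \<alpha>p by simp
  qed

  \<comment> \<open>The regressions as trace identities\<close>
  define X where "X = s * U * s"
  define B where "B = generated_vna X"
  have X_A: "X \<in> A" by (simp add: X_def)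
  have "B \<subseteq> A"
    unfolding B_def generated_vna_def by (rule hull_minimal) (simp_all add: vA X_A)
  then have B_A: "b \<in> A" if "b \<in> B" for b using that by blast
  have one_B: "1 \<in> B" and X_B: "X \<in> B"
    unfolding B_def generated_vna_def by (rule hull_inc, simp)+
  have resolvent_B: "r \<in> B" if "(1 - z *\<^sub>R X) * r = 1" "r * (1 - z *\<^sub>R X) = 1" for r z
  proof -
    have "1 - z *\<^sub>R X \<in> t" if "von_neumann_algebra t" "{X, 1} \<subseteq> t" for t
    proof -
      have "X \<in> t" using that(2) by simp
      then show ?thesis
        by (intro von_neumann_algebraD(3)[OF that(1)] von_neumann_algebraD(4,7)[OF that(1)])
    qed
    then have "1 - z *\<^sub>R X \<in> von_neumann_algebra hull {X, 1}" unfolding hull_def by (intro InterI) blast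
    then show ?thesis
      unfolding B_def generated_vna_def using that by (rule von_neumann_algebra_inverse_hull)
  qed
  have regression: "\<tau> (x * r) = k * \<tau> r" if "x \<in> A" "E x = complex_of_real k *\<^sub>C 1" "r \<in> B" for x r k
  proof -
    have E': "\<And>a. a \<in> A \<Longrightarrow> \<phi> (E a) = \<phi> a"
      "\<And>a b b'. a \<in> A \<Longrightarrow> b \<in> B \<Longrightarrow> b' \<in> B \<Longrightarrow> E (b * a * b') = b * E a * b'"
      using E unfolding conditional_expectation_def B_def X_def s_def by blast+
    have "\<phi> (x * r) = \<phi> (E (1 * x * r))" using E'(1)[of "x * r"] that B_A by simp
    also have "\<dots> = \<phi> (1 * E x * r)" using E'(2)[OF that(1) one_B that(3)] by simp
    also have "\<dots> = complex_of_real k * \<phi> r"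
      unfolding that(2) using B_A[OF that(3)] by (simp add: scaleC_mult_bounded_op)
    finally show ?thesis by simp
  qed
  have EWi: "E Wi = complex_of_real c *\<^sub>C 1" and EWi2: "E (Wi * Wi) = complex_of_real d *\<^sub>C 1"
    using E1 E2 op_inverse[OF Wi] unfolding W_def s_def by (simp_all add: power2_eq_square)
  \<comment> \<open>\<open>R \<mapsto> s * R * h\<close> is the similarity that carries \<open>U * V\<close> to \<open>X\<close>.\<close>
  have cond: "\<tau> (q * p * R) = c * \<tau> R" "\<tau> (q * p * (q * p) * R) = d * \<tau> R"
    if R: "R \<in> A" "s * R * h \<in> B" for R
  proof -
    have r: "\<tau> (s * R * h) = \<tau> R"
    proof -
      have "\<tau> (s * R * h) = \<tau> (h * (s * R))" using trace[of "s * R" h] R by simp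
      also have "h * (s * R) = R" by (simp add: hs flip: mult.assoc)
      finally show ?thesis .
    qed
    have "Wi * (s * R * h) = h * p * (h * s) * R * h" by (simp only: hph[symmetric] mult.assoc)
    then have w1: "Wi * (s * R * h) = h * p * R * h" by (simp add: hs)
    have "\<tau> (q * p * R) = \<tau> (h * (h * p * R))" by (simp add: q_def mult.assoc)
    also have "\<dots> = \<tau> (h * p * R * h)" using trace[of h "h * p * R"] R by simp
    also have "\<dots> = c * \<tau> R" using regression[OF Wi_A EWi R(2)] r w1 by simp
    finally show "\<tau> (q * p * R) = c * \<tau> R" .
    have "Wi * Wi * (s * R * h) = h * p * (h * h) * p * R * h"
      by (simp only: mult.assoc w1[unfolded mult.assoc]) (simp only: hph[symmetric] mult.assoc)
    then have w2: "Wi * Wi * (s * R * h) = h * p * q * p * R * h" by (simp add: q_def mult.assoc)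
    have "\<tau> (q * p * (q * p) * R) = \<tau> (h * (h * p * q * p * R))" by (simp add: q_def mult.assoc)
    also have "\<dots> = \<tau> (h * p * q * p * R * h)" using trace[of h "h * p * q * p * R"] R by simp
    also have "\<dots> = d * \<tau> R" using regression[OF _ EWi2 R(2)] r w2 by simp
    finally show "\<tau> (q * p * (q * p) * R) = d * \<tau> R" .
  qed
  have cond1: "\<tau> (q * p) = c" "\<tau> (q * p * (q * p)) = d"
    using cond[of 1] one_B sh by simp_all
  have sUVh: "s * (U * V) * h = X"
  proof -
    have "s * (U * V) * h = s * U * s * (s * h)" by (simp only: sV[symmetric] mult.assoc)
    then show ?thesis by (simp add: sh X_def)
  qed
  have condX: "\<tau> (q * p * (U * V)) = c * \<tau> (U * V)" "\<tau> (q * p * (q * p) * (U * V)) = d * \<tau> (U * V)"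
    using cond[of "U * V"] X_B sUVh by simp_all
  \<comment> \<open>As \<open>s\<close> and \<open>h\<close> are mutually inverse, the similarity
    carries the resolvent of \<open>U * V\<close> to that of \<open>X\<close>, which lies in the von
    Neumann algebra generated by \<open>X\<close>.\<close>
  have condR: "\<tau> (q * p * R) = c * \<tau> R \<and> \<tau> (q * p * (q * p) * R) = d * \<tau> R"
    if "R \<in> adjointable" "R * (1 - z *\<^sub>R (U * V)) = 1" "(1 - z *\<^sub>R (U * V)) * R = 1" for z R
  proof -
    have D: "1 - z *\<^sub>R X = s * (1 - z *\<^sub>R (U * V)) * h"
      by (simp add: sUVh[symmetric] left_diff_distrib right_diff_distrib sh)
    have "(1 - z *\<^sub>R X) * (s * R * h) = s * ((1 - z *\<^sub>R (U * V)) * ((h * s) * R)) * h"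
      unfolding D by (simp only: mult.assoc)
    then have 1: "(1 - z *\<^sub>R X) * (s * R * h) = 1" by (simp add: hs that(3) sh)
    have "(s * R * h) * (1 - z *\<^sub>R X) = s * (R * ((h * s) * (1 - z *\<^sub>R (U * V)))) * h"
      unfolding D by (simp only: mult.assoc)
    then have 2: "(s * R * h) * (1 - z *\<^sub>R X) = 1" by (simp add: hs that(2) sh)
    show ?thesis using cond[OF adjointable_A[OF that(1)] resolvent_B[OF 1 2]] by blast
  qed

  \<comment> \<open>Strictness of \<open>d > c\<^sup>2\<close>\<close>
  have \<tau>qp: "\<tau> q * \<tau> p = c" using fp.\<tau>_mult[OF qF] pF cond1 by simp
  have c: "c > 0" using \<tau>qp \<tau>q \<alpha>_pos \<alpha>p by (simp flip: \<tau>qp)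
  have \<tau>Wi: "\<tau> Wi = c" "\<tau> (Wi * Wi) = d"
    using regression[OF Wi_A EWi one_B] regression[OF _ EWi2 one_B] by simp_all
  \<comment> \<open>Testing the regressions on 1 shows that \<open>Wi\<close> has mean
    \<open>c\<close> and second moment \<open>d\<close>, so \<open>d - c\<^sup>2\<close> is its
    variance.\<close>
  define Y where "Y = Wi - c *\<^sub>R 1"
  have Y: "Y \<in> A" "self_adjoint Y"
    using Wi_sa unfolding Y_def self_adjoint_def by (auto intro: is_adjoint_diff is_adjoint_scaleR is_adjoint_one)
  have YY: "\<tau> (Y * Y) = d - c\<^sup>2"
    by (simp add: Y_def left_diff_distrib right_diff_distrib \<tau>Wi power2_eq_square)
  have dc: "d > c\<^sup>2"
  proof (rule ccontr)
    assume "\<not> d > c\<^sup>2"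
    moreover have "0 \<le> d - c\<^sup>2" using \<phi>_adjoint_square(2)[of Y Y] Y YY by (simp add: self_adjoint_def)
    ultimately have "Y = 0" using faithful_sa[OF Y] YY by simp
    then have Wi_c: "Wi = c *\<^sub>R 1" by (simp add: Y_def)
    \<comment> \<open>Now \<open>V\<close> is a multiple of \<open>p\<close>, hence free from
      itself; its variance vanishes and faithfulness makes it a scalar, and then \<open>U\<close>
      too.\<close>
    then have pc: "p = c *\<^sub>R V" by (simp add: p_def sV)
    define k where "k = \<tau> V"
    have "\<tau> (p * V) = \<tau> p * \<tau> V" using fp.\<tau>_mult[OF pF] VF by simp
    then have VV: "\<tau> (V * V) = k * k" using c by (simp add: pc k_def)
    have "V - k *\<^sub>R 1 = 0"
    proof (rule faithful_sa)
      show "self_adjoint (V - k *\<^sub>R 1)"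
        using V_sa unfolding self_adjoint_def by (intro is_adjoint_diff is_adjoint_scaleR is_adjoint_one)
      show "\<tau> ((V - k *\<^sub>R 1) * (V - k *\<^sub>R 1)) = 0"
        by (simp add: left_diff_distrib right_diff_distrib VV) (simp add: k_def)
    qed simp
    then have Vk: "V = k *\<^sub>R 1" by simp
    have "(c * k) *\<^sub>R (1 - U) = 1" using p1 by (simp add: pc Vk)
    moreover have "c * k \<noteq> 0" using c \<tau>V by (simp add: k_def)
    moreover have "1 - U = (1 / (c * k)) *\<^sub>R ((c * k) *\<^sub>R (1 - U))" using \<open>c * k \<noteq> 0\<close> by simp
    ultimately have "1 - U = (1 / (c * k)) *\<^sub>R 1" by simp
    then have Uk: "U = (1 - 1 / (c * k)) *\<^sub>R 1" by (simp add: scaleR_diff_left algebra_simps)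
    have "is_scalar U" "is_scalar V"
      unfolding is_scalar_def by (rule exI, rule Uk[unfolded scaleR_bounded_op_eq], rule exI, rule Vk[unfolded scaleR_bounded_op_eq])
    then show False using not_scalar by blast
  qed

  \<comment> \<open>Identification of the two distributions\<close>
  define D where "D = d - c\<^sup>2"
  have D: "D > 0" using dc by (simp add: D_def)
  have d: "d > 0" using dc c by (smt (verit) zero_less_power)
  have eqs: "\<forall>\<^sub>F w in at_right 0. \<forall>m. m = (\<Sum>n. \<tau> (U ^ n) * w ^ n) - 1 \<longrightarrow>
      w * (1 + m) * (c\<^sup>2 * \<alpha> + (d - c\<^sup>2) * m) = m * (c\<^sup>2 * \<alpha> + d + (d - c\<^sup>2) * m)"
    "\<forall>\<^sub>F x in at_right 0. \<forall>m. m = (\<Sum>n. \<tau> (V ^ n) * x ^ n) - 1 \<longrightarrow>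
      x * (1 + m) * (c\<^sup>2 * \<alpha> + d + (d - c\<^sup>2) * m) = c ^ 3 * m"
    by (rule fp.moment_equations_eventually[OF UF pF p1 p2 VF qF qV Vq less_imp_neq[OF c, symmetric]
          cond1(1) condX(1) cond1(2) condX(2) _ \<alpha>p \<tau>_pow(1) \<tau>U2 \<tau>_pow(2) \<tau>V], rule condR; assumption)+
  have distr: "has_distribution \<phi> Z \<nu>"
    if "Z \<in> A" "self_adjoint Z" "prob_space \<nu>" "sets \<nu> = sets borel" "AE x in \<nu>. \<bar>x\<bar> \<le> r"
      and "\<And>n. \<tau> (Z ^ n) = (\<integral>x. x ^ n \<partial>\<nu>)" for Z \<nu> r
    unfolding has_distribution_def
    using that \<phi>_self_adjoint[OF _ self_adjoint_power[OF that(2)]] by auto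
  define a \<rho> where "a = D / c ^ 3" and "\<rho> = (c\<^sup>2 * \<alpha> + d) / D"
  have a: "a > 0" using c D by (simp add: a_def)
  have \<rho>: "\<rho> > 1"
  proof -
    have "0 < c\<^sup>2 * \<alpha>" "0 < c\<^sup>2" using c \<alpha>_pos by simp_all
    then have "0 < c\<^sup>2 * \<alpha> + c\<^sup>2" by (rule add_pos_pos)
    then have "D < c\<^sup>2 * \<alpha> + d" by (simp add: D_def)
    then show ?thesis using D by (simp add: \<rho>_def pos_less_divide_eq)
  qed
  define \<sigma> \<theta> where "\<sigma> = c\<^sup>2 * \<alpha> / D" and "\<theta> = d / D"
  have \<sigma>: "\<sigma> > 0" and \<theta>: "\<theta> > 1" using D c d \<alpha>_pos by (auto simp: \<sigma>_def \<theta>_def D_def pos_less_divide_eq)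
  note fP = free_poisson_generating_function[OF a \<rho>]
  note fB = free_binomial_generating_function[OF \<sigma> \<theta>]
  have b: "0 < a * (1 + sqrt \<rho>)\<^sup>2" using a \<rho> by (intro mult_pos_pos zero_less_power add_pos_pos) simp_all
  have ev_small: "eventually (\<lambda>w::real. 0 < w \<and> w < e) (at_right 0)" if "e > 0" for e
    using eventually_at_right_real[OF that] by simp
  have "\<tau> (V ^ n) = (\<integral>x. x ^ n \<partial>free_poisson a \<rho>)" for n
  proof (rule moments_eqI[OF fP(1,2,3) b, where K = "norm V + 1" and A = "\<lambda>x. a * x" and
        B = "\<lambda>x. a * x * (1 + \<rho>) - 1" and C = "\<lambda>x. a * x * \<rho>"])
    show "((\<lambda>x. a * x) \<longlongrightarrow> a * 0) (at_right 0)" "((\<lambda>x. a * x * (1 + \<rho>) - 1) \<longlongrightarrow> a * 0 * (1 + \<rho>) - 1) (at_right 0)"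
      by (intro tendsto_intros)+
    show "\<forall>\<^sub>F w in at_right 0. \<forall>m. m = (\<Sum>n. \<tau> (V ^ n) * w ^ n) - 1 \<longrightarrow>
        a * w * m\<^sup>2 + (a * w * (1 + \<rho>) - 1) * m + a * w * \<rho> = 0"
      using eqs(2)
    proof eventually_elim
      case (elim x)
      show ?case
      proof (intro allI impI)
        fix m assume "m = (\<Sum>n. \<tau> (V ^ n) * x ^ n) - 1"
        then have e: "x * (1 + m) * (c\<^sup>2 * \<alpha> + d + D * m) = c ^ 3 * m" using elim by (simp add: D_def)
        have "D * \<rho> = c\<^sup>2 * \<alpha> + d" "c ^ 3 * a = D" using D c by (simp_all add: \<rho>_def a_def)
        \<comment> \<open>Clearing the denominator \<open>c ^ 3\<close> of \<open>a\<close> turns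
          the moment equation of \<open>V\<close> into the quadratic equation of the free Poisson
          law.\<close>
        then have "c ^ 3 * (a * x * m\<^sup>2 + (a * x * (1 + \<rho>) - 1) * m + a * x * \<rho>) = 0" using e by algebra
        then show "a * x * m\<^sup>2 + (a * x * (1 + \<rho>) - 1) * m + a * x * \<rho> = 0" using c by simp
      qed
    qed
    show "\<forall>\<^sub>F w in at_right 0. \<forall>m. m = (\<integral>x. 1 / (1 - w * x) \<partial>free_poisson a \<rho>) - 1 \<longrightarrow>
        a * w * m\<^sup>2 + (a * w * (1 + \<rho>) - 1) * m + a * w * \<rho> = 0"
      using ev_small[OF divide_pos_pos[OF zero_less_one b]]
    proof eventually_elim
      case (elim w)
      then have "w * (a * (1 + sqrt \<rho>)\<^sup>2) < 1" using b by (simp add: pos_less_divide_eq)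
      then show ?case using fP(4)[of w] elim b by simp
    qed
  qed (use fp.\<tau>_power_bound[of V] VF in \<open>auto simp: add_nonneg_pos\<close>)
  then have V_distr: "has_distribution \<phi> V (free_poisson a \<rho>)" by (rule distr[OF V_A V_sa fP(1,2,3)])
  have "\<tau> (U ^ n) = (\<integral>x. x ^ n \<partial>free_binomial \<sigma> \<theta>)" for n
  proof (rule moments_eqI[OF fB(1,2,3) zero_less_one, where K = "norm U + 1" and A = "\<lambda>w. 1 - w" and
        B = "\<lambda>w. \<sigma> + \<theta> - w * (1 + \<sigma>)" and C = "\<lambda>w. - (w * \<sigma>)"])
    show "((\<lambda>w. 1 - w) \<longlongrightarrow> 1 - 0) (at_right (0::real))" "((\<lambda>w. \<sigma> + \<theta> - w * (1 + \<sigma>)) \<longlongrightarrow> \<sigma> + \<theta> - 0 * (1 + \<sigma>)) (at_right 0)"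
      by (intro tendsto_intros)+
    show "\<forall>\<^sub>F w in at_right 0. \<forall>m. m = (\<Sum>n. \<tau> (U ^ n) * w ^ n) - 1 \<longrightarrow>
        (1 - w) * m\<^sup>2 + (\<sigma> + \<theta> - w * (1 + \<sigma>)) * m + - (w * \<sigma>) = 0"
      using eqs(1)
    proof eventually_elim
      case (elim w)
      show ?case
      proof (intro allI impI)
        fix m assume "m = (\<Sum>n. \<tau> (U ^ n) * w ^ n) - 1"
        then have e: "w * (1 + m) * (c\<^sup>2 * \<alpha> + D * m) = m * (c\<^sup>2 * \<alpha> + d + D * m)" using elim by (simp add: D_def)
        have "D * \<sigma> = c\<^sup>2 * \<alpha>" "D * \<theta> = d" using D by (simp_all add: \<sigma>_def \<theta>_def)
        \<comment> \<open>The denominator shared by \<open>\<sigma>\<close> and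
          \<open>\<theta>\<close> is \<open>D\<close>; multiplied by it, the free binomial quadratic
          is the moment equation of \<open>U\<close> rearranged.\<close>
        then have "D * ((1 - w) * m\<^sup>2 + (\<sigma> + \<theta> - w * (1 + \<sigma>)) * m + - (w * \<sigma>)) = 0" using e by algebra
        then show "(1 - w) * m\<^sup>2 + (\<sigma> + \<theta> - w * (1 + \<sigma>)) * m + - (w * \<sigma>) = 0" using D by simp
      qed
    qed
    show "\<forall>\<^sub>F w in at_right 0. \<forall>m. m = (\<integral>x. 1 / (1 - w * x) \<partial>free_binomial \<sigma> \<theta>) - 1 \<longrightarrow>
        (1 - w) * m\<^sup>2 + (\<sigma> + \<theta> - w * (1 + \<sigma>)) * m + - (w * \<sigma>) = 0"
      using ev_small[OF zero_less_one]
    proof eventually_elim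
      case (elim w)
      then show ?case using fB(4)[of w] by simp
    qed
  qed (use fp.\<tau>_power_bound[of U] UF \<sigma> \<theta> in \<open>auto simp: add_nonneg_pos\<close>)
  then have "has_distribution \<phi> U (free_binomial \<sigma> \<theta>)" by (rule distr[OF U_A U_sa fB(1,2,3)])
  with dc V_distr show ?thesis by (simp add: a_def \<rho>_def \<sigma>_def \<theta>_def D_def)
qed

end
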